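(* Let $d\ge2$ and let $W$ be the dihedral group of order $4d$ (symmetries of a regular $2d$-gon) acting on its two-dimensional reflection representation $\mathfrak{h}$, with real parameters $(c_1,c_2)$. (i) $U(\mathbb{C})$ is the union of the region defined by the inequalities $c_1+c_2<\frac1d$, $c_1\le\frac12$, $c_2\le\frac12$ with the line $c_1+c_2=\frac1d$. (ii) If $1\le l\le d-1$, then $U(\tau_l)$ is the rectangle defined by the inequalities $|c_1+c_2|\le\frac ld$ and $|c_1-c_2|\le\frac{d-l}{d}$.
   Context: $W$ has two conjugacy classes of reflections, represented by Coxeter generators $s_1,s_2$ with $(s_1s_2)^{2d}=1$; $c_1,c_2\in\mathbb{R}$ are the values of the parameter function $c$ on the classes of $s_1$ and $s_2$. $\mathbb{C}$ is the trivial representation, and $\tau_l$ ($1\le l\le d-1$) is the two-dimensional irreducible representation in which the counterclockwise rotation by $2\pi/(2d)$ acts with eigenvalues $\zeta^l,\bar\zeta^l$, $\zeta=e^{2\pi i/(2d)}$; $\mathfrak{h}=\tau_1$. $\mathfrak{h}$ is the complexification of the Euclidean plane $\mathfrak{h}_{\mathbb R}$ with the induced positive definite Hermitian product. Let $S$ be the set of reflections; for $s\in S$ let $\alpha_s\in\mathfrak{h}^*$ generate $\mathrm{Im}(s-1)|_{\mathfrak{h}^*}$ and $\alpha_s^\vee\in\mathfrak{h}$ generate $\mathrm{Im}(s-1)|_{\mathfrak{h}}$, with $(\alpha_s,\alpha_s^\vee)=2$. $H_c(W,\mathfrak{h})$ is the quotient of $\mathbb{C}W\ltimes T(\mathfrak{h}\oplus\mathfrak{h}^*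 )$ by $[x,x']=0$, $[y,y']=0$, $[y,x]=(y,x)-\sum_{s\in S}c_s(y,\alpha_s)(x,\alpha_s^\vee)s$ for $x,x'\in\mathfrak{h}^*$, $y,y'\in\mathfrak{h}$. For an irreducible representation $\tau$ of $W$, $M_c(\tau)=H_c(W,\mathfrak{h})\otimes_{\mathbb{C}W\ltimes S\mathfrak{h}}\tau$ (with $\mathfrak{h}$ acting on $\tau$ by $0$), and $L_c(\tau)$ is its unique irreducible quotient. Let $T:\mathfrak{h}\to\mathfrak{h}^*$ be the antilinear isomorphism $(Ty_1)(y_2)=(y_2,y_1)$. Fix a $W$-invariant positive definite Hermitian form on $\tau$; it extends uniquely to a $W$-invariant Hermitian form on $M_c(\tau)$ with $(yv,v')=(v,Ty\cdot v')$, whose kernel is the maximal proper submodule. $L_c(\tau)$ is unitary if the induced form is positive definite, and $U(\tau)\subset\mathbb{R}^2$ is the set of $(c_1,c_2)$ for which $L_c(\tau)$ is unitary. *)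

theory Defs
  imports "HOL-Analysis.Analysis" "HOL-Algebra.Algebra"
begin

section \<open>The dihedral group and its reflection representation\<close>

definition polygon :: "nat \<Rightarrow> (real^2) set" where
  "polygon n = (\<lambda>k. vector [cos (2 * pi * real k / real n), sin (2 * pi * real k / real n)]) ` {..<n}"

definition dihedral :: "nat \<Rightarrow> (real^2^2) set" where
  "dihedral d = {w. orthogonal_matrix w \<and> (*v) w ` polygon (2 * d) = polygon (2 * d)}"

definition dihedral_group :: "nat \<Rightarrow> (real^2^2) monoid" where
  "dihedral_group d = \<lparr>carrier = dihedral d, mult = (**), one = mat 1\<rparr>"

definition rotation :: "nat \<Rightarrow> real^2^2" where
  "rotation d = vector [vector [cos (2 * pi / real (2 * d)), - sin (2 * pi / real (2 * d))],
                        vector [sin (2 * pi / real (2 * d)),   cos (2 * pi / real (2 * d))]]"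

definition reflections :: "nat \<Rightarrow> (real^2^2) set" where
  "reflections d = {s \<in> dihedral d. rank (s - mat 1) = 1}"

definition coxeter_generators :: "nat \<Rightarrow> real^2^2 \<Rightarrow> real^2^2 \<Rightarrow> bool" where
  "coxeter_generators d s1 s2 \<longleftrightarrow>
     s1 \<in> reflections d \<and> s2 \<in> reflections d \<and>
     generate (dihedral_group d) {s1, s2} = dihedral d \<and>
     group.ord (dihedral_group d) (s1 ** s2) = 2 * d"

text \<open>The parameter function with value \<open>c1\<close> on the conjugacy class of \<open>s1\<close>; the remaining
  reflections form the class of the other Coxeter generator.\<close>

definition param :: "nat \<Rightarrow> real^2^2 \<Rightarrow> real \<Rightarrow> real \<Rightarrow> real^2^2 \<Rightarrow> real" where
  "param d s1 c1 c2 s = (if \<exists>w \<in> dihedral d. s = w ** s1 ** matrix_inv w then c1 else c2)"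

text \<open>Vectors of \<open>h\<close> and of its dual are both coordinate vectors in \<open>complex^2\<close>, with respect to the
  standard basis of the complexified plane and its dual basis. The dual carries the contragredient
  action \<open>x \<mapsto> x \<circ> w\<^sup>-\<^sup>1\<close>.\<close>

definition pairing :: "complex^2 \<Rightarrow> complex^2 \<Rightarrow> complex" where
  "pairing y x = (\<Sum>i\<in>UNIV. y $ i * x $ i)"

definition act_h :: "real^2^2 \<Rightarrow> complex^2 \<Rightarrow> complex^2" where
  "act_h w y = map_matrix complex_of_real w *v y"

definition act_dual :: "real^2^2 \<Rightarrow> complex^2 \<Rightarrow> complex^2" where
  "act_dual w x = x v* map_matrix complex_of_real (matrix_inv w)"

definition herm_h :: "complex^2 \<Rightarrow> complex^2 \<Rightarrow> complex" where
  "herm_h y y' = (\<Sum>i\<in>UNIV. y $ i * cnj (y' $ i))"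

definition T_map :: "complex^2 \<Rightarrow> complex^2" where
  "T_map y1 = (THE x. \<forall>y2. pairing y2 x = herm_h y2 y1)"

text \<open>A pair of a root and a coroot is determined by the reflection up to
  \<open>(\<alpha>, \<alpha>\<^sup>\<or>) \<mapsto> (k \<alpha>, k\<^sup>-\<^sup>1 \<alpha>\<^sup>\<or>)\<close>, which does not affect the defining relations below.\<close>

definition root_pair :: "real^2^2 \<Rightarrow> (complex^2) \<times> (complex^2)" where
  "root_pair s = (SOME (a, a').
     vec.span {a} = range (\<lambda>x. act_dual s x - x) \<and>
     vec.span {a'} = range (\<lambda>y. act_h s y - y) \<and>
     pairing a' a = 2)"

definition root_of :: "real^2^2 \<Rightarrow> complex^2" where
  "root_of s = fst (root_pair s)"

definition coroot_of :: "real^2^2 \<Rightarrow> complex^2" where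
  "coroot_of s = snd (root_pair s)"


section \<open>The smash product of the group algebra with the tensor algebra\<close>

datatype 'a free_mon = Free_Mon (letters: "'a list")

instantiation free_mon :: (type) monoid_add
begin

definition zero_free_mon :: "'a free_mon" where
  "zero_free_mon = Free_Mon []"

definition plus_free_mon :: "'a free_mon \<Rightarrow> 'a free_mon \<Rightarrow> 'a free_mon" where
  "plus_free_mon u v = Free_Mon (letters u @ letters v)"

instance
  by standard (simp_all add: zero_free_mon_def plus_free_mon_def)

end

text \<open>The tensor algebra of \<open>h \<oplus> h*\<close> is the free algebra on a basis, i.e. the monoid algebra of the
  free monoid on the letters \<open>LY i\<close> (basis of \<open>h\<close>) and \<open>LX i\<close> (dual basis of \<open>h*\<close>). The
  multiplication of \<open>tens\<close> is the convolution product of \<open>Poly_Mapping\<close>.\<close>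

datatype letter = LY 2 | LX 2

type_synonym tens = "letter free_mon \<Rightarrow>\<^sub>0 complex"

definition tens_const :: "complex \<Rightarrow> tens" where
  "tens_const k = Poly_Mapping.single 0 k"

definition tens_Y :: "complex^2 \<Rightarrow> tens" where
  "tens_Y y = (\<Sum>i\<in>UNIV. Poly_Mapping.single (Free_Mon [LY i]) (y $ i))"

definition tens_X :: "complex^2 \<Rightarrow> tens" where
  "tens_X x = (\<Sum>i\<in>UNIV. Poly_Mapping.single (Free_Mon [LX i]) (x $ i))"

primrec act_letter :: "real^2^2 \<Rightarrow> letter \<Rightarrow> tens" where
  "act_letter w (LY i) = tens_Y (act_h w (axis i 1))"
| "act_letter w (LX i) = tens_X (act_dual w (axis i 1))"

definition act_tens :: "real^2^2 \<Rightarrow> tens \<Rightarrow> tens" where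
  "act_tens w p = (\<Sum>m \<in> Poly_Mapping.keys p.
     tens_const (Poly_Mapping.lookup p m) * prod_list (map (act_letter w) (letters m)))"

text \<open>A function \<open>f\<close> supported on the group stands for the element \<open>\<Sum>w. f w \<cdot> w\<close>; the product is
  determined by \<open>(p u)(q v) = p u(q) u v\<close>.\<close>

definition smash :: "nat \<Rightarrow> (real^2^2 \<Rightarrow> tens) ring" where
  "smash d = \<lparr>carrier = {f. \<forall>w. w \<notin> dihedral d \<longrightarrow> f w = 0},
     mult = (\<lambda>f g w. \<Sum>u\<in>dihedral d. f u * act_tens u (g (matrix_inv u ** w))),
     one = (\<lambda>w. if w = mat 1 then 1 else 0),
     ring.zero = (\<lambda>w. 0),
     ring.add = (\<lambda>f g w. f w + g w)\<rparr>"

definition of_tens :: "tens \<Rightarrow> real^2^2 \<Rightarrow> tens" where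
  "of_tens p = (\<lambda>w. if w = mat 1 then p else 0)"

definition of_const :: "complex \<Rightarrow> real^2^2 \<Rightarrow> tens" where
  "of_const k = of_tens (tens_const k)"

definition of_Y :: "complex^2 \<Rightarrow> real^2^2 \<Rightarrow> tens" where
  "of_Y y = of_tens (tens_Y y)"

definition of_X :: "complex^2 \<Rightarrow> real^2^2 \<Rightarrow> tens" where
  "of_X x = of_tens (tens_X x)"

definition of_grp :: "real^2^2 \<Rightarrow> real^2^2 \<Rightarrow> tens" where
  "of_grp u = (\<lambda>w. if w = u then 1 else 0)"


section \<open>The rational Cherednik algebra\<close>

definition cherednik_relations :: "nat \<Rightarrow> (real^2^2 \<Rightarrow> real) \<Rightarrow> (real^2^2 \<Rightarrow> tens) set" where
  "cherednik_relations d c = (let A = smash d in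
     {of_X x \<otimes>\<^bsub>A\<^esub> of_X x' \<ominus>\<^bsub>A\<^esub> of_X x' \<otimes>\<^bsub>A\<^esub> of_X x | x x'. True} \<union>
     {of_Y y \<otimes>\<^bsub>A\<^esub> of_Y y' \<ominus>\<^bsub>A\<^esub> of_Y y' \<otimes>\<^bsub>A\<^esub> of_Y y | y y'. True} \<union>
     {(of_Y y \<otimes>\<^bsub>A\<^esub> of_X x \<ominus>\<^bsub>A\<^esub> of_X x \<otimes>\<^bsub>A\<^esub> of_Y y) \<ominus>\<^bsub>A\<^esub>
      (of_const (pairing y x) \<ominus>\<^bsub>A\<^esub>
       (\<Oplus>\<^bsub>A\<^esub>s\<in>reflections d.
          of_const (complex_of_real (c s) * pairing y (root_of s) * pairing (coroot_of s) x) \<otimes>\<^bsub>A\<^esub> of_grp s))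
      | y x. True})"

definition cherednik :: "nat \<Rightarrow> (real^2^2 \<Rightarrow> real) \<Rightarrow> (real^2^2 \<Rightarrow> tens) set ring" where
  "cherednik d c = smash d Quot (Idl\<^bsub>smash d\<^esub> (cherednik_relations d c))"

definition H_class :: "nat \<Rightarrow> (real^2^2 \<Rightarrow> real) \<Rightarrow> (real^2^2 \<Rightarrow> tens) \<Rightarrow> (real^2^2 \<Rightarrow> tens) set" where
  "H_class d c f = Idl\<^bsub>smash d\<^esub> (cherednik_relations d c) +>\<^bsub>smash d\<^esub> f"

text \<open>The algebra \<open>CW \<ltimes> Sh\<close>, with \<open>Sh\<close> presented as the tensor algebra of \<open>h\<close> modulo commutators,
  and its canonical homomorphism to the Cherednik algebra.\<close>

definition smash_h :: "nat \<Rightarrow> (real^2^2 \<Rightarrow> tens) ring" where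
  "smash_h d = (smash d)\<lparr>carrier := {f \<in> carrier (smash d).
     \<forall>w. \<forall>m \<in> Poly_Mapping.keys (f w). set (letters m) \<subseteq> range LY}\<rparr>"

definition smash_sym :: "nat \<Rightarrow> (real^2^2 \<Rightarrow> tens) set ring" where
  "smash_sym d = smash_h d Quot (Idl\<^bsub>smash_h d\<^esub>
     {of_Y y \<otimes>\<^bsub>smash_h d\<^esub> of_Y y' \<ominus>\<^bsub>smash_h d\<^esub>
      of_Y y' \<otimes>\<^bsub>smash_h d\<^esub> of_Y y | y y'. True})"

definition smash_sym_hom :: "nat \<Rightarrow> (real^2^2 \<Rightarrow> real) \<Rightarrow>
    (real^2^2 \<Rightarrow> tens) set \<Rightarrow> (real^2^2 \<Rightarrow> tens) set" where
  "smash_sym_hom d c F = (\<Union>f\<in>F. H_class d c f)"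


section \<open>Modules over noncommutative rings\<close>

text \<open>Left modules are represented by the record of \<open>HOL-Algebra.Module\<close>, whose fields inherited
  from rings, \<open>mult\<close> and \<open>one\<close>, play no role. (The locale \<open>module\<close> itself requires a commutative
  ring.)\<close>

text \<open>The tensor product \<open>H \<otimes>\<^sub>B N\<close> along a ring homomorphism \<open>\<phi> : B \<rightarrow> H\<close>.\<close>

definition tensor_relations ::
    "'h ring \<Rightarrow> 'b ring \<Rightarrow> ('b \<Rightarrow> 'h) \<Rightarrow> ('b, 'n) module \<Rightarrow> (('h \<times> 'n) \<Rightarrow>\<^sub>0 int) set" where
  "tensor_relations H B \<phi> N =
     generate (free_Abelian_group (carrier H \<times> carrier N))
      ({frag_of (a \<oplus>\<^bsub>H\<^esub> a', v) - frag_of (a, v) - frag_of (a', v) | a a' v.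
          a \<in> carrier H \<and> a' \<in> carrier H \<and> v \<in> carrier N} \<union>
       {frag_of (a, v \<oplus>\<^bsub>N\<^esub> v') - frag_of (a, v) - frag_of (a, v') | a v v'.
          a \<in> carrier H \<and> v \<in> carrier N \<and> v' \<in> carrier N} \<union>
       {frag_of (a \<otimes>\<^bsub>H\<^esub> \<phi> b, v) - frag_of (a, b \<odot>\<^bsub>N\<^esub> v) | a b v.
          a \<in> carrier H \<and> b \<in> carrier B \<and> v \<in> carrier N})"

definition tensor_module ::
    "'h ring \<Rightarrow> 'b ring \<Rightarrow> ('b \<Rightarrow> 'h) \<Rightarrow> ('b, 'n) module \<Rightarrow> ('h, (('h \<times> 'n) \<Rightarrow>\<^sub>0 int) set) module" where
  "tensor_module H B \<phi> N =
    (let F = free_Abelian_group (carrier H \<times> carrier N); R = tensor_relations H B \<phi> N in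
     \<lparr>carrier = carrier (F Mod R), mult = undefined, one = undefined,
      ring.zero = \<one>\<^bsub>F Mod R\<^esub>, ring.add = mult (F Mod R),
      smult = (\<lambda>a t. \<Union>z\<in>t. R #>\<^bsub>F\<^esub> frag_extend (\<lambda>(b, v). frag_of (a \<otimes>\<^bsub>H\<^esub> b, v)) z)\<rparr>)"

definition pure_tensor ::
    "'h ring \<Rightarrow> 'b ring \<Rightarrow> ('b \<Rightarrow> 'h) \<Rightarrow> ('b, 'n) module \<Rightarrow> 'h \<Rightarrow> 'n \<Rightarrow> (('h \<times> 'n) \<Rightarrow>\<^sub>0 int) set" where
  "pure_tensor H B \<phi> N a v =
     tensor_relations H B \<phi> N #>\<^bsub>free_Abelian_group (carrier H \<times> carrier N)\<^esub> frag_of (a, v)"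

definition quotient_module :: "('r, 'm) module \<Rightarrow> 'm set \<Rightarrow> ('r, 'm set) module" where
  "quotient_module M J =
     \<lparr>carrier = a_rcosets\<^bsub>M\<^esub> J, mult = undefined, one = undefined,
      ring.zero = J, ring.add = set_add M,
      smult = (\<lambda>r U. \<Union>m\<in>U. J +>\<^bsub>M\<^esub> (r \<odot>\<^bsub>M\<^esub> m))\<rparr>"

definition maximal_proper_submodule :: "'r ring \<Rightarrow> ('r, 'm) module \<Rightarrow> 'm set \<Rightarrow> bool" where
  "maximal_proper_submodule R M J \<longleftrightarrow>
     submodule J R M \<and> J \<noteq> carrier M \<and>
     (\<forall>K. submodule K R M \<and> J \<subseteq> K \<longrightarrow> K = J \<or> K = carrier M)"


section \<open>Representations of the dihedral group\<close>

text \<open>Representations are matrix-valued; only the values on the group matter.\<close>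

definition is_representation :: "nat \<Rightarrow> (real^2^2 \<Rightarrow> complex^'n^'n) \<Rightarrow> bool" where
  "is_representation d \<rho> \<longleftrightarrow> \<rho> (mat 1) = mat 1 \<and>
     (\<forall>u\<in>dihedral d. \<forall>w\<in>dihedral d. \<rho> (u ** w) = \<rho> u ** \<rho> w)"

definition is_irreducible :: "nat \<Rightarrow> (real^2^2 \<Rightarrow> complex^'n^'n) \<Rightarrow> bool" where
  "is_irreducible d \<rho> \<longleftrightarrow> is_representation d \<rho> \<and>
     (\<forall>V. vec.subspace V \<and> (\<forall>w\<in>dihedral d. (*v) (\<rho> w) ` V \<subseteq> V) \<longrightarrow> V = {0} \<or> V = UNIV)"

definition trivial_rep :: "real^2^2 \<Rightarrow> complex^1^1" where
  "trivial_rep w = mat 1"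

definition is_tau :: "nat \<Rightarrow> nat \<Rightarrow> (real^2^2 \<Rightarrow> complex^2^2) \<Rightarrow> bool" where
  "is_tau d l \<rho> \<longleftrightarrow> is_irreducible d \<rho> \<and>
     (let \<zeta> = exp (2 * of_real pi * \<i> / of_nat (2 * d)) in
      {k. \<exists>v. v \<noteq> 0 \<and> \<rho> (rotation d) *v v = k *s v} = {\<zeta> ^ l, cnj \<zeta> ^ l})"

definition is_invariant_inner_product :: "nat \<Rightarrow> (real^2^2 \<Rightarrow> complex^'n^'n) \<Rightarrow>
    (complex^'n \<Rightarrow> complex^'n \<Rightarrow> complex) \<Rightarrow> bool" where
  "is_invariant_inner_product d \<rho> h \<longleftrightarrow>
     (\<forall>u u' v. h (u + u') v = h u v + h u' v) \<and>
     (\<forall>k u v. h (k *s u) v = k * h u v) \<and>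
     (\<forall>u v. h v u = cnj (h u v)) \<and>
     (\<forall>v. v \<noteq> 0 \<longrightarrow> 0 < Re (h v v)) \<and>
     (\<forall>w\<in>dihedral d. \<forall>u v. h (\<rho> w *v u) (\<rho> w *v v) = h u v)"


section \<open>Standard modules, their simple quotients and unitarity\<close>

text \<open>On \<open>\<tau>\<close> an element \<open>\<Sum>w. p w \<cdot> w\<close> acts through the constant terms of the \<open>p w\<close>, since \<open>h\<close> acts
  by zero; this does not depend on the representative of a class in \<open>smash_sym\<close>.\<close>

definition rep_module :: "nat \<Rightarrow> (real^2^2 \<Rightarrow> complex^'n^'n) \<Rightarrow>
    ((real^2^2 \<Rightarrow> tens) set, complex^'n) module" where
  "rep_module d \<rho> =
     \<lparr>carrier = UNIV, mult = undefined, one = undefined, ring.zero = 0, ring.add = (+),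
      smult = (\<lambda>F v. let f = (SOME f. f \<in> F) in
         \<Sum>w\<in>dihedral d. Poly_Mapping.lookup (f w) 0 *s (\<rho> w *v v))\<rparr>"

type_synonym 'n std = "(((real^2^2 \<Rightarrow> tens) set \<times> (complex^'n)) \<Rightarrow>\<^sub>0 int) set"

definition standard_module :: "nat \<Rightarrow> (real^2^2 \<Rightarrow> real) \<Rightarrow> (real^2^2 \<Rightarrow> complex^'n^'n) \<Rightarrow>
    ((real^2^2 \<Rightarrow> tens) set, 'n std) module" where
  "standard_module d c \<rho> =
     tensor_module (cherednik d c) (smash_sym d) (smash_sym_hom d c) (rep_module d \<rho>)"

definition lowest_weight_vector :: "nat \<Rightarrow> (real^2^2 \<Rightarrow> real) \<Rightarrow> (real^2^2 \<Rightarrow> complex^'n^'n) \<Rightarrow>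
    complex^'n \<Rightarrow> 'n std" where
  "lowest_weight_vector d c \<rho> v =
     pure_tensor (cherednik d c) (smash_sym d) (smash_sym_hom d c) (rep_module d \<rho>)
       \<one>\<^bsub>cherednik d c\<^esub> v"

definition max_submodule :: "nat \<Rightarrow> (real^2^2 \<Rightarrow> real) \<Rightarrow> (real^2^2 \<Rightarrow> complex^'n^'n) \<Rightarrow>
    'n std set" where
  "max_submodule d c \<rho> = (THE J. maximal_proper_submodule (cherednik d c) (standard_module d c \<rho>) J)"

definition simple_module :: "nat \<Rightarrow> (real^2^2 \<Rightarrow> real) \<Rightarrow> (real^2^2 \<Rightarrow> complex^'n^'n) \<Rightarrow>
    ((real^2^2 \<Rightarrow> tens) set, 'n std set) module" where
  "simple_module d c \<rho> = quotient_module (standard_module d c \<rho>) (max_submodule d c \<rho>)"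

text \<open>Forms are linear in the first and antilinear in the second argument.\<close>

definition is_contravariant_form :: "nat \<Rightarrow> (real^2^2 \<Rightarrow> real) \<Rightarrow> (real^2^2 \<Rightarrow> complex^'n^'n) \<Rightarrow>
    (complex^'n \<Rightarrow> complex^'n \<Rightarrow> complex) \<Rightarrow> ('n std \<Rightarrow> 'n std \<Rightarrow> complex) \<Rightarrow> bool" where
  "is_contravariant_form d c \<rho> h \<beta> \<longleftrightarrow>
    (let M = standard_module d c \<rho> in
     (\<forall>m\<in>carrier M. \<forall>m'\<in>carrier M. \<forall>n\<in>carrier M. \<beta> (m \<oplus>\<^bsub>M\<^esub> m') n = \<beta> m n + \<beta> m' n) \<and>
     (\<forall>k. \<forall>m\<in>carrier M. \<forall>n\<in>carrier M.
        \<beta> (H_class d c (of_const k) \<odot>\<^bsub>M\<^esub> m) n = k * \<beta> m n) \<and>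
     (\<forall>m\<in>carrier M. \<forall>n\<in>carrier M. \<beta> n m = cnj (\<beta> m n)) \<and>
     (\<forall>w\<in>dihedral d. \<forall>m\<in>carrier M. \<forall>n\<in>carrier M.
        \<beta> (H_class d c (of_grp w) \<odot>\<^bsub>M\<^esub> m) (H_class d c (of_grp w) \<odot>\<^bsub>M\<^esub> n) = \<beta> m n) \<and>
     (\<forall>y. \<forall>m\<in>carrier M. \<forall>n\<in>carrier M.
        \<beta> (H_class d c (of_Y y) \<odot>\<^bsub>M\<^esub> m) n =
        \<beta> m (H_class d c (of_X (T_map y)) \<odot>\<^bsub>M\<^esub> n)) \<and>
     (\<forall>u v. \<beta> (lowest_weight_vector d c \<rho> u) (lowest_weight_vector d c \<rho> v) = h u v))"

definition is_induced_form :: "nat \<Rightarrow> (real^2^2 \<Rightarrow> real) \<Rightarrow> (real^2^2 \<Rightarrow> complex^'n^'n) \<Rightarrow>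
    ('n std \<Rightarrow> 'n std \<Rightarrow> complex) \<Rightarrow> ('n std set \<Rightarrow> 'n std set \<Rightarrow> complex) \<Rightarrow> bool" where
  "is_induced_form d c \<rho> \<beta> \<gamma> \<longleftrightarrow>
    (let M = standard_module d c \<rho>; J = max_submodule d c \<rho> in
     \<forall>m\<in>carrier M. \<forall>n\<in>carrier M. \<gamma> (J +>\<^bsub>M\<^esub> m) (J +>\<^bsub>M\<^esub> n) = \<beta> m n)"

text \<open>The contravariant form extending \<open>h\<close> exists and is unique, and the form it induces on the
  simple module is well defined, so the existential quantifiers merely name these forms.\<close>

definition is_unitary :: "nat \<Rightarrow> (real^2^2 \<Rightarrow> real) \<Rightarrow> (real^2^2 \<Rightarrow> complex^'n^'n) \<Rightarrow>
    (complex^'n \<Rightarrow> complex^'n \<Rightarrow> complex) \<Rightarrow> bool" where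
  "is_unitary d c \<rho> h \<longleftrightarrow>
     (\<exists>\<beta> \<gamma>. is_contravariant_form d c \<rho> h \<beta> \<and> is_induced_form d c \<rho> \<beta> \<gamma> \<and>
       (\<forall>v\<in>carrier (simple_module d c \<rho>). v \<noteq> \<zero>\<^bsub>simple_module d c \<rho>\<^esub> \<longrightarrow> 0 < Re (\<gamma> v v)))"

definition unitary_locus :: "nat \<Rightarrow> real^2^2 \<Rightarrow> (real^2^2 \<Rightarrow> complex^'n^'n) \<Rightarrow>
    (complex^'n \<Rightarrow> complex^'n \<Rightarrow> complex) \<Rightarrow> (real \<times> real) set" where
  "unitary_locus d s1 \<rho> h = {(c1, c2). is_unitary d (param d s1 c1 c2) \<rho> h}"

end

theory Submission
  imports Defs
begin

text \<open>By the normal form of words in the Cherednik algebra, the standard module is the space of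
  \<open>\<tau>\<close>-valued polynomials with \<open>h\<close> acting by Dunkl operators. The kernel of a contravariant form is the
  largest proper submodule, because the Euler element separates degrees; so \<open>L(\<tau>)\<close> is unitary iff the
  contravariant form on polynomials is positive semidefinite.

  Let \<open>\<kappa>\<close> be the scalar by which \<open>C = \<Sum> c\<^sub>s s\<close> acts on \<open>\<tau>\<close>. If \<open>u\<close> is homogeneous of degree \<open>n\<close> and
  \<open>C u = \<mu> u\<close>, then \<open>(n - \<kappa> + \<mu>) (u, u) = \<Sum>\<^sub>i (D\<^sub>i u, D\<^sub>i u)\<close>. Here \<open>\<mu>\<close> is \<open>\<plusminus> d (c\<^sub>1 + c\<^sub>2)\<close> on vectors fixed by the
  rotations, \<open>\<plusminus> d (c\<^sub>1 - c\<^sub>2)\<close> on vectors on which the generating rotation acts by \<open>-1\<close>, and \<open>0\<close> on the other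
  rotation weight spaces. Hence the form is positive semidefinite as soon as \<open>n - \<kappa> + \<mu> \<ge> 0\<close> in the first
  degrees in which these two weights occur: \<open>l\<close> and \<open>d - l\<close> for \<open>\<tau>\<^sub>l\<close>, where \<open>\<kappa> = 0\<close>, and \<open>2\<close> and \<open>d\<close> for the
  trivial representation, where \<open>\<kappa> = d (c\<^sub>1 + c\<^sub>2)\<close>. Conversely, the vectors \<open>z\<^sup>n v \<plusminus> s z\<^sup>n v\<close> of degrees \<open>l\<close>
  and \<open>d - l\<close> (for the trivial representation, of degree \<open>d\<close>) have norm a positive multiple of
  \<open>n - \<kappa> \<plusminus> \<mu>\<close>, and the linear polynomial \<open>z\<close> has norm a positive multiple of \<open>1 - \<kappa>\<close>. On the line \<open>\<kappa> = 1\<close> all linear polynomials are singular and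
  \<open>L(\<tau>)\<close> is one-dimensional.\<close>

section \<open>The dihedral group and its reflections\<close>

text \<open>The standard module is a quotient of a free abelian group by relations over a quotient
  ring, so nothing shows at first that it does not collapse. Operators are therefore built first, on
  a concrete space of polynomials. Once they satisfy the Cherednik relations, the evaluation
  \<open>ev\<close> is well defined on the tensor product; the monomials in z and w give a section
  \<open>sect\<close>, and the two are inverse once every generator respects \<open>sect\<close>.
  The Dunkl operators come from the prescribed commutators by recursion on monomials, with no
  division by linear forms; the price is that independence of the order of factors and commutativity
  must be proved.

  The Euler identity rests on sum x_i y_i - C having commutator x with every linear form x. The
  values of \<mu> come from a Fourier expansion: by parity of the index, c is (p + q)/2 + (-1)^k (p
  - q)/2 on the k-th reflection, so C sees only the rotation characters 1 and -1. Since n - \<kappa>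
  + \<mu> grows with n, the first degree in which a character occurs gives the strongest
  condition.\<close>

lemma vec2_eq_iff: "x = y \<longleftrightarrow> x $ 1 = y $ 1 \<and> x $ 2 = y $ 2" for x y :: "'a^2"
  by (simp add: vec_eq_iff forall_2)

lemma mat2_eq_iff: "A = B \<longleftrightarrow> A $ 1 $ 1 = B $ 1 $ 1 \<and> A $ 1 $ 2 = B $ 1 $ 2 \<and>
    A $ 2 $ 1 = B $ 2 $ 1 \<and> A $ 2 $ 2 = B $ 2 $ 2" for A B :: "'a^2^2"
  by (simp add: vec2_eq_iff)

section \<open>Rotations and reflections of the plane\<close>

definition rotm :: "real \<Rightarrow> real^2^2" where
  "rotm t = vector [vector [cos t, - sin t], vector [sin t, cos t]]"

text \<open>The mirror of \<open>refm t\<close> is the line at angle t/2. Indexing by t rather than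
  by the mirror makes every rule in \<open>plane_mult\<close> a sum or difference of angles.\<close>

definition refm :: "real \<Rightarrow> real^2^2" where
  "refm t = vector [vector [cos t, sin t], vector [sin t, - cos t]]"

definition vertex :: "real \<Rightarrow> real^2" where
  "vertex t = vector [cos t, sin t]"

lemma rotm_nth [simp]: "rotm t $ 1 $ 1 = cos t" "rotm t $ 1 $ 2 = - sin t"
    "rotm t $ 2 $ 1 = sin t" "rotm t $ 2 $ 2 = cos t"
  by (simp_all add: rotm_def)

lemma refm_nth [simp]: "refm t $ 1 $ 1 = cos t" "refm t $ 1 $ 2 = sin t"
    "refm t $ 2 $ 1 = sin t" "refm t $ 2 $ 2 = - cos t"
  by (simp_all add: refm_def)

lemma vertex_nth [simp]: "vertex t $ 1 = cos t" "vertex t $ 2 = sin t"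
  by (simp_all add: vertex_def)

lemma mat2_nth [simp]: "(mat 1 :: 'a::{zero,one}^2^2) $ 1 $ 1 = 1" "(mat 1 :: 'a^2^2) $ 1 $ 2 = 0"
    "(mat 1 :: 'a^2^2) $ 2 $ 1 = 0" "(mat 1 :: 'a^2^2) $ 2 $ 2 = 1"
  by (simp_all add: mat_def)

lemmas mult2_simps = matrix_matrix_mult_def matrix_vector_mult_def vector_matrix_mult_def sum_2

lemma rotm_mult_rotm: "rotm a ** rotm b = rotm (a + b)"
  and rotm_mult_refm: "rotm a ** refm b = refm (a + b)"
  and refm_mult_rotm: "refm a ** rotm b = refm (a - b)"
  and refm_mult_refm: "refm a ** refm b = rotm (a - b)"
  by (simp_all add: mat2_eq_iff mult2_simps sin_add cos_add sin_diff cos_diff)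

lemmas plane_mult = rotm_mult_rotm rotm_mult_refm refm_mult_rotm refm_mult_refm

lemma rotm_vertex: "rotm a *v vertex b = vertex (a + b)"
  and refm_vertex: "refm a *v vertex b = vertex (a - b)"
  by (simp_all add: vec2_eq_iff mult2_simps sin_add cos_add sin_diff cos_diff)

lemma rotm_0: "rotm 0 = mat 1"
  by (simp add: mat2_eq_iff)

lemma transpose_rotm: "transpose (rotm a) = rotm (- a)"
  and transpose_refm: "transpose (refm a) = refm a"
  by (simp_all add: mat2_eq_iff transpose_def)

lemma orthogonal_rotm: "orthogonal_matrix (rotm a)"
  and orthogonal_refm: "orthogonal_matrix (refm a)"
  by (simp_all add: orthogonal_matrix transpose_rotm transpose_refm plane_mult rotm_0)

lemma matrix_inv_orthogonal:
  assumes "orthogonal_matrix (w :: real^2^2)"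
  shows "matrix_inv w = transpose w"
proof -
  have 1: "w ** transpose w = mat 1" "transpose w ** w = mat 1"
    using assms by (simp_all add: orthogonal_matrix_def)
  then have "invertible w" unfolding invertible_def by blast
  then have "w ** matrix_inv w = mat 1 \<and> matrix_inv w ** w = mat 1"
    unfolding matrix_inv_def invertible_def by (rule someI_ex)
  then show ?thesis
    by (metis 1(2) matrix_mul_assoc matrix_mul_lid matrix_mul_rid)
qed

lemma matrix_inv_rotm: "matrix_inv (rotm a) = rotm (- a)"
  and matrix_inv_refm: "matrix_inv (refm a) = refm a"
  by (simp_all add: matrix_inv_orthogonal orthogonal_rotm orthogonal_refm transpose_rotm transpose_refm)

text \<open>The first column is a unit vector (cos t, sin t). The second is orthogonal to it, hence
  \<open>k\<close> times its quarter turn, where \<open>k\<close> is the determinant; Lagrange's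
  identity gives k^2 = 1.\<close>

lemma orthogonal_matrix_plane:
  assumes "orthogonal_matrix w"
  obtains t where "w = rotm t \<or> w = refm t"
proof -
  define a b c e where "a = w $ 1 $ 1" "b = w $ 2 $ 1" "c = w $ 1 $ 2" "e = w $ 2 $ 2"
  note df = this
  have "transpose w ** w = mat 1" using assms by (simp add: orthogonal_matrix)
  then have h: "a * a + b * b = 1" "a * c + b * e = 0" "c * c + e * e = 1"
    by (simp_all add: mat2_eq_iff mult2_simps transpose_def df)
  obtain t where t: "a = cos t" "b = sin t"
    using sincos_total_2pi[of a b] h(1) by (metis power2_eq_square)
  define k where "k = a * e - b * c"
  have c: "c = - b * k"
  proof -
    have "- b * k = c * (a * a + b * b) - a * (a * c + b * e)" unfolding k_def by (simp add: algebra_simps)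
    then show ?thesis using h by simp
  qed
  have e: "e = a * k"
  proof -
    have "a * k = e * (a * a + b * b) - b * (a * c + b * e)" unfolding k_def by (simp add: algebra_simps)
    then show ?thesis using h by simp
  qed
  have "k * k = (c * c + e * e) * (a * a + b * b) - (a * c + b * e)^2" unfolding k_def by (simp add: algebra_simps power2_eq_square)
  then have "k * k = 1" using h by simp
  then have "k = 1 \<or> k = -1" by (metis mult_cancel_left2 mult_minus_left square_eq_1_iff)
  then have "w = rotm t \<or> w = refm t"
    using c e t df by (auto simp: mat2_eq_iff)
  then show ?thesis using that by blast
qed

section \<open>The dihedral group, indexed by integers modulo 2d\<close>

definition ang :: "nat \<Rightarrow> int \<Rightarrow> real" where
  "ang d k = pi * of_int k / real d"

lemma ang_add: "ang d (j + k) = ang d j + ang d k"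
  and ang_diff: "ang d (j - k) = ang d j - ang d k"
  and ang_minus: "ang d (- k) = - ang d k"
  and ang_0: "ang d 0 = 0"
  and ang_double: "ang d (2 * k) = 2 * ang d k"
  by (simp_all add: ang_def algebra_simps add_divide_distrib diff_divide_distrib)

lemma sin_cos_ang_eq_iff:
  assumes "d > 0"
  shows "sin (ang d j) = sin (ang d k) \<and> cos (ang d j) = cos (ang d k) \<longleftrightarrow> int (2 * d) dvd j - k"
proof -
  have "ang d j = ang d k + 2 * pi * of_int n \<longleftrightarrow> j = k + int (2 * d) * n" for n
  proof -
    have "ang d j = ang d k + 2 * pi * of_int n \<longleftrightarrow>
        pi * of_int j = pi * of_int k + pi * (2 * of_int n * real d)"
      using assms by (simp add: ang_def field_simps)
    also have "\<dots> \<longleftrightarrow> pi * of_int j = pi * of_int (k + int (2 * d) * n)"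
      by (simp add: algebra_simps)
    also have "\<dots> \<longleftrightarrow> (of_int j :: real) = of_int (k + int (2 * d) * n)"
      using pi_neq_zero by (metis mult_left_cancel)
    also have "\<dots> \<longleftrightarrow> j = k + int (2 * d) * n" using of_int_eq_iff by blast
    finally show ?thesis .
  qed
  then show ?thesis
    unfolding sin_cos_eq_iff dvd_def by (auto simp: algebra_simps)
qed

lemma vertex_ang_eq_iff: "d > 0 \<Longrightarrow> vertex (ang d j) = vertex (ang d k) \<longleftrightarrow> int (2 * d) dvd j - k"
  using sin_cos_ang_eq_iff[of d j k] by (auto simp: vec2_eq_iff)

lemma refm_ang_eq_iff: "d > 0 \<Longrightarrow> refm (ang d j) = refm (ang d k) \<longleftrightarrow> int (2 * d) dvd j - k"
  using sin_cos_ang_eq_iff[of d j k] by (auto simp: mat2_eq_iff)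

lemma rotm_ang_eq_iff: "d > 0 \<Longrightarrow> rotm (ang d j) = rotm (ang d k) \<longleftrightarrow> int (2 * d) dvd j - k"
  using sin_cos_ang_eq_iff[of d j k] by (auto simp: mat2_eq_iff)

text \<open>Integer indices keep negatives available for inverses and differences; this returns to
  the 2d indices needed for finiteness and for sums.\<close>

lemma range_ang_mod:
  assumes "d > 0" and "\<And>j k. int (2 * d) dvd j - k \<Longrightarrow> f (ang d j) = f (ang d k)"
  shows "range (\<lambda>k. f (ang d k)) = (\<lambda>k. f (ang d (int k))) ` {..<2 * d}"
proof (intro equalityI subsetI)
  fix x assume "x \<in> range (\<lambda>k. f (ang d k))"
  then obtain k where x: "x = f (ang d k)" by blast
  have "f (ang d k) = f (ang d (int (nat (k mod int (2 * d)))))"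
    using assms(1) by (intro assms(2)) (simp add: mod_eq_dvd_iff[symmetric])
  moreover have "nat (k mod int (2 * d)) < 2 * d"
    using assms(1) by (simp add: nat_less_iff)
  ultimately show "x \<in> (\<lambda>k. f (ang d (int k))) ` {..<2 * d}" using x by blast
qed auto

lemma polygon_eq:
  assumes "d > 0"
  shows "polygon (2 * d) = range (\<lambda>k. vertex (ang d k))"
proof -
  have "polygon (2 * d) = (\<lambda>k. vertex (ang d (int k))) ` {..<2 * d}"
    unfolding polygon_def vertex_def ang_def by (intro image_cong) (auto simp: field_simps)
  also have "\<dots> = range (\<lambda>k. vertex (ang d k))"
    using range_ang_mod[OF assms, of vertex] vertex_ang_eq_iff[OF assms] by auto
  finally show ?thesis .
qed

lemma range_comp_surj: "surj g \<Longrightarrow> range (\<lambda>j. f (g j)) = range f"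
  by (metis image_image)

text \<open>Both \<open>rotm t\<close> and \<open>refm t\<close> send the vertex at angle 0 to the
  vertex at angle t, so preserving the polygon forces t to be a multiple of pi/d modulo 2 pi.
  Conversely such an element permutes the vertex indices by j -> k + j or j -> k - j.\<close>

lemma dihedral_eq:
  assumes "d > 0"
  shows "dihedral d = range (\<lambda>k. rotm (ang d k)) \<union> range (\<lambda>k. refm (ang d k))"
proof (intro equalityI subsetI)
  fix w assume "w \<in> dihedral d"
  then have o: "orthogonal_matrix w" and p: "(*v) w ` polygon (2 * d) = polygon (2 * d)"
    by (auto simp: dihedral_def)
  obtain t where t: "w = rotm t \<or> w = refm t" using o by (rule orthogonal_matrix_plane)
  have "vertex (ang d 0) \<in> polygon (2 * d)" by (auto simp: polygon_eq[OF assms])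
  then have "w *v vertex (ang d 0) \<in> polygon (2 * d)" using p by blast
  then obtain k where k: "w *v vertex (ang d 0) = vertex (ang d k)"
    by (auto simp: polygon_eq[OF assms])
  moreover have "w *v vertex (ang d 0) = vertex t"
    using t by (auto simp: rotm_vertex refm_vertex ang_0)
  ultimately have "cos t = cos (ang d k)" "sin t = sin (ang d k)" by (auto simp: vec2_eq_iff)
  then have "rotm t = rotm (ang d k)" "refm t = refm (ang d k)" by (auto simp: mat2_eq_iff)
  then show "w \<in> range (\<lambda>k. rotm (ang d k)) \<union> range (\<lambda>k. refm (ang d k))" using t by auto
next
  fix w assume "w \<in> range (\<lambda>k. rotm (ang d k)) \<union> range (\<lambda>k. refm (ang d k))"
  then consider k where "w = rotm (ang d k)" | k where "w = refm (ang d k)" by blast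
  then show "w \<in> dihedral d"
  proof cases
    case 1
    have "(*v) w ` range (\<lambda>k. vertex (ang d k)) = range (\<lambda>k. vertex (ang d k))"
      unfolding 1 image_image rotm_vertex ang_add[symmetric]
      by (rule range_comp_surj) (rule surjI[of _ "\<lambda>j. j - k"], simp)
    then show ?thesis unfolding dihedral_def polygon_eq[OF assms] using 1 orthogonal_rotm by auto
  next
    case 2
    have "(*v) w ` range (\<lambda>k. vertex (ang d k)) = range (\<lambda>k. vertex (ang d k))"
      unfolding 2 image_image refm_vertex ang_diff[symmetric]
      by (rule range_comp_surj) (rule surjI[of _ "\<lambda>j. k - j"], simp)
    then show ?thesis unfolding dihedral_def polygon_eq[OF assms] using 2 orthogonal_refm by auto
  qed
qed

lemma finite_dihedral: "d > 0 \<Longrightarrow> finite (dihedral d)"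
  using range_ang_mod[of d rotm] range_ang_mod[of d refm]
  by (simp add: dihedral_eq rotm_ang_eq_iff refm_ang_eq_iff)

lemma dihedral_cases:
  assumes "d > 0" "w \<in> dihedral d"
  obtains k where "w = rotm (ang d k)" | k where "w = refm (ang d k)"
  using assms by (auto simp: dihedral_eq)

lemma rotm_in_dihedral: "d > 0 \<Longrightarrow> rotm (ang d k) \<in> dihedral d"
  and refm_in_dihedral: "d > 0 \<Longrightarrow> refm (ang d k) \<in> dihedral d"
  by (auto simp: dihedral_eq)

lemma orthogonal_dihedral: "w \<in> dihedral d \<Longrightarrow> orthogonal_matrix w"
  by (simp add: dihedral_def)

lemma mat_1_in_dihedral: "d > 0 \<Longrightarrow> mat 1 \<in> dihedral d"
  using rotm_in_dihedral[of d 0] by (simp add: ang_0 rotm_0)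

lemma dihedral_mult: "d > 0 \<Longrightarrow> u \<in> dihedral d \<Longrightarrow> w \<in> dihedral d \<Longrightarrow> u ** w \<in> dihedral d"
  by (auto simp: dihedral_eq plane_mult ang_add[symmetric] ang_diff[symmetric])

lemma dihedral_inv: "d > 0 \<Longrightarrow> w \<in> dihedral d \<Longrightarrow> matrix_inv w \<in> dihedral d"
  by (auto simp: dihedral_eq matrix_inv_rotm matrix_inv_refm ang_minus[symmetric])

lemma dihedral_inv_mult: "w \<in> dihedral d \<Longrightarrow> matrix_inv w ** w = mat 1"
  and dihedral_mult_inv: "w \<in> dihedral d \<Longrightarrow> w ** matrix_inv w = mat 1"
  using orthogonal_dihedral[of w d] by (simp_all add: matrix_inv_orthogonal orthogonal_matrix_def)

lemma dihedral_inv_inv: "w \<in> dihedral d \<Longrightarrow> matrix_inv (matrix_inv w) = w"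
  using orthogonal_dihedral[of w d] by (simp add: matrix_inv_orthogonal)

section \<open>Reflections and their conjugacy classes\<close>

lemma rank_refm: "rank (refm t - mat 1) = 1"
proof -
  have "det (refm t - mat 1) = 0"
    using sin_cos_squared_add[of t] by (simp add: det_2 algebra_simps power2_eq_square)
  then have "rank (refm t - mat 1) < 2"
    using det_eq_0_rank[of "refm t - mat 1"] by simp
  moreover have "rank (refm t - mat 1) \<noteq> 0"
    unfolding rank_eq_0 by (auto simp: mat2_eq_iff)
  ultimately show ?thesis by simp
qed

text \<open>A rotation is the identity, with rank 0 here, or has no nonzero fixed vector: the
  determinant 2 - 2 cos t is then nonzero and the rank is 2. So rank 1 singles out the
  reflections.\<close>

lemma rank_rotm: "rank (rotm t - mat 1) \<noteq> 1"
proof (cases "cos t = 1")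
  case True
  then have "sin t = 0" using sin_cos_squared_add[of t] by simp
  with True have "rotm t - mat 1 = 0" by (simp add: mat2_eq_iff)
  then show ?thesis by simp
next
  case False
  have "det (rotm t - mat 1) = 2 - 2 * cos t"
    using sin_cos_squared_add[of t] by (simp add: det_2 algebra_simps power2_eq_square)
  then have "det (rotm t - mat 1) \<noteq> 0" using False by simp
  then have "\<not> rank (rotm t - mat 1) < 2" using det_eq_0_rank[of "rotm t - mat 1"] by simp
  then show ?thesis by simp
qed

lemma reflections_eq: "d > 0 \<Longrightarrow> reflections d = range (\<lambda>k. refm (ang d k))"
  using rank_refm rank_rotm by (fastforce simp: reflections_def dihedral_eq)

lemma reflections_eq_nat:
  "d > 0 \<Longrightarrow> reflections d = (\<lambda>k. refm (ang d (int k))) ` {..<2 * d}"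
  using range_ang_mod[of d refm] by (simp add: reflections_eq refm_ang_eq_iff)

lemma reflections_subset: "reflections d \<subseteq> dihedral d"
  by (auto simp: reflections_def)

lemma finite_reflections: "d > 0 \<Longrightarrow> finite (reflections d)"
  using finite_dihedral reflections_subset finite_subset by blast

lemma reflections_cases:
  assumes "d > 0" "s \<in> reflections d"
  obtains k where "s = refm (ang d k)"
  using assms by (auto simp: reflections_eq)

lemma reflection_conj:
  assumes "d > 0" "w \<in> dihedral d" "s \<in> reflections d"
  shows "w ** s ** matrix_inv w \<in> reflections d"
  using assms by (auto simp: plane_mult matrix_inv_rotm matrix_inv_refm reflections_eq dihedral_eq
      ang_add[symmetric] ang_diff[symmetric] ang_minus[symmetric])

text \<open>Conjugation by the rotation of index k sends index i to i + 2k, and by the reflection of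
  index k to 2k - i. Parity is therefore the class invariant; it makes sense because indices count
  modulo the even number 2d.\<close>

lemma param_refm:
  assumes "d > 0"
  shows "param d (refm (ang d i)) c1 c2 (refm (ang d j)) = (if even (j - i) then c1 else c2)"
proof -
  have "(\<exists>w\<in>dihedral d. refm (ang d j) = w ** refm (ang d i) ** matrix_inv w) \<longleftrightarrow> even (j - i)"
  proof
    assume "\<exists>w\<in>dihedral d. refm (ang d j) = w ** refm (ang d i) ** matrix_inv w"
    then obtain w where w: "w \<in> dihedral d"
      and j: "refm (ang d j) = w ** refm (ang d i) ** matrix_inv w" by blast
    have "\<exists>k. refm (ang d j) = refm (ang d k) \<and> even (k - i)"
      using assms w
    proof (cases rule: dihedral_cases)
      case (1 k)
      then show ?thesis using j
        by (intro exI[of _ "k + i - - k"])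
          (auto simp: plane_mult matrix_inv_rotm ang_add ang_diff ang_minus ang_double)
    next
      case (2 k)
      then show ?thesis using j
        by (intro exI[of _ "k - i + k"])
          (auto simp: plane_mult matrix_inv_refm ang_add ang_diff ang_minus ang_double)
    qed
    then obtain k where "int (2 * d) dvd j - k" "even (k - i)"
      using refm_ang_eq_iff[OF assms] by blast
    then have "even (k - i)" and "(2::int) dvd j - k" by (blast, metis dvd_trans dvd_triv_left int_ops(3) of_nat_mult)
    then show "even (j - i)" using \<open>even (k - i)\<close> by presburger
  next
    assume "even (j - i)"
    then obtain k where k: "j - i = 2 * k" by blast
    then have "j = k + i - - k" by simp
    then have "refm (ang d j) = rotm (ang d k) ** refm (ang d i) ** matrix_inv (rotm (ang d k))"
      by (simp add: plane_mult matrix_inv_rotm ang_add ang_diff ang_minus ang_double)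
    then show "\<exists>w\<in>dihedral d. refm (ang d j) = w ** refm (ang d i) ** matrix_inv w"
      using rotm_in_dihedral[OF assms] by blast
  qed
  then show ?thesis unfolding param_def by simp
qed

lemma param_conj:
  assumes "d > 0" "s1 \<in> reflections d" "w \<in> dihedral d" "s \<in> reflections d"
  shows "param d s1 c1 c2 (w ** s ** matrix_inv w) = param d s1 c1 c2 s"
proof -
  obtain i j where s1: "s1 = refm (ang d i)" and s: "s = refm (ang d j)"
    using assms by (meson reflections_cases)
  from assms(1,3) show ?thesis
  proof (cases rule: dihedral_cases)
    case (1 k)
    have "w ** s ** matrix_inv w = refm (ang d (k + j - - k))"
      by (simp add: 1 s plane_mult matrix_inv_rotm ang_add ang_diff ang_minus ang_double)
    then show ?thesis by (simp add: s1 s param_refm[OF assms(1)])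
  next
    case (2 k)
    have "w ** s ** matrix_inv w = refm (ang d (k - j + k))"
      by (simp add: 2 s plane_mult matrix_inv_refm ang_add ang_diff ang_minus ang_double)
    then show ?thesis by (simp add: s1 s param_refm[OF assms(1)])
  qed
qed

section \<open>The action on the complexified plane and its dual, roots and coroots\<close>

lemma act_h_nth [simp]:
  "act_h w y $ 1 = complex_of_real (w $ 1 $ 1) * y $ 1 + complex_of_real (w $ 1 $ 2) * y $ 2"
  "act_h w y $ 2 = complex_of_real (w $ 2 $ 1) * y $ 1 + complex_of_real (w $ 2 $ 2) * y $ 2"
  by (simp_all add: act_h_def mult2_simps map_matrix_def)

lemma pairing_eq: "pairing y x = y $ 1 * x $ 1 + y $ 2 * x $ 2"
  by (simp add: pairing_def sum_2)

text \<open>The inverse transpose of an orthogonal matrix is the matrix itself, so h and its dual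
  carry the same action in coordinates.\<close>

lemma act_dual_eq_act_h: "orthogonal_matrix w \<Longrightarrow> act_dual w x = act_h w x"
  by (simp add: act_dual_def matrix_inv_orthogonal vec2_eq_iff mult2_simps map_matrix_def
      transpose_def mult.commute)

lemma act_h_mult: "act_h (u ** w) y = act_h u (act_h w y)"
  by (simp add: vec2_eq_iff mult2_simps algebra_simps)

lemma act_h_mat_1 [simp]: "act_h (mat 1) y = y"
  by (simp add: vec2_eq_iff)

lemma act_h_add: "act_h w (x + y) = act_h w x + act_h w y"
  and act_h_diff: "act_h w (x - y) = act_h w x - act_h w y"
  and act_h_scale: "act_h w (k *s x) = k *s act_h w x"
  by (simp_all add: vec2_eq_iff algebra_simps)

lemma pairing_act_h:
  assumes "orthogonal_matrix w"
  shows "pairing (act_h w y) (act_h w x) = pairing y x"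
proof -
  have "transpose w ** w = mat 1" using assms by (simp add: orthogonal_matrix)
  then have h: "w$1$1 * w$1$1 + w$2$1 * w$2$1 = 1" "w$1$1 * w$1$2 + w$2$1 * w$2$2 = 0"
      "w$1$2 * w$1$2 + w$2$2 * w$2$2 = 1"
    by (simp_all add: mat2_eq_iff mult2_simps transpose_def)
  define a b c e where abce: "a = complex_of_real (w$1$1)" "b = complex_of_real (w$1$2)"
    "c = complex_of_real (w$2$1)" "e = complex_of_real (w$2$2)"
  have h': "a * a + c * c = 1" "a * b + c * e = 0" "b * b + e * e = 1"
    using h[THEN arg_cong[of _ _ complex_of_real]] unfolding abce by simp_all
  have "pairing (act_h w y) (act_h w x) = (a * a + c * c) * (y$1 * x$1) + (b * b + e * e) * (y$2 * x$2)
      + (a * b + c * e) * (y$1 * x$2 + y$2 * x$1)"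
    by (simp add: pairing_eq abce algebra_simps)
  then show ?thesis by (simp add: h' pairing_eq)
qed

lemma pairing_add_left: "pairing (x + y) z = pairing x z + pairing y z"
  and pairing_add_right: "pairing z (x + y) = pairing z x + pairing z y"
  and pairing_diff_left: "pairing (x - y) z = pairing x z - pairing y z"
  and pairing_scale_left: "pairing (k *s x) z = k * pairing x z"
  and pairing_scale_right: "pairing z (k *s x) = k * pairing z x"
  by (simp_all add: pairing_eq algebra_simps)

lemma pairing_commute: "pairing x y = pairing y x"
  by (simp add: pairing_eq mult.commute)

text \<open>The pair chosen by \<open>SOME\<close> is unknown, but both members lie on the line of
  the mirror normal \<open>a\<close>. With root k a and coroot k' a the normalisation reads k k' =
  2, and both formulas involve only this product.\<close>

lemma root_coroot:
  assumes "d > 0" "s \<in> reflections d"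
  shows root_reflection: "act_h s y = y - pairing y (root_of s) *s coroot_of s"
    and coroot_reflection: "act_h s x = x - pairing (coroot_of s) x *s root_of s"
proof -
  obtain k where s: "s = refm (ang d k)" using assms by (rule reflections_cases)
  \<comment> \<open>Half of the index angle is the direction of the mirror, so \<open>a\<close>
    below is its unit normal.\<close>
  define t where "t = ang d k / 2"
  have s: "s = refm (2 * t)" using s by (simp add: t_def)
  define a :: "complex^2" where "a = vector [complex_of_real (sin t), - complex_of_real (cos t)]"
  have a_nth [simp]: "a $ 1 = complex_of_real (sin t)" "a $ 2 = - complex_of_real (cos t)"
    by (simp_all add: a_def)
  have sc: "sin t * sin t + cos t * cos t = 1"
    using sin_cos_squared_add[of t] by (simp add: power2_eq_square)
  have paa: "pairing a a = 1"
    using sc[THEN arg_cong[of _ _ complex_of_real]] by (simp add: pairing_eq)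
  have d1: "cos (2 * t) = 1 - 2 * (sin t * sin t)" "cos (2 * t) = 2 * (cos t * cos t) - 1"
    using cos_double_sin[of t] cos_double_cos[of t] by (simp_all add: power2_eq_square)
  have c2: "1 - complex_of_real (cos (2 * t)) = 2 * (complex_of_real (sin t) * complex_of_real (sin t))"
    unfolding d1(1) by simp
  have c3: "1 + complex_of_real (cos (2 * t)) = 2 * (complex_of_real (cos t) * complex_of_real (cos t))"
    unfolding d1(2) by simp
  have act: "act_h s y - y = (- 2 * pairing y a) *s a" for y
  proof -
    have "act_h s y $ 1 - y $ 1 = - (1 - complex_of_real (cos (2 * t))) * y $ 1
        + complex_of_real (sin (2 * t)) * y $ 2"
      "act_h s y $ 2 - y $ 2 = complex_of_real (sin (2 * t)) * y $ 1
        - (1 + complex_of_real (cos (2 * t))) * y $ 2"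
      by (simp_all add: s algebra_simps)
    then show ?thesis unfolding c2 c3 sin_double
      by (simp add: vec2_eq_iff pairing_eq algebra_simps)
  qed
  have "orthogonal_matrix s" by (simp add: s orthogonal_refm)
  then have dual: "act_dual s x = act_h s x" for x by (rule act_dual_eq_act_h)
  have range: "range (\<lambda>y. act_h s y - y) = vec.span {a}"
  proof -
    have "- 2 * pairing ((- k / 2) *s a) a = k" for k
      by (simp only: pairing_scale_left paa) simp
    then have "surj (\<lambda>y. - 2 * pairing y a)" by (rule surjI[where f = "\<lambda>k. (- k / 2) *s a"])
    then have "(\<lambda>k. k *s a) ` range (\<lambda>y. - 2 * pairing y a) = range (\<lambda>k. k *s a)" by simp
    then show ?thesis unfolding act vec.span_singleton by (simp add: image_image)
  qed
  have ex: "\<exists>p. case p of (b, b') \<Rightarrow> vec.span {b} = range (\<lambda>x. act_dual s x - x) \<and>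
     vec.span {b'} = range (\<lambda>y. act_h s y - y) \<and> pairing b' b = 2"
  proof -
    have "vec.span {2 *s a} = vec.span {a}"
    proof -
      have "surj (\<lambda>k :: complex. k * 2)" by (rule surjI[of _ "\<lambda>k. k / 2"]) simp
      then show ?thesis
        using range_comp_surj[of "\<lambda>k :: complex. k * 2" "\<lambda>k. k *s a"]
        by (simp add: vec.span_singleton)
    qed
    then show ?thesis
      using paa by (intro exI[of _ "(a, 2 *s a)"]) (simp add: range dual pairing_scale_left)
  qed
  have "case root_pair s of (b, b') \<Rightarrow> vec.span {b} = range (\<lambda>x. act_dual s x - x) \<and>
     vec.span {b'} = range (\<lambda>y. act_h s y - y) \<and> pairing b' b = 2"
    unfolding root_pair_def by (rule someI_ex[OF ex])
  then have sp: "vec.span {root_of s} = vec.span {a}" "vec.span {coroot_of s} = vec.span {a}"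
    and pr: "pairing (coroot_of s) (root_of s) = 2"
    by (auto simp: root_of_def coroot_of_def range dual split: prod.splits)
  have "root_of s \<in> vec.span {a}" "coroot_of s \<in> vec.span {a}"
    using sp vec.span_base[of _ "{root_of s}"] vec.span_base[of _ "{coroot_of s}"] by auto
  then obtain k k' where k: "root_of s = k *s a" and k': "coroot_of s = k' *s a"
    by (auto simp: vec.span_singleton)
  have kk: "k' * k = 2" using pr by (simp add: k k' pairing_scale_left pairing_scale_right paa mult.commute)
  have "act_h s y = y + (- 2 * pairing y a) *s a" for y
    using act[of y] by (simp add: algebra_simps)
  moreover have "pairing y (root_of s) *s coroot_of s = (2 * pairing y a) *s a"
    "pairing (coroot_of s) y *s root_of s = (2 * pairing y a) *s a" for y
    using kk by (simp_all add: k k' pairing_scale_left pairing_scale_right pairing_commute[of a]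
        mult.assoc[symmetric]) (simp_all add: algebra_simps)
  ultimately show "act_h s y = y - pairing y (root_of s) *s coroot_of s"
    "act_h s x = x - pairing (coroot_of s) x *s root_of s"
    by (simp_all only:) (simp_all add: vec2_eq_iff)
qed

lemma T_map_eq: "T_map y = (\<chi> i. cnj (y $ i))"
  unfolding T_map_def
proof (rule the_equality)
  show "\<forall>y2. pairing y2 (\<chi> i. cnj (y $ i)) = herm_h y2 y"
    by (simp add: pairing_def herm_h_def)
next
  fix x assume "\<forall>y2. pairing y2 x = herm_h y2 y"
  then have "pairing (axis 1 1) x = herm_h (axis 1 1) y" "pairing (axis 2 1) x = herm_h (axis 2 1) y"
    by blast+
  then show "x = (\<chi> i. cnj (y $ i))"
    by (simp add: vec2_eq_iff pairing_eq herm_h_def sum_2 axis_def)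
qed

section \<open>The smash product ring\<close>

abbreviation "lookup \<equiv> Poly_Mapping.lookup"
abbreviation "single \<equiv> Poly_Mapping.single"
abbreviation "keys \<equiv> Poly_Mapping.keys"

text \<open>The coefficient is an argument of \<open>g\<close>, so that one construction serves for
  complex, integer and vector coefficients.\<close>

definition linext :: "('k \<Rightarrow> 'a::zero \<Rightarrow> 'b::comm_monoid_add) \<Rightarrow> ('k \<Rightarrow>\<^sub>0 'a) \<Rightarrow> 'b" where
  "linext g p = (\<Sum>k\<in>keys p. g k (lookup p k))"

lemma linext_superset:
  assumes "finite S" "keys p \<subseteq> S" "\<And>k. g k 0 = 0"
  shows "linext g p = (\<Sum>k\<in>S. g k (lookup p k))"
  unfolding linext_def using assms
  by (intro sum.mono_neutral_left) (auto simp: in_keys_iff)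

lemma linext_add:
  fixes g :: "'k \<Rightarrow> 'a::monoid_add \<Rightarrow> 'b::comm_monoid_add"
  assumes "\<And>k a b. g k (a + b) = g k a + g k b" "\<And>k. g k 0 = 0"
  shows "linext g (p + q) = linext g p + linext g q"
proof -
  let ?S = "keys p \<union> keys q"
  have "linext g r = (\<Sum>k\<in>?S. g k (lookup r k))"
    if "keys r \<subseteq> ?S" for r
    using that by (intro linext_superset) (auto simp: assms(2))
  then show ?thesis
    using Poly_Mapping.keys_add[of p q] by (simp add: lookup_add assms(1) sum.distrib)
qed

lemma linext_single: "g k 0 = 0 \<Longrightarrow> linext g (single k a) = g k a"
  by (cases "a = 0") (simp_all add: linext_def)

lemma linext_0 [simp]: "linext g 0 = 0"
  by (simp add: linext_def)

lemma poly_mapping_sum_single: "p = (\<Sum>k\<in>keys p. single k (lookup p k))"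
  by (rule poly_mapping_eqI) (simp add: lookup_sum lookup_single when_def in_keys_iff)

lemma poly_mapping_add_induct [case_names single add]:
  fixes p :: "'k \<Rightarrow>\<^sub>0 'a::comm_monoid_add"
  assumes single: "\<And>k a. P (single k a)" and add: "\<And>p q. P p \<Longrightarrow> P q \<Longrightarrow> P (p + q)"
  shows "P p"
proof -
  have "P (\<Sum>k\<in>S. single k (lookup p k))" if "finite S" for S
    using that
  proof induction
    case empty
    show ?case using single[of undefined 0] by simp
  qed (simp add: single add)
  then show ?thesis using poly_mapping_sum_single[of p] finite_keys by metis
qed

section \<open>The group acting on the tensor algebra\<close>

definition act_word :: "real^2^2 \<Rightarrow> letter free_mon \<Rightarrow> tens" where
  "act_word w m = prod_list (map (act_letter w) (letters m))"

lemma tens_const_mult: "tens_const a * tens_const b = tens_const (a * b)"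
  and tens_const_add: "tens_const (a + b) = tens_const a + tens_const b"
  and tens_const_0: "tens_const 0 = 0"
  and tens_const_1: "tens_const 1 = 1"
  by (simp_all add: tens_const_def mult_single single_add)

lemma tens_const_commute: "tens_const k * p = p * tens_const k"
  by (induction p rule: poly_mapping_add_induct)
    (simp_all add: tens_const_def mult_single mult.commute distrib_left distrib_right)

lemma tens_const_single: "tens_const k * single m a = single m (k * a)"
  by (simp add: tens_const_def mult_single)

lemma act_tens_linext: "act_tens w p = linext (\<lambda>m k. tens_const k * act_word w m) p"
  by (simp add: act_tens_def linext_def act_word_def)

lemma act_tens_add: "act_tens w (p + q) = act_tens w p + act_tens w q"
  unfolding act_tens_linext
  by (rule linext_add) (simp_all add: tens_const_add tens_const_0 distrib_right)

lemma act_tens_single: "act_tens w (single m k) = tens_const k * act_word w m"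
  unfolding act_tens_linext by (rule linext_single) (simp add: tens_const_0)

lemma act_tens_0 [simp]: "act_tens w 0 = 0"
  by (simp add: act_tens_linext)

lemma act_tens_sum: "act_tens w (sum f A) = (\<Sum>a\<in>A. act_tens w (f a))"
  by (induction A rule: infinite_finite_induct) (simp_all add: act_tens_add)

lemma act_word_add: "act_word w (m + n) = act_word w m * act_word w n"
  by (simp add: act_word_def plus_free_mon_def)

lemma act_word_0 [simp]: "act_word w 0 = 1"
  by (simp add: act_word_def zero_free_mon_def)

lemma act_word_Cons: "act_word w (Free_Mon (a # as)) = act_letter w a * act_word w (Free_Mon as)"
  and act_word_Nil: "act_word w (Free_Mon []) = 1"
  by (simp_all add: act_word_def)

lemma act_tens_mult: "act_tens w (p * q) = act_tens w p * act_tens w q"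
proof (induction p rule: poly_mapping_add_induct)
  case (single m a)
  show ?case
  proof (induction q rule: poly_mapping_add_induct)
    case (single n b)
    have "tens_const a * act_word w m * (tens_const b * act_word w n)
        = tens_const a * tens_const b * (act_word w m * act_word w n)"
      by (metis mult.assoc tens_const_commute)
    then show ?case
      by (simp add: mult_single act_tens_single act_word_add tens_const_mult)
  qed (simp add: distrib_left act_tens_add)
qed (simp add: distrib_right act_tens_add)

lemma act_tens_const [simp]: "act_tens w (tens_const k) = tens_const k"
  by (simp add: tens_const_def act_tens_single[where m = 0, simplified] act_tens_single)

lemma act_tens_1 [simp]: "act_tens w 1 = 1"
  using act_tens_const[of w 1] by (simp add: tens_const_1)

lemma tens_Y_add: "tens_Y (x + y) = tens_Y x + tens_Y y"
  and tens_X_add: "tens_X (x + y) = tens_X x + tens_X y"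
  by (simp_all add: tens_Y_def tens_X_def single_add sum.distrib)

lemma tens_Y_scale: "tens_Y (k *s x) = tens_const k * tens_Y x"
  and tens_X_scale: "tens_X (k *s x) = tens_const k * tens_X x"
  by (simp_all add: tens_Y_def tens_X_def sum_distrib_left tens_const_single)

lemma tens_Y_axis: "tens_Y (axis i 1) = single (Free_Mon [LY i]) 1"
  and tens_X_axis: "tens_X (axis i 1) = single (Free_Mon [LX i]) 1"
  using exhaust_2[of i] by (auto simp: tens_Y_def tens_X_def sum_2 axis_def)

lemma vec2_expansion: "x = x $ 1 *s axis 1 1 + x $ 2 *s axis 2 1" for x :: "'a::semiring_1^2"
  by (simp add: vec2_eq_iff axis_def)

lemma act_tens_Y: "act_tens w (tens_Y y) = tens_Y (act_h w y)"
proof -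
  have 1: "act_tens w (tens_Y (axis i 1)) = tens_Y (act_h w (axis i 1))" for i
    by (simp add: tens_Y_axis act_tens_single act_word_Cons act_word_Nil tens_const_1)
  show ?thesis
    by (subst (1 2) vec2_expansion[of y])
      (simp only: tens_Y_add tens_Y_scale act_tens_add act_tens_mult act_tens_const 1
        act_h_add act_h_scale)
qed

lemma act_dual_add: "act_dual w (x + y) = act_dual w x + act_dual w y"
  and act_dual_scale: "act_dual w (k *s x) = k *s act_dual w x"
  by (simp_all add: act_dual_def vec_eq_iff vector_matrix_mult_def algebra_simps sum.distrib sum_distrib_left)

lemma act_tens_X: "act_tens w (tens_X y) = tens_X (act_dual w y)"
proof -
  have 1: "act_tens w (tens_X (axis i 1)) = tens_X (act_dual w (axis i 1))" for i
    by (simp add: tens_X_axis act_tens_single act_word_Cons act_word_Nil tens_const_1)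
  show ?thesis
    by (subst (1 2) vec2_expansion[of y])
      (simp only: tens_X_add tens_X_scale act_tens_add act_tens_mult act_tens_const 1
        act_dual_add act_dual_scale)
qed

lemma act_dual_mult:
  assumes "orthogonal_matrix u" "orthogonal_matrix w"
  shows "act_dual (u ** w) x = act_dual u (act_dual w x)"
  using assms by (simp add: act_dual_eq_act_h orthogonal_matrix_mul act_h_mult)

lemma act_tens_mat_mult:
  assumes "orthogonal_matrix u" "orthogonal_matrix w"
  shows "act_tens u (act_tens w p) = act_tens (u ** w) p"
proof (induction p rule: poly_mapping_add_induct)
  case (single m k)
  have 1: "act_tens u (act_letter w a) = act_letter (u ** w) a" for a
    by (cases a) (simp_all add: act_tens_Y act_tens_X act_h_mult act_dual_mult[OF assms])
  have "act_tens u (act_word w (Free_Mon l)) = act_word (u ** w) (Free_Mon l)" for l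
    by (induction l) (simp_all add: act_word_Cons act_word_Nil act_tens_mult 1)
  from this[of "letters m"] show ?case by (simp add: act_tens_single act_tens_mult)
qed (simp add: act_tens_add)

lemma act_tens_mat_1 [simp]: "act_tens (mat 1) p = p"
proof (induction p rule: poly_mapping_add_induct)
  case (single m k)
  have o: "orthogonal_matrix (mat 1 :: real^2^2)" by (simp add: orthogonal_matrix_def)
  have 1: "act_letter (mat 1) a = single (Free_Mon [a]) 1" for a
    by (cases a) (simp_all add: act_dual_eq_act_h[OF o] tens_Y_axis tens_X_axis)
  have "act_word (mat 1) (Free_Mon l) = single (Free_Mon l) 1" for l
  proof (induction l)
    case Nil
    show ?case by (metis act_word_Nil single_one zero_free_mon_def)
  next
    case (Cons a l)
    then show ?case by (simp add: act_word_Cons 1 mult_single plus_free_mon_def)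
  qed
  from this[of "letters m"] show ?case
    by (simp add: act_tens_single tens_const_single)
qed (simp add: act_tens_add)

lemma carrier_smash: "carrier (smash d) = {f. \<forall>w. w \<notin> dihedral d \<longrightarrow> f w = 0}"
  and mult_smash: "f \<otimes>\<^bsub>smash d\<^esub> g = (\<lambda>w. \<Sum>u\<in>dihedral d. f u * act_tens u (g (matrix_inv u ** w)))"
  and one_smash: "\<one>\<^bsub>smash d\<^esub> = of_tens 1"
  and zero_smash: "\<zero>\<^bsub>smash d\<^esub> = (\<lambda>w. 0)"
  and add_smash: "f \<oplus>\<^bsub>smash d\<^esub> g = (\<lambda>w. f w + g w)"
  by (simp_all add: smash_def of_tens_def)

section \<open>Ring structure and generators of the smash product\<close>

locale dihedral_setup =
  fixes d :: nat
  assumes d_pos: "d > 0"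
begin

abbreviation smash_mult (infixl "\<cdot>" 70) where "f \<cdot> g \<equiv> f \<otimes>\<^bsub>smash d\<^esub> g"
abbreviation smash_add (infixl "\<boxplus>" 65) where "f \<boxplus> g \<equiv> f \<oplus>\<^bsub>smash d\<^esub> g"
abbreviation smash_diff (infixl "\<boxminus>" 65) where "f \<boxminus> g \<equiv> f \<ominus>\<^bsub>smash d\<^esub> g"
abbreviation G where "G \<equiv> dihedral d"

lemmas G_mult [simp] = dihedral_mult[OF d_pos]
lemmas G_inv [simp] = dihedral_inv[OF d_pos]
lemmas G_one [simp] = mat_1_in_dihedral[OF d_pos]
lemmas G_finite [simp] = finite_dihedral[OF d_pos]
lemmas G_orth = orthogonal_dihedral[of _ d]
lemmas G_inv_mult [simp] = dihedral_inv_mult[of _ d]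
lemmas G_mult_inv [simp] = dihedral_mult_inv[of _ d]
lemmas G_inv_inv [simp] = dihedral_inv_inv[of _ d]

lemma G_inv_mult_assoc [simp]: "w \<in> G \<Longrightarrow> matrix_inv w ** (w ** v) = v"
  and G_mult_inv_assoc [simp]: "w \<in> G \<Longrightarrow> w ** (matrix_inv w ** v) = v"
  by (simp_all add: matrix_mul_assoc)

lemma matrix_inv_mult: "u \<in> G \<Longrightarrow> w \<in> G \<Longrightarrow> matrix_inv (u ** w) = matrix_inv w ** matrix_inv u"
  using G_orth by (simp add: matrix_inv_orthogonal orthogonal_matrix_mul matrix_transpose_mul)

lemma matrix_inv_mat_1 [simp]: "matrix_inv (mat 1 :: real^2^2) = mat 1"
  using G_inv_mult[OF G_one] by simp

lemma G_translate: "u \<in> G \<Longrightarrow> bij_betw (\<lambda>w. u ** w) G G"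
  by (rule bij_betwI[where g = "\<lambda>w. matrix_inv u ** w"]) auto

lemma sum_G_translate: "u \<in> G \<Longrightarrow> (\<Sum>w\<in>G. f (u ** w)) = (\<Sum>w\<in>G. f w)"
  by (rule sum.reindex_bij_betw[OF G_translate])

lemma G_mult_iff: "u \<in> G \<Longrightarrow> u ** w \<in> G \<longleftrightarrow> w \<in> G"
  using G_mult G_inv G_inv_mult_assoc by metis

lemma ring_smash: "ring (smash d)"
proof (rule ringI)
  show "abelian_group (smash d)"
  proof (rule abelian_groupI)
    fix x assume x: "x \<in> carrier (smash d)"
    show "\<exists>y\<in>carrier (smash d). y \<boxplus> x = \<zero>\<^bsub>smash d\<^esub>"
      using x by (intro bexI[of _ "\<lambda>w. - x w"]) (auto simp: carrier_smash add_smash zero_smash)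
  qed (auto simp: carrier_smash add_smash zero_smash add_ac)
  show "monoid (smash d)"
  proof (rule monoidI)
    fix f g assume "f \<in> carrier (smash d)" "g \<in> carrier (smash d)"
    then show "f \<cdot> g \<in> carrier (smash d)"
      by (auto simp: carrier_smash mult_smash G_mult_iff intro!: sum.neutral)
  next
    show "\<one>\<^bsub>smash d\<^esub> \<in> carrier (smash d)" by (auto simp: carrier_smash one_smash of_tens_def)
  next
    fix f g h
    show "f \<cdot> g \<cdot> h = f \<cdot> (g \<cdot> h)"
    proof (rule HOL.ext)
      fix w
      have "(f \<cdot> g \<cdot> h) w = (\<Sum>t\<in>G. \<Sum>u\<in>G. f t * act_tens t (g (matrix_inv t ** u)) *
          act_tens u (h (matrix_inv u ** w)))"
        by (simp add: mult_smash sum_distrib_right) (rule sum.swap)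
      \<comment> \<open>Shifting the inner index by \<open>t\<close> makes \<open>t ** u\<close> act
        on the third factor, which is the action of \<open>u\<close> followed by that of
        \<open>t\<close>.\<close>
      also have "\<dots> = (\<Sum>t\<in>G. \<Sum>u\<in>G. f t * act_tens t (g u) *
          act_tens (t ** u) (h (matrix_inv (t ** u) ** w)))"
        by (rule sum.cong[OF refl], subst sum_G_translate[symmetric]) auto
      also have "\<dots> = (f \<cdot> (g \<cdot> h)) w"
        by (simp add: mult_smash act_tens_sum act_tens_mult sum_distrib_left act_tens_mat_mult G_orth
            matrix_inv_mult matrix_mul_assoc mult.assoc cong: sum.cong)
      finally show "(f \<cdot> g \<cdot> h) w = (f \<cdot> (g \<cdot> h)) w" .
    qed
  next
    fix f assume "f \<in> carrier (smash d)"
    show "\<one>\<^bsub>smash d\<^esub> \<cdot> f = f"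
      by (simp add: mult_smash one_smash of_tens_def if_distrib[of "\<lambda>x. x * _"] sum.delta cong: if_cong)
    have *: "matrix_inv u ** w = mat 1 \<longleftrightarrow> u = w" if "u \<in> G" for u w
      using that by (metis G_mult_inv_assoc G_inv_mult matrix_mul_rid)
    show "f \<cdot> \<one>\<^bsub>smash d\<^esub> = f"
    proof (rule HOL.ext)
      fix w
      have "(f \<cdot> \<one>\<^bsub>smash d\<^esub>) w = (\<Sum>u\<in>G. if u = w then f u else 0)"
        unfolding mult_smash one_smash of_tens_def by (intro sum.cong) (auto simp: *)
      then show "(f \<cdot> \<one>\<^bsub>smash d\<^esub>) w = f w"
        using \<open>f \<in> carrier (smash d)\<close> by (auto simp: carrier_smash)
    qed
  qed
qed (simp_all add: carrier_smash mult_smash add_smash act_tens_add distrib_left distrib_right sum.distrib)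

sublocale A: ring "smash d" by (rule ring_smash)

lemma a_inv_smash: "f \<in> carrier (smash d) \<Longrightarrow> \<ominus>\<^bsub>smash d\<^esub> f = (\<lambda>w. - f w)"
  by (rule A.minus_equality) (auto simp: carrier_smash add_smash zero_smash)

lemma a_minus_smash:
  "f \<in> carrier (smash d) \<Longrightarrow> g \<in> carrier (smash d) \<Longrightarrow> f \<boxminus> g = (\<lambda>w. f w - g w)"
  by (simp add: a_minus_def a_inv_smash add_smash)

lemma finsum_smash:
  assumes "finite S" "F \<in> S \<rightarrow> carrier (smash d)"
  shows "finsum (smash d) F S = (\<lambda>w. \<Sum>s\<in>S. F s w)"
  using assms
proof (induction S)
  case empty
  then show ?case by (simp add: zero_smash)
next
  case (insert s S)
  then show ?case by (subst A.finsum_insert) (auto simp: add_smash)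
qed

lemma of_tens_closed [simp]: "of_tens p \<in> carrier (smash d)"
  by (auto simp: carrier_smash of_tens_def)

lemma of_const_closed [simp]: "of_const k \<in> carrier (smash d)"
  and of_X_closed [simp]: "of_X x \<in> carrier (smash d)"
  and of_Y_closed [simp]: "of_Y y \<in> carrier (smash d)"
  by (simp_all add: of_const_def of_X_def of_Y_def)

lemma of_grp_closed [simp]: "u \<in> G \<Longrightarrow> of_grp u \<in> carrier (smash d)"
  by (auto simp: carrier_smash of_grp_def)

lemma of_tens_mult: "of_tens p \<cdot> f = (\<lambda>w. p * f w)"
  by (simp add: mult_smash of_tens_def if_distrib[of "\<lambda>x. x * _"] sum.delta cong: if_cong)

lemma of_grp_mult: "u \<in> G \<Longrightarrow> of_grp u \<cdot> f = (\<lambda>w. act_tens u (f (matrix_inv u ** w)))"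
  by (simp add: mult_smash of_grp_def if_distrib[of "\<lambda>x. x * _"] sum.delta cong: if_cong)

lemma of_tens_mult_of_tens: "of_tens p \<cdot> of_tens q = of_tens (p * q)"
  unfolding of_tens_mult by (auto simp: of_tens_def)

lemma of_tens_add: "of_tens p \<boxplus> of_tens q = of_tens (p + q)"
  by (auto simp: add_smash of_tens_def)

lemma of_tens_mult_of_grp: "of_tens p \<cdot> of_grp u = (\<lambda>w. if w = u then p else 0)"
  unfolding of_tens_mult by (auto simp: of_grp_def)

lemma G_inv_mult_eq_iff: "u \<in> G \<Longrightarrow> matrix_inv u ** w = v \<longleftrightarrow> w = u ** v"
  using G_mult_inv_assoc G_inv_mult_assoc by metis

lemma of_grp_mult_of_tens:
  "u \<in> G \<Longrightarrow> of_grp u \<cdot> of_tens p = of_tens (act_tens u p) \<cdot> of_grp u"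
  unfolding of_tens_mult_of_grp by (auto simp: of_grp_mult of_tens_def G_inv_mult_eq_iff)

lemma smash_expansion:
  assumes "f \<in> carrier (smash d)"
  shows "f = finsum (smash d) (\<lambda>u. of_tens (f u) \<cdot> of_grp u) G"
proof -
  have "(\<lambda>u. of_tens (f u) \<cdot> of_grp u) \<in> G \<rightarrow> carrier (smash d)" by auto
  then show ?thesis
    using assms by (subst finsum_smash) (auto simp: of_tens_mult_of_grp carrier_smash)
qed

text \<open>Scalars, linear forms, vectors and group elements generate the ring: words are products
  of letters, tensors are sums of scalar multiples of words, and \<open>smash_expansion\<close>
  brings in the group. Facts about the action of the whole algebra reduce to these four
  kinds.\<close>

lemma smash_induct [consumes 1, case_names const X Y grp add mult]:
  assumes "f \<in> carrier (smash d)"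
    and const: "\<And>k. P (of_const k)" and X: "\<And>x. P (of_X x)" and Y: "\<And>y. P (of_Y y)"
    and grp: "\<And>u. u \<in> G \<Longrightarrow> P (of_grp u)"
    and add: "\<And>f g. f \<in> carrier (smash d) \<Longrightarrow> g \<in> carrier (smash d) \<Longrightarrow> P f \<Longrightarrow> P g \<Longrightarrow> P (f \<boxplus> g)"
    and mult: "\<And>f g. f \<in> carrier (smash d) \<Longrightarrow> g \<in> carrier (smash d) \<Longrightarrow> P f \<Longrightarrow> P g \<Longrightarrow> P (f \<cdot> g)"
  shows "P f"
proof -
  have word: "P (of_tens (single (Free_Mon l) 1))" for l
  proof (induction l)
    case Nil
    show ?case using const[of 1] by (simp add: of_const_def tens_const_def zero_free_mon_def)
  next
    case (Cons a l)
    have "P (of_tens (single (Free_Mon [a]) 1))"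
      using X Y by (cases a) (auto simp: of_X_def of_Y_def tens_X_axis[symmetric] tens_Y_axis[symmetric])
    from mult[OF _ _ this Cons.IH] show ?case
      by (simp add: of_tens_mult_of_tens mult_single plus_free_mon_def)
  qed
  have tens: "P (of_tens p)" for p
  proof (induction p rule: poly_mapping_add_induct)
    case (single m k)
    show ?case
      using mult[OF _ _ const[of k] word[of "letters m"]]
      by (simp add: of_const_def of_tens_mult_of_tens tens_const_single)
  next
    case (add p q)
    then show ?case using assms(6)[OF _ _ add(1,2)] by (simp add: of_tens_add)
  qed
  have F: "(\<lambda>u. of_tens (f u) \<cdot> of_grp u) \<in> G \<rightarrow> carrier (smash d)" by auto
  have "P (finsum (smash d) (\<lambda>u. of_tens (f u) \<cdot> of_grp u) S)" if "S \<subseteq> G" for S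
    using finite_subset[OF that G_finite] that
  proof induction
    case empty
    show ?case using const[of 0] by (simp add: of_const_def tens_const_0 zero_smash of_tens_def)
  next
    case (insert u S)
    then have "finsum (smash d) (\<lambda>u. of_tens (f u) \<cdot> of_grp u) (insert u S) =
      (of_tens (f u) \<cdot> of_grp u) \<boxplus> finsum (smash d) (\<lambda>u. of_tens (f u) \<cdot> of_grp u) S"
      by (intro A.finsum_insert) auto
    moreover have "finsum (smash d) (\<lambda>u. of_tens (f u) \<cdot> of_grp u) S \<in> carrier (smash d)"
      using insert by (intro A.finsum_closed) auto
    ultimately show ?case using insert by (auto intro!: add mult tens grp)
  qed
  from this[OF order_refl] show ?thesis using smash_expansion[OF assms(1)] by simp
qed

end

section \<open>Polynomials and Dunkl operators\<close>

text \<open>A monomial with exponent \<open>(i, j)\<close> and coefficient \<open>v\<close> stands for \<open>z\<^sup>i w\<^sup>j \<otimes> v\<close>, where \<open>z = x\<^sub>1 + \<i> x\<^sub>2\<close> and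
  \<open>w = x\<^sub>1 - \<i> x\<^sub>2\<close>; in these coordinates rotations act diagonally.\<close>

type_synonym 'n vpoly = "(nat \<times> nat) \<Rightarrow>\<^sub>0 (complex^'n)"

section \<open>Vector-valued polynomials and multiplication by linear forms\<close>

definition scal :: "complex \<Rightarrow> ('n::finite) vpoly \<Rightarrow> 'n vpoly" where
  "scal k u = linext (\<lambda>m v. single m (k *s v)) u"

lemma scal_single: "scal k (single m v) = single m (k *s v)"
  unfolding scal_def by (rule linext_single) simp

lemma lookup_scal:
  fixes u :: "('n::finite) vpoly"
  shows "lookup (scal k u) m = k *s lookup u m"
proof -
  have add: "scal k (p + q) = scal k p + scal k q" for p q :: "'n vpoly"
    unfolding scal_def by (rule linext_add) (simp_all add: vec.scale_right_distrib single_add)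
  show ?thesis
    by (induction u rule: poly_mapping_add_induct)
      (simp_all add: scal_single lookup_single when_def add lookup_add vec.scale_right_distrib)
qed

interpretation V: vector_space "scal :: complex \<Rightarrow> ('n::finite) vpoly \<Rightarrow> 'n vpoly"
  by standard (rule poly_mapping_eqI; simp add: lookup_scal lookup_add vec.scale_right_distrib
      vec.scale_left_distrib)+

definition lin :: "(('n::finite) vpoly \<Rightarrow> ('m::finite) vpoly) \<Rightarrow> bool" where
  "lin f \<longleftrightarrow> (\<forall>u v. f (u + v) = f u + f v) \<and> (\<forall>k u. f (scal k u) = scal k (f u))"

lemma linI: "(\<And>u v. f (u + v) = f u + f v) \<Longrightarrow> (\<And>k u. f (scal k u) = scal k (f u)) \<Longrightarrow> lin f"
  by (simp add: lin_def)

context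
  fixes f :: "('n::finite) vpoly \<Rightarrow> ('m::finite) vpoly"
  assumes f: "lin f"
begin

lemma lin_add: "f (u + v) = f u + f v"
  and lin_scal: "f (scal k u) = scal k (f u)"
  using f by (simp_all add: lin_def)

lemma lin_0: "f 0 = 0"
  using lin_scal[of 0 0] by simp

lemma lin_minus: "f (- u) = - f u"
  using lin_scal[of "- 1" u] by simp

lemma lin_diff: "f (u - v) = f u - f v"
  using lin_add[of u "- v"] by (simp add: lin_minus)

lemma lin_sum: "f (sum g A) = (\<Sum>a\<in>A. f (g a))"
  by (induction A rule: infinite_finite_induct) (simp_all add: lin_0 lin_add)

end

lemmas lin_simps = lin_add lin_scal lin_0 lin_minus lin_diff lin_sum

lemma lin_linext:
  fixes g :: "nat \<times> nat \<Rightarrow> complex^'n \<Rightarrow> 'm::finite vpoly"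
  assumes add: "\<And>m v w. g m (v + w) = g m v + g m w"
    and scale: "\<And>m k v. g m (k *s v) = scal k (g m v)"
  shows "lin (linext g)"
proof (rule linI)
  have 0: "g m 0 = 0" for m using scale[of m 0 0] by simp
  show a: "linext g (u + v) = linext g u + linext g v" for u v
    by (rule linext_add) (simp_all add: add 0)
  show "linext g (scal k u) = scal k (linext g u)" for k u
    by (induction u rule: poly_mapping_add_induct)
      (simp_all add: scal_single linext_single 0 scale a V.scale_right_distrib)
qed

lemma lin_compose: "lin f \<Longrightarrow> lin g \<Longrightarrow> lin (\<lambda>u. f (g u))"
  and lin_plus: "lin f \<Longrightarrow> lin g \<Longrightarrow> lin (\<lambda>u. f u + g u)"
  and lin_scale: "lin f \<Longrightarrow> lin (\<lambda>u. scal k (f u))"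
  by (simp_all add: lin_def V.scale_right_distrib V.scale_left_commute)

lemma lin_minus_fun: "lin f \<Longrightarrow> lin g \<Longrightarrow> lin (\<lambda>u. f u - g u)"
  by (simp add: lin_def V.scale_right_diff_distrib)

lemma lin_sum_fun: "(\<And>a. a \<in> A \<Longrightarrow> lin (f a)) \<Longrightarrow> lin (\<lambda>u. \<Sum>a\<in>A. f a u)"
  unfolding lin_def by (simp add: sum.distrib V.scale_sum_right)

lemma lin_id: "lin (\<lambda>u. u)"
  by (simp add: lin_def)

lemma lin_funpow:
  fixes f :: "('n::finite) vpoly \<Rightarrow> 'n vpoly"
  shows "lin f \<Longrightarrow> lin (f ^^ n)"
  by (induction n) (simp_all add: lin_def)

definition lw :: "complex^'n \<Rightarrow> ('n::finite) vpoly" where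
  "lw v = single (0, 0) v"

lemma lw_add: "lw (v + w) = lw v + lw w"
  and lw_scale: "lw (k *s v) = scal k (lw v)"
  by (simp_all add: lw_def single_add scal_single)

definition mulz :: "('n::finite) vpoly \<Rightarrow> 'n vpoly" where
  "mulz u = linext (\<lambda>(i, j) v. single (Suc i, j) v) u"

definition mulzb :: "('n::finite) vpoly \<Rightarrow> 'n vpoly" where
  "mulzb u = linext (\<lambda>(i, j) v. single (i, Suc j) v) u"

lemma mulz_single: "mulz (single (i, j) v) = single (Suc i, j) v"
  and mulzb_single: "mulzb (single (i, j) v) = single (i, Suc j) v"
  unfolding mulz_def mulzb_def by (subst linext_single; simp)+

lemma lin_mulz: "lin mulz" and lin_mulzb: "lin mulzb"
  unfolding mulz_def[abs_def] mulzb_def[abs_def]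
  by (rule lin_linext; auto simp: single_add scal_single)+

lemma mulz_mulzb: "mulz (mulzb u) = mulzb (mulz u)"
proof (induction u rule: poly_mapping_add_induct)
  case (single m v)
  show ?case by (cases m) (simp add: mulz_single mulzb_single)
qed (simp add: lin_simps[OF lin_mulz] lin_simps[OF lin_mulzb])

text \<open>The two scalars are the coordinates of the linear form \<open>x\<close> in the basis z,
  w; see \<open>zv_expansion\<close>.\<close>

definition mulx :: "complex^2 \<Rightarrow> ('n::finite) vpoly \<Rightarrow> 'n vpoly" where
  "mulx x u = scal ((x $ 1 - \<i> * x $ 2) / 2) (mulz u) + scal ((x $ 1 + \<i> * x $ 2) / 2) (mulzb u)"

text \<open>Coordinate vectors of the linear forms z and w. They also serve as vectors of h, where
  \<open>zbv\<close> pairs with z to 2 and with w to 0.\<close>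

definition zv :: "complex^2" where "zv = vector [1, \<i>]"
definition zbv :: "complex^2" where "zbv = vector [1, - \<i>]"

lemma zv_nth [simp]: "zv $ 1 = 1" "zv $ 2 = \<i>" "zbv $ 1 = 1" "zbv $ 2 = - \<i>"
  by (simp_all add: zv_def zbv_def)

lemma mulx_zv: "mulx zv u = mulz u" and mulx_zbv: "mulx zbv u = mulzb u"
  by (simp_all add: mulx_def)

lemma zv_expansion:
  "x = ((x $ 1 - \<i> * x $ 2) / 2) *s zv + ((x $ 1 + \<i> * x $ 2) / 2) *s zbv" for x :: "complex^2"
  by (simp add: vec2_eq_iff field_simps)

lemma lin_mulx: "lin (mulx x)"
  unfolding mulx_def[abs_def] by (intro lin_plus lin_scale lin_mulz lin_mulzb)

lemma mulx_add: "mulx (x + y) u = mulx x u + mulx y u"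
  unfolding mulx_def by (simp add: algebra_simps add_divide_distrib diff_divide_distrib V.scale_left_distrib V.scale_left_diff_distrib)

lemma mulx_scale: "mulx (k *s x) u = scal k (mulx x u)"
  unfolding mulx_def by (simp add: algebra_simps V.scale_right_distrib diff_divide_distrib add_divide_distrib V.scale_left_distrib V.scale_left_diff_distrib)

lemma mulx_diff: "mulx (x - y) u = mulx x u - mulx y u"
  using mulx_add[of "x - y" y u] by simp

lemma mulx_commute: "mulx x (mulx y u) = mulx y (mulx x u)"
  by (simp add: mulx_def lin_simps[OF lin_mulz] lin_simps[OF lin_mulzb] mulz_mulzb
      V.scale_right_distrib mult.commute add_ac)

lemma mulx_funpow_commute: "(mulx x ^^ n) (mulx y u) = mulx y ((mulx x ^^ n) u)"
  by (induction n) (simp_all add: mulx_commute[of x y])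

lemma single_eq_funpow: "single (i, j) v = (mulz ^^ i) ((mulzb ^^ j) (lw v))"
proof -
  have "single (0, j) v = (mulzb ^^ j) (lw v)"
    by (induction j) (simp_all add: lw_def mulzb_single[symmetric])
  then show ?thesis
    by (induction i) (simp_all add: mulz_single[symmetric])
qed

lemma vpoly_induct [case_names lw z zb add]:
  fixes u :: "('n::finite) vpoly"
  assumes "\<And>v. P (lw v)" "\<And>u. P u \<Longrightarrow> P (mulz u)" "\<And>u. P u \<Longrightarrow> P (mulzb u)"
    and "\<And>u v. P u \<Longrightarrow> P v \<Longrightarrow> P (u + v)"
  shows "P u"
proof (induction u rule: poly_mapping_add_induct)
  case (single m v)
  have "P ((mulzb ^^ j) (lw v))" for j by (induction j) (simp_all add: assms)
  then have "P ((mulz ^^ i) ((mulzb ^^ j) (lw v)))" for i j by (induction i) (simp_all add: assms)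
  then show ?case by (cases m) (simp add: single_eq_funpow)
qed (rule assms(4))

lemma vpoly_induct_x [case_names lw x add]:
  fixes u :: "('n::finite) vpoly"
  assumes "\<And>v. P (lw v)" "\<And>x u. P u \<Longrightarrow> P (mulx x u)" "\<And>u v. P u \<Longrightarrow> P v \<Longrightarrow> P (u + v)"
  shows "P u"
  using assms by (induction u rule: vpoly_induct) (auto simp: mulx_zv[symmetric] mulx_zbv[symmetric])

lemma linear_in_vector:
  assumes "\<And>x y. f (x + y) = f x + f y" "\<And>k x. f (k *s x) = scal k (f x)"
    and "\<And>x y. g (x + y) = g x + g y" "\<And>k x. g (k *s x) = scal k (g x)"
    and "f zv = g zv" "f zbv = g zbv"
  shows "f x = g x"
  by (subst (1 2) zv_expansion[of x]) (simp only: assms)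

section \<open>Group action, commutators and Dunkl operators for an arbitrary class function
  c\<close>

locale dunkl_setup = dihedral_setup d for d :: nat +
  fixes c :: "real^2^2 \<Rightarrow> real" and \<rho> :: "real^2^2 \<Rightarrow> complex^'n^'n::finite"
  assumes c_conj: "w \<in> dihedral d \<Longrightarrow> s \<in> reflections d \<Longrightarrow> c (w ** s ** matrix_inv w) = c s"
    and rep: "is_representation d \<rho>"
begin

abbreviation S where "S \<equiv> reflections d"

lemmas S_finite [simp] = finite_reflections[OF d_pos]

lemma S_in_G [simp]: "s \<in> S \<Longrightarrow> s \<in> G"
  using reflections_subset by blast

lemma act_dual_G: "w \<in> G \<Longrightarrow> act_dual w x = act_h w x"
  by (rule act_dual_eq_act_h[OF G_orth])

definition grp :: "real^2^2 \<Rightarrow> 'n vpoly \<Rightarrow> 'n vpoly" where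
  "grp w u = linext (\<lambda>(i, j) v. (mulx (act_dual w zv) ^^ i) ((mulx (act_dual w zbv) ^^ j) (lw (\<rho> w *v v)))) u"

lemma grp_single: "grp w (single (i, j) v) =
    (mulx (act_dual w zv) ^^ i) ((mulx (act_dual w zbv) ^^ j) (lw (\<rho> w *v v)))"
proof -
  have "lw 0 = (0 :: 'n vpoly)" by (simp add: lw_def)
  then show ?thesis unfolding grp_def
    by (subst linext_single) (simp_all add: lin_0[OF lin_funpow[OF lin_mulx]])
qed

lemma lin_grp: "lin (grp w)"
  unfolding grp_def[abs_def]
  by (rule lin_linext) (auto simp: lin_simps[OF lin_funpow[OF lin_mulx]] matrix_vector_right_distrib
      lw_add vector_scalar_commute lw_scale)

lemma grp_lw: "grp w (lw v) = lw (\<rho> w *v v)"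
  by (simp add: lw_def[of v] grp_single)

lemma grp_mulx: "grp w (mulx x u) = mulx (act_dual w x) (grp w u)"
proof (rule linear_in_vector[where f = "\<lambda>x. grp w (mulx x u)" and g = "\<lambda>x. mulx (act_dual w x) (grp w u)"])
  show "grp w (mulx zv u) = mulx (act_dual w zv) (grp w u)"
  proof (induction u rule: poly_mapping_add_induct)
    case (single m v)
    show ?case by (cases m) (simp add: mulx_zv mulz_single grp_single)
  qed (simp add: lin_simps[OF lin_mulx] lin_simps[OF lin_grp])
  show "grp w (mulx zbv u) = mulx (act_dual w zbv) (grp w u)"
  proof (induction u rule: poly_mapping_add_induct)
    case (single m v)
    show ?case by (cases m) (simp add: mulx_zbv mulzb_single grp_single mulx_funpow_commute)
  qed (simp add: lin_simps[OF lin_mulx] lin_simps[OF lin_grp])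
qed (simp_all add: mulx_add mulx_scale lin_simps[OF lin_grp] act_dual_add act_dual_scale)

lemma rep_mult: "u \<in> G \<Longrightarrow> w \<in> G \<Longrightarrow> \<rho> (u ** w) = \<rho> u ** \<rho> w"
  and rep_1: "\<rho> (mat 1) = mat 1"
  using rep by (simp_all add: is_representation_def)

lemma grp_mult: "u \<in> G \<Longrightarrow> w \<in> G \<Longrightarrow> grp u (grp w x) = grp (u ** w) x"
  by (induction x rule: vpoly_induct_x)
    (simp_all add: grp_lw rep_mult matrix_vector_mul_assoc grp_mulx act_dual_G act_h_mult lin_simps[OF lin_grp])

lemma grp_1: "grp (mat 1) x = x"
  by (induction x rule: vpoly_induct_x)
    (simp_all add: grp_lw rep_1 grp_mulx act_dual_G lin_simps[OF lin_grp])

text \<open>The right-hand side of the defining relation for \<open>[y, x]\<close>, with reflections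
  acting by \<open>grp\<close>: what the commutator of the Dunkl operator of \<open>y\<close> with
  multiplication by \<open>x\<close> has to be.\<close>

definition cm :: "complex^2 \<Rightarrow> complex^2 \<Rightarrow> 'n vpoly \<Rightarrow> 'n vpoly" where
  "cm y x u = scal (pairing y x) u -
     (\<Sum>s\<in>S. scal (of_real (c s) * pairing y (root_of s) * pairing (coroot_of s) x) (grp s u))"

lemma lin_cm: "lin (cm y x)"
  unfolding cm_def[abs_def] by (intro lin_minus_fun lin_scale lin_sum_fun lin_grp lin_id)

lemma cm_add_left: "cm (x + y) z u = cm x z u + cm y z u"
  and cm_add_right: "cm z (x + y) u = cm z x u + cm z y u"
  by (simp_all add: cm_def pairing_add_left pairing_add_right V.scale_left_distrib sum.distrib
      distrib_left distrib_right)

lemma cm_scale_left: "cm (k *s x) z u = scal k (cm x z u)"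
  and cm_scale_right: "cm z (k *s x) u = scal k (cm z x u)"
  by (simp_all add: cm_def pairing_scale_left pairing_scale_right V.scale_right_diff_distrib
      V.scale_sum_right mult_ac)

lemma act_S: "s \<in> S \<Longrightarrow> act_h s y = y - pairing y (root_of s) *s coroot_of s"
  and act_S_dual: "s \<in> S \<Longrightarrow> act_dual s x = x - pairing (coroot_of s) x *s root_of s"
  using root_reflection[OF d_pos, of s] coroot_reflection[OF d_pos, of s] by (simp_all add: act_dual_G)

text \<open>A reflection moves \<open>x\<close> by a multiple of its root, so passing
  \<open>x\<close> through the sum costs a term containing the pairings of the coroot with
  \<open>x\<close> and with \<open>x'\<close>. Its symmetry in \<open>x\<close> and
  \<open>x'\<close> is what makes the Dunkl operators consistent.\<close>

lemma mulx_cm: "mulx x (cm y x' u) = cm y x' (mulx x u) -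
    (\<Sum>s\<in>S. scal (of_real (c s) * pairing y (root_of s) * (pairing (coroot_of s) x' * pairing (coroot_of s) x))
      (mulx (root_of s) (grp s u)))"
proof -
  have "cm y x' (mulx x u) - mulx x (cm y x' u) =
     - (\<Sum>s\<in>S. scal (of_real (c s) * pairing y (root_of s) * pairing (coroot_of s) x')
          (grp s (mulx x u) - mulx x (grp s u)))"
    by (simp add: cm_def lin_simps[OF lin_mulx] V.scale_right_diff_distrib sum_subtractf)
  also have "(\<Sum>s\<in>S. scal (of_real (c s) * pairing y (root_of s) * pairing (coroot_of s) x')
          (grp s (mulx x u) - mulx x (grp s u))) =
     (\<Sum>s\<in>S. - scal (of_real (c s) * pairing y (root_of s) * (pairing (coroot_of s) x' * pairing (coroot_of s) x))
      (mulx (root_of s) (grp s u)))"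
    by (intro sum.cong refl)
      (simp add: grp_mulx act_S_dual mulx_diff mulx_scale mult_ac)
  finally show ?thesis by (simp add: sum_negf algebra_simps)
qed

text \<open>The operator is forced by killing constants and by its commutators with linear forms.
  Factors z are removed before factors w, so the rule for z holds almost by definition and the rule
  for w becomes the consistency statement \<open>dunkl_mulzb\<close>.\<close>

fun dunkl_mono :: "complex^2 \<Rightarrow> nat \<Rightarrow> nat \<Rightarrow> complex^'n \<Rightarrow> 'n vpoly" where
  "dunkl_mono y 0 0 v = 0"
| "dunkl_mono y 0 (Suc j) v = mulzb (dunkl_mono y 0 j v) + cm y zbv (single (0, j) v)"
| "dunkl_mono y (Suc i) j v = mulz (dunkl_mono y i j v) + cm y zv (single (i, j) v)"

definition dunkl :: "complex^2 \<Rightarrow> 'n vpoly \<Rightarrow> 'n vpoly" where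
  "dunkl y u = linext (\<lambda>(i, j) v. dunkl_mono y i j v) u"

lemma dunkl_mono_add: "dunkl_mono y i j (v + w) = dunkl_mono y i j v + dunkl_mono y i j w"
  and dunkl_mono_scale: "dunkl_mono y i j (k *s v) = scal k (dunkl_mono y i j v)"
  by (induction y i j v rule: dunkl_mono.induct)
    (simp_all add: lin_simps[OF lin_mulz] lin_simps[OF lin_mulzb] lin_simps[OF lin_cm] single_add
      scal_single[symmetric] V.scale_right_distrib add_ac)

lemma lin_dunkl: "lin (dunkl y)"
  unfolding dunkl_def[abs_def] by (rule lin_linext) (auto simp: dunkl_mono_add dunkl_mono_scale)

lemma dunkl_single: "dunkl y (single (i, j) v) = dunkl_mono y i j v"
  unfolding dunkl_def using dunkl_mono_scale[of y _ _ 0 0] by (subst linext_single) auto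

lemma dunkl_lw: "dunkl y (lw v) = 0"
  by (simp add: lw_def dunkl_single)

lemma dunkl_mulz: "dunkl y (mulz u) = mulz (dunkl y u) + cm y zv u"
proof (induction u rule: poly_mapping_add_induct)
  case (single m v)
  show ?case by (cases m) (simp add: mulz_single dunkl_single)
qed (simp add: lin_simps[OF lin_mulz] lin_simps[OF lin_cm] lin_simps[OF lin_dunkl])

lemma dunkl_mulzb: "dunkl y (mulzb u) = mulzb (dunkl y u) + cm y zbv u"
proof (induction u rule: poly_mapping_add_induct)
  case (single m v)
  have "dunkl y (mulzb (single (i, j) v)) =
      mulzb (dunkl y (single (i, j) v)) + cm y zbv (single (i, j) v)" for i j
  proof (induction i)
    case 0
    show ?case by (simp add: mulzb_single dunkl_single)
  next
    case (Suc i)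
    let ?u = "single (i, j) v"
    \<comment> \<open>By \<open>mulx_cm\<close> both sides carry the same correction, symmetric in z
      and w: the two ways of passing \<open>y\<close> through the product z w agree.\<close>
    have "mulx zv (cm y zbv ?u) + cm y zv (mulx zbv ?u) = mulx zbv (cm y zv ?u) + cm y zbv (mulx zv ?u)"
      by (simp add: mulx_cm mult_ac)
    then have *: "mulz (cm y zbv ?u) + cm y zv (mulzb ?u) = mulzb (cm y zv ?u) + cm y zbv (mulz ?u)"
      by (simp add: mulx_zv mulx_zbv)
    have "dunkl y (mulzb (mulz ?u)) = mulz (mulzb (dunkl y ?u)) + (mulz (cm y zbv ?u) + cm y zv (mulzb ?u))"
      by (simp add: mulz_mulzb[symmetric] dunkl_mulz Suc lin_simps[OF lin_mulz] add_ac)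
    also have "\<dots> = mulzb (dunkl y (mulz ?u)) + cm y zbv (mulz ?u)"
      unfolding * by (simp add: dunkl_mulz lin_simps[OF lin_mulzb] mulz_mulzb add_ac)
    finally show ?case by (simp add: mulz_single)
  qed
  then show ?case by (cases m) simp
qed (simp add: lin_simps[OF lin_mulzb] lin_simps[OF lin_cm] lin_simps[OF lin_dunkl])

lemma dunkl_mulx: "dunkl y (mulx x u) = mulx x (dunkl y u) + cm y x u"
  by (rule linear_in_vector[where f = "\<lambda>x. dunkl y (mulx x u)" and g = "\<lambda>x. mulx x (dunkl y u) + cm y x u"])
    (simp_all add: mulx_add mulx_scale lin_simps[OF lin_dunkl] cm_add_right cm_scale_right
      V.scale_right_distrib mulx_zv mulx_zbv dunkl_mulz dunkl_mulzb)

lemma dunkl_add_vec: "dunkl (x + y) u = dunkl x u + dunkl y u"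
  by (induction u rule: vpoly_induct_x)
    (simp_all add: dunkl_lw dunkl_mulx lin_simps[OF lin_dunkl] lin_simps[OF lin_mulx] cm_add_left)

lemma dunkl_scale_vec: "dunkl (k *s x) u = scal k (dunkl x u)"
  by (induction u rule: vpoly_induct_x)
    (simp_all add: dunkl_lw dunkl_mulx lin_simps[OF lin_dunkl] lin_simps[OF lin_mulx] cm_scale_left
      V.scale_right_distrib)

lemma dunkl_diff_vec: "dunkl (x - y) u = dunkl x u - dunkl y u"
  using dunkl_add_vec[of "x - y" y u] by simp

lemma S_conj_bij: "w \<in> G \<Longrightarrow> bij_betw (\<lambda>s. w ** s ** matrix_inv w) S S"
proof (rule bij_betwI[where g = "\<lambda>s. matrix_inv w ** s ** w"])
  assume w: "w \<in> G"
  show "(\<lambda>s. w ** s ** matrix_inv w) \<in> S \<rightarrow> S" using reflection_conj[OF d_pos w] by auto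
  show "(\<lambda>s. matrix_inv w ** s ** w) \<in> S \<rightarrow> S"
    using reflection_conj[OF d_pos G_inv[OF w]] w by auto
  show "matrix_inv w ** (w ** s ** matrix_inv w) ** w = s" if "s \<in> S" for s
    using w by (simp add: matrix_mul_assoc[symmetric])
  show "w ** (matrix_inv w ** s ** w) ** matrix_inv w = s" if "s \<in> S" for s
    using w by (simp add: matrix_mul_assoc[symmetric])
qed

text \<open>Root and coroot enter only through this product, which depends on \<open>s\<close>
  alone; coefficients are evaluated in this form from here on.\<close>

lemma pairing_root: "s \<in> S \<Longrightarrow> pairing y (root_of s) * pairing (coroot_of s) x = pairing (y - act_h s y) x"
  by (simp add: act_S pairing_scale_left)

text \<open>Conjugation permutes the reflections and preserves \<open>c\<close>, and by
  \<open>pairing_root\<close> the coefficient of the conjugate at the moved vectors equals the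
  original one.\<close>

lemma grp_cm:
  assumes w: "w \<in> G"
  shows "grp w (cm y x u) = cm (act_h w y) (act_h w x) (grp w u)"
proof -
  let ?k = "\<lambda>s y x. of_real (c s) * pairing y (root_of s) * pairing (coroot_of s) x"
  let ?j = "\<lambda>s. w ** s ** matrix_inv w"
  have "?k (?j s) (act_h w y) (act_h w x) = ?k s y x" if "s \<in> S" for s
  proof -
    have s': "?j s \<in> S" using reflection_conj[OF d_pos w that] .
    have "act_h (?j s) (act_h w y) = act_h w (act_h s y)"
      by (simp add: act_h_mult[symmetric] matrix_mul_assoc[symmetric] w)
    then have "pairing (act_h w y - act_h (?j s) (act_h w y)) (act_h w x) = pairing (y - act_h s y) x"
      by (simp add: act_h_diff[symmetric] pairing_act_h[OF G_orth[OF w]])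
    then show ?thesis
      unfolding mult.assoc pairing_root[OF that] pairing_root[OF s'] by (simp add: c_conj[OF w that])
  qed
  moreover have "grp (?j s) (grp w u) = grp w (grp s u)" if "s \<in> S" for s
    using w that by (simp add: grp_mult matrix_mul_assoc[symmetric])
  ultimately have "(\<Sum>s\<in>S. scal (?k (?j s) (act_h w y) (act_h w x)) (grp (?j s) (grp w u))) =
      (\<Sum>s\<in>S. scal (?k s y x) (grp w (grp s u)))"
    by (intro sum.cong) simp_all
  moreover have "(\<Sum>s\<in>S. scal (?k (?j s) (act_h w y) (act_h w x)) (grp (?j s) (grp w u))) =
      (\<Sum>s\<in>S. scal (?k s (act_h w y) (act_h w x)) (grp s (grp w u)))"
    by (rule sum.reindex_bij_betw[OF S_conj_bij[OF w],
        where g = "\<lambda>s. scal (?k s (act_h w y) (act_h w x)) (grp s (grp w u))"])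
  ultimately show ?thesis
    by (simp add: cm_def lin_simps[OF lin_grp] pairing_act_h[OF G_orth[OF w]])
qed

lemma grp_dunkl: "w \<in> G \<Longrightarrow> grp w (dunkl y u) = dunkl (act_h w y) (grp w u)"
  by (induction u rule: vpoly_induct_x)
    (simp_all add: dunkl_lw grp_lw lin_simps[OF lin_grp] lin_simps[OF lin_dunkl] dunkl_mulx grp_mulx
      grp_cm act_dual_G)

lemma dunkl_cm: "dunkl y (cm y' x u) = cm y' x (dunkl y u) -
    (\<Sum>s\<in>S. scal (of_real (c s) * (pairing y' (root_of s) * pairing y (root_of s)) * pairing (coroot_of s) x)
      (dunkl (coroot_of s) (grp s u)))"
proof -
  have 1: "grp s (dunkl y u) = dunkl y (grp s u) - scal (pairing y (root_of s)) (dunkl (coroot_of s) (grp s u))"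
    if "s \<in> S" for s
    using that by (simp add: grp_dunkl act_S dunkl_diff_vec dunkl_scale_vec)
  have "cm y' x (dunkl y u) - dunkl y (cm y' x u) =
     - (\<Sum>s\<in>S. scal (of_real (c s) * pairing y' (root_of s) * pairing (coroot_of s) x)
          (grp s (dunkl y u) - dunkl y (grp s u)))"
    by (simp add: cm_def lin_simps[OF lin_dunkl] V.scale_right_diff_distrib sum_subtractf)
  also have "(\<Sum>s\<in>S. scal (of_real (c s) * pairing y' (root_of s) * pairing (coroot_of s) x)
          (grp s (dunkl y u) - dunkl y (grp s u))) =
     (\<Sum>s\<in>S. - scal (of_real (c s) * (pairing y' (root_of s) * pairing y (root_of s)) * pairing (coroot_of s) x)
      (dunkl (coroot_of s) (grp s u)))"
    by (intro sum.cong refl) (simp add: 1 mult_ac)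
  finally show ?thesis by (simp add: sum_negf algebra_simps)
qed

text \<open>At \<open>mulx x u\<close> both orders leave, besides the induction hypothesis, two
  mixed terms. By \<open>dunkl_cm\<close> these are an expression symmetric in \<open>y\<close> and
  \<open>y'\<close> minus a correction that is symmetric as well.\<close>

lemma dunkl_commute: "dunkl y (dunkl y' u) = dunkl y' (dunkl y u)"
proof (induction u rule: vpoly_induct_x)
  case (x x u)
  have "dunkl y (dunkl y' (mulx x u)) =
      mulx x (dunkl y (dunkl y' u)) + (cm y x (dunkl y' u) + dunkl y (cm y' x u))" for y y'
    by (simp add: dunkl_mulx lin_simps[OF lin_dunkl])
  moreover have "cm y x (dunkl y' u) + dunkl y (cm y' x u) = cm y' x (dunkl y u) + dunkl y' (cm y x u)"
    by (simp add: dunkl_cm mult_ac add_ac)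
  ultimately show ?case using x by simp
qed (simp_all add: dunkl_lw lin_simps[OF lin_dunkl])

end

section \<open>The action of the Cherednik algebra on polynomials\<close>

context dunkl_setup
begin

section \<open>Operators attached to tensors and to elements of the smash product\<close>

primrec letter_op :: "letter \<Rightarrow> 'n vpoly \<Rightarrow> 'n vpoly" where
  "letter_op (LY i) = dunkl (axis i 1)"
| "letter_op (LX i) = mulx (axis i 1)"

definition word_op :: "letter free_mon \<Rightarrow> 'n vpoly \<Rightarrow> 'n vpoly" where
  "word_op m u = foldr letter_op (letters m) u"

definition tens_op :: "tens \<Rightarrow> 'n vpoly \<Rightarrow> 'n vpoly" where
  "tens_op p u = linext (\<lambda>m k. scal k (word_op m u)) p"

lemma lin_letter_op: "lin (letter_op a)"
  by (cases a) (simp_all add: lin_dunkl lin_mulx)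

lemma word_op_Nil: "word_op (Free_Mon []) u = u"
  and word_op_Cons: "word_op (Free_Mon (a # l)) u = letter_op a (word_op (Free_Mon l) u)"
  by (simp_all add: word_op_def)

lemma lin_word_op: "lin (word_op m)"
proof -
  have "lin (word_op (Free_Mon l))" for l
  proof (induction l)
    case Nil
    show ?case by (rule linI) (simp_all add: word_op_Nil)
  next
    case (Cons a l)
    show ?case using lin_compose[OF lin_letter_op Cons.IH, of a] by (simp add: word_op_Cons lin_def)
  qed
  from this[of "letters m"] show ?thesis by simp
qed

lemma word_op_add: "word_op (m + n) u = word_op m (word_op n u)"
  by (simp add: word_op_def plus_free_mon_def)

lemma tens_op_add: "tens_op (p + q) u = tens_op p u + tens_op q u"
  unfolding tens_op_def by (rule linext_add) (simp_all add: V.scale_left_distrib)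

lemma tens_op_single: "tens_op (single m k) u = scal k (word_op m u)"
  unfolding tens_op_def by (rule linext_single) simp

lemma tens_op_0 [simp]: "tens_op 0 u = 0"
  by (simp add: tens_op_def)

lemma tens_op_minus: "tens_op (- p) u = - tens_op p u"
  using tens_op_add[of p "- p" u] by (simp add: add_eq_0_iff)

lemma tens_op_diff: "tens_op (p - q) u = tens_op p u - tens_op q u"
  using tens_op_add[of p "- q" u] by (simp add: tens_op_minus)

lemma tens_op_sum: "tens_op (sum f A) u = (\<Sum>a\<in>A. tens_op (f a) u)"
  by (induction A rule: infinite_finite_induct) (simp_all add: tens_op_add)

lemma lin_tens_op: "lin (tens_op p)"
  by (induction p rule: poly_mapping_add_induct)
    (simp_all add: lin_def tens_op_single tens_op_add lin_simps[OF lin_word_op] V.scale_right_distrib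
      V.scale_left_commute)

lemma tens_op_mult: "tens_op (p * q) u = tens_op p (tens_op q u)"
proof (induction p rule: poly_mapping_add_induct)
  case (single m k)
  show ?case
    by (induction q rule: poly_mapping_add_induct)
      (simp_all add: mult_single tens_op_single word_op_add lin_simps[OF lin_word_op] distrib_left
        tens_op_add V.scale_right_distrib)
qed (simp add: distrib_right tens_op_add)

lemma tens_op_const: "tens_op (tens_const k) u = scal k u"
  by (simp add: tens_const_def tens_op_single word_op_def zero_free_mon_def)

lemma tens_op_1 [simp]: "tens_op 1 u = u"
  using tens_op_const[of 1] by (simp add: tens_const_1)

lemma tens_op_X: "tens_op (tens_X x) u = mulx x u"
  by (subst (1 2) vec2_expansion[of x])
    (simp only: tens_X_add tens_X_scale tens_op_add tens_op_mult tens_op_const mulx_add mulx_scale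
      tens_X_axis tens_op_single word_op_Cons word_op_Nil letter_op.simps V.scale_one)

lemma tens_op_Y: "tens_op (tens_Y y) u = dunkl y u"
  by (subst (1 2) vec2_expansion[of y])
    (simp only: tens_Y_add tens_Y_scale tens_op_add tens_op_mult tens_op_const dunkl_add_vec dunkl_scale_vec
      tens_Y_axis tens_op_single word_op_Cons word_op_Nil letter_op.simps V.scale_one)

text \<open>Acting on a tensor corresponds to conjugating its operator by \<open>grp w\<close>; this
  turns convolution in the smash product into composition.\<close>

lemma tens_op_act:
  assumes "w \<in> G"
  shows "tens_op (act_tens w p) (grp w u) = grp w (tens_op p u)"
proof (induction p rule: poly_mapping_add_induct)
  case (single m k)
  have 1: "tens_op (act_letter w a) (grp w u) = grp w (letter_op a u)" for a u
    by (cases a) (simp_all add: tens_op_X tens_op_Y grp_mulx grp_dunkl[OF assms])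
  have "tens_op (act_word w (Free_Mon l)) (grp w u) = grp w (word_op (Free_Mon l) u)" for l
    by (induction l) (simp_all add: act_word_Nil act_word_Cons word_op_Nil word_op_Cons tens_op_mult 1)
  from this[of "letters m"] show ?case
    by (simp add: act_tens_single tens_op_mult tens_op_const tens_op_single lin_simps[OF lin_grp])
qed (simp add: act_tens_add tens_op_add lin_simps[OF lin_grp])

definition smash_op :: "(real^2^2 \<Rightarrow> tens) \<Rightarrow> 'n vpoly \<Rightarrow> 'n vpoly" where
  "smash_op f u = (\<Sum>w\<in>G. tens_op (f w) (grp w u))"

lemma lin_smash_op: "lin (smash_op f)"
  unfolding smash_op_def[abs_def] by (intro lin_sum_fun lin_compose[OF lin_tens_op lin_grp])

lemma smash_op_add: "smash_op (f \<boxplus> g) u = smash_op f u + smash_op g u"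
  by (simp add: smash_op_def add_smash tens_op_add sum.distrib)

lemma smash_op_diff:
  "f \<in> carrier (smash d) \<Longrightarrow> g \<in> carrier (smash d) \<Longrightarrow>
    smash_op (f \<boxminus> g) u = smash_op f u - smash_op g u"
  by (simp add: smash_op_def a_minus_smash tens_op_diff sum_subtractf)

lemma smash_op_a_inv: "f \<in> carrier (smash d) \<Longrightarrow> smash_op (\<ominus>\<^bsub>smash d\<^esub> f) u = - smash_op f u"
  by (simp add: smash_op_def a_inv_smash tens_op_minus sum_negf)

lemma smash_op_zero: "smash_op \<zero>\<^bsub>smash d\<^esub> u = 0"
  by (simp add: smash_op_def zero_smash)

lemma smash_op_mult: "smash_op (f \<cdot> g) u = smash_op f (smash_op g u)"
proof -
  have "smash_op (f \<cdot> g) u =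
      (\<Sum>v\<in>G. \<Sum>w\<in>G. tens_op (f v) (tens_op (act_tens v (g (matrix_inv v ** w))) (grp w u)))"
    by (simp add: smash_op_def mult_smash tens_op_sum tens_op_mult) (rule sum.swap)
  also have "\<dots> = (\<Sum>v\<in>G. \<Sum>w\<in>G. tens_op (f v) (tens_op (act_tens v (g w)) (grp (v ** w) u)))"
    by (rule sum.cong[OF refl], subst sum_G_translate[symmetric]) auto
  also have "\<dots> = smash_op f (smash_op g u)"
    by (simp add: smash_op_def lin_simps[OF lin_grp] lin_simps[OF lin_tens_op] tens_op_act[symmetric]
        grp_mult cong: sum.cong)
  finally show ?thesis .
qed

lemma smash_op_of_tens: "smash_op (of_tens p) u = tens_op p u"
  by (simp add: smash_op_def of_tens_def if_distrib[of "\<lambda>p. tens_op p _"] sum.delta grp_1 cong: if_cong)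

lemma smash_op_const: "smash_op (of_const k) u = scal k u"
  and smash_op_X: "smash_op (of_X x) u = mulx x u"
  and smash_op_Y: "smash_op (of_Y y) u = dunkl y u"
  by (simp_all add: of_const_def of_X_def of_Y_def smash_op_of_tens tens_op_const tens_op_X tens_op_Y)

lemma smash_op_grp: "w \<in> G \<Longrightarrow> smash_op (of_grp w) u = grp w u"
  by (simp add: smash_op_def of_grp_def if_distrib[of "\<lambda>p. tens_op p _"] sum.delta cong: if_cong)

lemma smash_op_one: "smash_op \<one>\<^bsub>smash d\<^esub> u = u"
  by (simp add: one_smash smash_op_of_tens)

lemma smash_op_finsum:
  "finite T \<Longrightarrow> F \<in> T \<rightarrow> carrier (smash d) \<Longrightarrow>
    smash_op (finsum (smash d) F T) u = (\<Sum>s\<in>T. smash_op (F s) u)"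
  by (simp add: smash_op_def finsum_smash tens_op_sum) (rule sum.swap)

section \<open>The defining relations and the quotient ring\<close>

definition rel_coeff :: "complex^2 \<Rightarrow> complex^2 \<Rightarrow> real^2^2 \<Rightarrow> complex" where
  "rel_coeff y x s = complex_of_real (c s) * pairing y (root_of s) * pairing (coroot_of s) x"

definition rel_rhs :: "complex^2 \<Rightarrow> complex^2 \<Rightarrow> real^2^2 \<Rightarrow> tens" where
  "rel_rhs y x = of_const (pairing y x) \<boxminus>
     finsum (smash d) (\<lambda>s. of_const (rel_coeff y x s) \<cdot> of_grp s) S"

abbreviation comm_xx where "comm_xx x x' \<equiv> of_X x \<cdot> of_X x' \<boxminus> of_X x' \<cdot> of_X x"
abbreviation comm_yy where "comm_yy y y' \<equiv> of_Y y \<cdot> of_Y y' \<boxminus> of_Y y' \<cdot> of_Y y"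
abbreviation comm_yx where "comm_yx y x \<equiv>
  (of_Y y \<cdot> of_X x \<boxminus> of_X x \<cdot> of_Y y) \<boxminus> rel_rhs y x"

lemma cherednik_relations_eq: "cherednik_relations d c =
    {comm_xx x x' | x x'. True} \<union> {comm_yy y y' | y y'. True} \<union> {comm_yx y x | y x. True}"
  by (simp add: cherednik_relations_def Let_def rel_rhs_def rel_coeff_def)

lemma rel_rhs_fun: "(\<lambda>s. of_const (rel_coeff y x s) \<cdot> of_grp s) \<in> S \<rightarrow> carrier (smash d)"
  by auto

lemma rel_rhs_closed [simp]: "rel_rhs y x \<in> carrier (smash d)"
  unfolding rel_rhs_def using rel_rhs_fun by (intro A.minus_closed A.finsum_closed) auto

lemma smash_op_rel_rhs: "smash_op (rel_rhs y x) u = cm y x u"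
proof -
  have "finsum (smash d) (\<lambda>s. of_const (rel_coeff y x s) \<cdot> of_grp s) S \<in> carrier (smash d)"
    using rel_rhs_fun by (rule A.finsum_closed)
  then have "smash_op (rel_rhs y x) u = scal (pairing y x) u - (\<Sum>s\<in>S. scal (rel_coeff y x s) (grp s u))"
    unfolding rel_rhs_def
    by (simp add: smash_op_diff smash_op_const smash_op_finsum[OF S_finite rel_rhs_fun] smash_op_mult
        smash_op_grp)
  then show ?thesis by (simp add: cm_def rel_coeff_def)
qed

text \<open>The elements acting by zero form a two-sided ideal. It contains the defining relations,
  hence the ideal \<open>J\<close> they generate, and so the polynomials become a module over the
  Cherednik algebra.\<close>

definition op_kernel :: "(real^2^2 \<Rightarrow> tens) set" where
  "op_kernel = {f \<in> carrier (smash d). \<forall>u. smash_op f u = 0}"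

lemma ideal_op_kernel: "ideal op_kernel (smash d)"
proof (rule idealI[OF ring_smash])
  show "subgroup op_kernel (add_monoid (smash d))"
    by (rule A.add.subgroupI)
      (auto simp: op_kernel_def smash_op_add smash_op_a_inv a_inv_def[symmetric] smash_op_zero
        intro!: exI[of _ "\<zero>\<^bsub>smash d\<^esub>"])
qed (auto simp: op_kernel_def smash_op_mult lin_simps[OF lin_smash_op])

lemma relations_closed: "cherednik_relations d c \<subseteq> carrier (smash d)"
  by (auto simp: cherednik_relations_eq)

lemma relations_in_kernel: "cherednik_relations d c \<subseteq> op_kernel"
  by (auto simp: cherednik_relations_eq op_kernel_def smash_op_diff smash_op_mult smash_op_X smash_op_Y
      mulx_commute dunkl_commute dunkl_mulx smash_op_rel_rhs)

definition J where "J = Idl\<^bsub>smash d\<^esub> (cherednik_relations d c)"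

sublocale JI: ideal J "smash d"
  unfolding J_def by (rule A.genideal_ideal[OF relations_closed])

lemma J_subset: "J \<subseteq> op_kernel"
  unfolding J_def by (rule A.genideal_minimal[OF ideal_op_kernel relations_in_kernel])

lemma cherednik_eq: "cherednik d c = smash d Quot J"
  by (simp add: cherednik_def J_def)

sublocale H: ring "cherednik d c"
  unfolding cherednik_eq by (rule JI.quotient_is_ring)

abbreviation cls where "cls f \<equiv> H_class d c f"

lemma cls_eq: "cls f = J +>\<^bsub>smash d\<^esub> f"
  by (simp add: H_class_def J_def)

sublocale cl: ring_hom_ring "smash d" "cherednik d c" "H_class d c"
proof -
  have "H_class d c = (+>\<^bsub>smash d\<^esub>) J" by (auto simp: cls_eq)
  then show "ring_hom_ring (smash d) (cherednik d c) (H_class d c)"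
    unfolding cherednik_eq using JI.rcos_ring_hom_ring by simp
qed

lemma carrier_cherednik: "carrier (cherednik d c) = H_class d c ` carrier (smash d)"
  unfolding cherednik_eq by (auto simp: FactRing_def A_RCOSETS_def' cls_eq)

lemma cls_self: "f \<in> carrier (smash d) \<Longrightarrow> f \<in> cls f"
  unfolding cls_eq by (rule JI.a_rcos_self)

lemma in_clsD: "f \<in> cls g \<Longrightarrow> g \<in> carrier (smash d) \<Longrightarrow> f \<in> carrier (smash d) \<and> cls f = cls g"
  unfolding cls_eq by (metis A.a_repr_independence JI.a_subgroup JI.a_elemrcos_carrier)

lemma cls_eq_iff:
  assumes "f \<in> carrier (smash d)" "g \<in> carrier (smash d)"
  shows "cls f = cls g \<longleftrightarrow> f \<boxminus> g \<in> J"
proof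
  assume "cls f = cls g"
  then have "f \<in> J +>\<^bsub>smash d\<^esub> g" using cls_self[OF assms(1)] by (simp add: cls_eq)
  then obtain j where "j \<in> J" "f = j \<boxplus> g" by (auto simp: a_r_coset_def')
  then show "f \<boxminus> g \<in> J"
    using assms JI.Icarr[of j] by (simp add: a_minus_smash add_smash)
next
  assume "f \<boxminus> g \<in> J"
  moreover have "f = (f \<boxminus> g) \<boxplus> g"
    using assms by (simp add: a_minus_smash add_smash)
  ultimately have "f \<in> cls g" unfolding cls_eq a_r_coset_def' by blast
  then show "cls f = cls g" using in_clsD assms(2) by blast
qed

lemma smash_op_cls_cong:
  assumes "f \<in> carrier (smash d)" "g \<in> carrier (smash d)" "cls f = cls g"
  shows "smash_op f u = smash_op g u"
  using assms J_subset by (force simp: cls_eq_iff op_kernel_def smash_op_diff)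

text \<open>A coset acts through a representative chosen by \<open>SOME\<close>; by
  \<open>smash_op_cls_cong\<close> every representative gives the same operator.\<close>

definition Hop :: "(real^2^2 \<Rightarrow> tens) set \<Rightarrow> 'n vpoly \<Rightarrow> 'n vpoly" where
  "Hop F = smash_op (SOME f. f \<in> F)"

lemma Hop_cls: "f \<in> carrier (smash d) \<Longrightarrow> Hop (cls f) u = smash_op f u"
  unfolding Hop_def using someI[of "\<lambda>g. g \<in> cls f", OF cls_self] in_clsD smash_op_cls_cong by metis

lemma lin_Hop: "lin (Hop a)"
  unfolding Hop_def by (rule lin_smash_op)

lemma Hop_add: "a \<in> carrier (cherednik d c) \<Longrightarrow> b \<in> carrier (cherednik d c) \<Longrightarrow>
    Hop (a \<oplus>\<^bsub>cherednik d c\<^esub> b) u = Hop a u + Hop b u"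
  by (auto simp: carrier_cherednik cl.hom_add[symmetric] Hop_cls smash_op_add simp del: cl.hom_add)

lemma Hop_mult: "a \<in> carrier (cherednik d c) \<Longrightarrow> b \<in> carrier (cherednik d c) \<Longrightarrow>
    Hop (a \<otimes>\<^bsub>cherednik d c\<^esub> b) u = Hop a (Hop b u)"
  by (auto simp: carrier_cherednik cl.hom_mult[symmetric] Hop_cls smash_op_mult simp del: cl.hom_mult)

lemma Hop_one: "Hop \<one>\<^bsub>cherednik d c\<^esub> u = u"
  using Hop_cls[OF A.one_closed] by (simp add: smash_op_one)

lemma cls_commute_X: "cls (of_X x) \<otimes>\<^bsub>cherednik d c\<^esub> cls (of_X x') = cls (of_X x') \<otimes>\<^bsub>cherednik d c\<^esub> cls (of_X x)"
proof -
  have "comm_xx x x' \<in> J"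
    unfolding J_def by (rule subsetD[OF A.genideal_self[OF relations_closed]]) (auto simp: cherednik_relations_eq)
  then show ?thesis by (simp add: cl.hom_mult[symmetric] cls_eq_iff del: cl.hom_mult)
qed

lemma minus_minus_smash:
  assumes "f \<in> carrier (smash d)" "g \<in> carrier (smash d)" "h \<in> carrier (smash d)"
  shows "f \<boxminus> g \<boxminus> h = f \<boxminus> (g \<boxplus> h)"
  using a_minus_smash[OF A.minus_closed[OF assms(1,2)] assms(3)] a_minus_smash[OF assms(1,2)]
    a_minus_smash[OF assms(1) A.a_closed[OF assms(2,3)]]
  by (simp add: add_smash algebra_simps)

lemma cls_YX: "cls (of_Y y) \<otimes>\<^bsub>cherednik d c\<^esub> cls (of_X x) =
    cls (of_X x) \<otimes>\<^bsub>cherednik d c\<^esub> cls (of_Y y) \<oplus>\<^bsub>cherednik d c\<^esub> cls (rel_rhs y x)"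
proof -
  have "comm_yx y x \<in> J"
    unfolding J_def by (rule subsetD[OF A.genideal_self[OF relations_closed]]) (auto simp: cherednik_relations_eq)
  moreover have "comm_yx y x = of_Y y \<cdot> of_X x \<boxminus>
      (of_X x \<cdot> of_Y y \<boxplus> rel_rhs y x)"
    by (rule minus_minus_smash) auto
  ultimately have "cls (of_Y y \<cdot> of_X x) = cls (of_X x \<cdot> of_Y y \<boxplus> rel_rhs y x)"
    by (subst cls_eq_iff) auto
  then show ?thesis by simp
qed

end

section \<open>Constant terms and the subalgebra generated by the group and \<open>h\<close>\<close>

lemma free_mon_add_eq_0_iff: "m + n = 0 \<longleftrightarrow> m = 0 \<and> n = 0" for m n :: "'a free_mon"
  by (cases m; cases n) (simp add: plus_free_mon_def zero_free_mon_def)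

text \<open>A product of words is empty only if both factors are, so the constant term is
  multiplicative. It is the augmentation through which h acts by zero on \<tau>.\<close>

lemma lookup_mult_0: "lookup (p * q) 0 = lookup p 0 * lookup q 0"
  for p q :: tens
proof (induction p rule: poly_mapping_add_induct)
  case (single m k)
  show ?case
    by (induction q rule: poly_mapping_add_induct)
      (simp_all add: mult_single lookup_single when_def free_mon_add_eq_0_iff distrib_left lookup_add)
qed (simp add: distrib_right lookup_add)

lemma lookup_tens_Y_0 [simp]: "lookup (tens_Y y) 0 = 0"
  and lookup_tens_X_0 [simp]: "lookup (tens_X y) 0 = 0"
  by (simp_all add: tens_Y_def tens_X_def lookup_sum lookup_single when_def zero_free_mon_def)

lemma lookup_tens_const_0 [simp]: "lookup (tens_const k) 0 = k"
  by (simp add: tens_const_def)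

lemma lookup_act_word_0: "lookup (act_word w m) 0 = (if m = 0 then 1 else 0)"
proof (cases m)
  case (Free_Mon l)
  have 1: "lookup (act_letter w a) 0 = 0" for a by (cases a) simp_all
  have "Free_Mon l = 0 \<longleftrightarrow> l = []" by (simp add: zero_free_mon_def)
  then show ?thesis
    by (cases l) (simp_all add: Free_Mon act_word_Cons act_word_Nil lookup_mult_0 1)
qed

lemma lookup_act_tens_0: "lookup (act_tens w p) 0 = lookup p 0"
  by (induction p rule: poly_mapping_add_induct)
    (simp_all add: act_tens_single lookup_mult_0 lookup_act_word_0 lookup_single act_tens_add lookup_add when_def)

definition Y_tens :: "tens set" where
  "Y_tens = {p. \<forall>m\<in>keys p. set (letters m) \<subseteq> range LY}"

lemma Y_tens_0 [simp]: "0 \<in> Y_tens"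
  and Y_tens_uminus: "p \<in> Y_tens \<Longrightarrow> - p \<in> Y_tens"
  by (simp_all add: Y_tens_def)

lemma Y_tens_add: "p \<in> Y_tens \<Longrightarrow> q \<in> Y_tens \<Longrightarrow> p + q \<in> Y_tens"
  using Poly_Mapping.keys_add[of p q] by (auto simp: Y_tens_def dest: subsetD)

lemma Y_tens_sum: "(\<And>a. a \<in> A \<Longrightarrow> f a \<in> Y_tens) \<Longrightarrow> sum f A \<in> Y_tens"
  by (induction A rule: infinite_finite_induct) (auto intro: Y_tens_add)

lemma Y_tens_mult:
  assumes "p \<in> Y_tens" "q \<in> Y_tens"
  shows "p * q \<in> Y_tens"
proof -
  have "set (letters (a + b)) \<subseteq> range LY"
    if "a \<in> keys p" "b \<in> keys q" for a b
    using assms that unfolding Y_tens_def plus_free_mon_def by force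
  then show ?thesis using keys_mult[of p q] unfolding Y_tens_def by blast
qed

lemma Y_tens_const [simp]: "tens_const k \<in> Y_tens"
  by (simp add: Y_tens_def tens_const_def zero_free_mon_def)

lemma Y_tens_1 [simp]: "1 \<in> Y_tens"
  using Y_tens_const[of 1] by (simp add: tens_const_1)

lemma Y_tens_Y [simp]: "tens_Y y \<in> Y_tens"
  unfolding tens_Y_def by (rule Y_tens_sum) (simp add: Y_tens_def)

lemma Y_tens_act:
  assumes "p \<in> Y_tens"
  shows "act_tens w p \<in> Y_tens"
proof -
  have "act_word w (Free_Mon l) \<in> Y_tens" if "set l \<subseteq> range LY" for l
    using that by (induction l) (auto simp: act_word_Nil act_word_Cons intro!: Y_tens_mult)
  then have word: "act_word w m \<in> Y_tens" if "set (letters m) \<subseteq> range LY" for m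
    using that by (metis free_mon.collapse)
  have "set (letters m) \<subseteq> range LY" if "m \<in> keys p" for m
    using assms that by (simp add: Y_tens_def)
  then show ?thesis
    unfolding act_tens_linext linext_def by (intro Y_tens_sum Y_tens_mult Y_tens_const word)
qed

context dihedral_setup
begin

lemma carrier_smash_h: "carrier (smash_h d) = {f \<in> carrier (smash d). \<forall>w. f w \<in> Y_tens}"
  by (auto simp: smash_h_def Y_tens_def)

lemma smash_h_simps: "mult (smash_h d) = mult (smash d)" "ring.add (smash_h d) = ring.add (smash d)"
    "one (smash_h d) = one (smash d)" "ring.zero (smash_h d) = ring.zero (smash d)"
  by (simp_all add: smash_h_def)

lemma subring_smash_h: "subring (carrier (smash_h d)) (smash d)"
proof (rule A.subringI)
  show "\<one>\<^bsub>smash d\<^esub> \<in> carrier (smash_h d)"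
    using A.one_closed by (simp add: carrier_smash_h) (simp add: one_smash of_tens_def)
next
  fix f assume "f \<in> carrier (smash_h d)"
  then show "\<ominus>\<^bsub>smash d\<^esub> f \<in> carrier (smash_h d)"
    using A.a_inv_closed[of f] by (simp add: carrier_smash_h) (simp add: a_inv_smash Y_tens_uminus)
next
  fix f g assume fg: "f \<in> carrier (smash_h d)" "g \<in> carrier (smash_h d)"
  then show "f \<cdot> g \<in> carrier (smash_h d)"
    using A.m_closed[of f g]
    by (simp add: carrier_smash_h) (simp add: mult_smash Y_tens_sum Y_tens_mult Y_tens_act)
  show "f \<boxplus> g \<in> carrier (smash_h d)"
    using fg A.a_closed[of f g]
    by (simp add: carrier_smash_h) (simp add: add_smash Y_tens_add)
qed (simp add: carrier_smash_h)

lemma smash_h_eq: "smash_h d = (smash d)\<lparr>carrier := carrier (smash_h d)\<rparr>"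
  by (simp add: smash_h_def)

lemma ring_smash_h: "ring (smash_h d)"
  by (subst smash_h_eq) (rule A.subring_is_ring[OF subring_smash_h])

sublocale B: ring "smash_h d" by (rule ring_smash_h)

lemma a_inv_smash_h: "f \<in> carrier (smash_h d) \<Longrightarrow> \<ominus>\<^bsub>smash_h d\<^esub> f = (\<lambda>w. - f w)"
  by (rule B.minus_equality)
    (auto simp: smash_h_simps add_smash zero_smash carrier_smash_h carrier_smash Y_tens_uminus)

lemma a_minus_smash_h: "g \<in> carrier (smash_h d) \<Longrightarrow> f \<ominus>\<^bsub>smash_h d\<^esub> g = (\<lambda>w. f w - g w)"
  by (simp add: a_minus_def a_inv_smash_h smash_h_simps add_smash)

lemma of_Y_smash_h [simp]: "of_Y y \<in> carrier (smash_h d)"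
  and of_const_smash_h [simp]: "of_const k \<in> carrier (smash_h d)"
  and of_grp_smash_h [simp]: "u \<in> G \<Longrightarrow> of_grp u \<in> carrier (smash_h d)"
  by (auto simp: carrier_smash_h) (auto simp: of_Y_def of_tens_def of_const_def of_grp_def)

end

context dunkl_setup
begin

definition JY where "JY = Idl\<^bsub>smash_h d\<^esub>
     {of_Y y \<otimes>\<^bsub>smash_h d\<^esub> of_Y y' \<ominus>\<^bsub>smash_h d\<^esub> of_Y y' \<otimes>\<^bsub>smash_h d\<^esub> of_Y y | y y'. True}"

lemma comm_closed: "{of_Y y \<otimes>\<^bsub>smash_h d\<^esub> of_Y y' \<ominus>\<^bsub>smash_h d\<^esub> of_Y y' \<otimes>\<^bsub>smash_h d\<^esub> of_Y y | y y'. True}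
    \<subseteq> carrier (smash_h d)"
  by (auto intro!: B.minus_closed B.m_closed)

sublocale JYI: ideal JY "smash_h d"
  unfolding JY_def by (rule B.genideal_ideal[OF comm_closed])

text \<open>Two properties of the commutator ideal matter: it maps to zero in the Cherednik algebra,
  and its elements have no constant terms, hence act by zero on \<tau>. Both together define an
  ideal, so \<open>JY_subset\<close> has to check them on the generators only.\<close>

definition JY0 where
  "JY0 = {f \<in> carrier (smash_h d). f \<in> J \<and> (\<forall>w. lookup (f w) 0 = 0)}"

lemma ideal_JY0: "ideal JY0 (smash_h d)"
proof (rule idealI[OF ring_smash_h])
  show "subgroup JY0 (add_monoid (smash_h d))"
  proof (rule B.add.subgroupI)
    show "JY0 \<noteq> {}" using JI.zero_closed B.zero_closed
      by (auto simp: JY0_def smash_h_simps zero_smash intro!: exI[of _ "\<zero>\<^bsub>smash d\<^esub>"])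
    fix f assume f: "f \<in> JY0"
    then have "(\<lambda>w. - f w) \<in> J" using JI.a_inv_closed[of f] by (simp add: JY0_def a_inv_smash carrier_smash_h)
    moreover have "(\<lambda>w. - f w) \<in> carrier (smash_h d)"
      using B.a_inv_closed[of f] f by (simp add: JY0_def a_inv_smash_h)
    ultimately show "\<ominus>\<^bsub>smash_h d\<^esub> f \<in> JY0"
      using f by (auto simp: JY0_def a_inv_smash_h)
  next
    fix f g assume "f \<in> JY0" "g \<in> JY0"
    then show "f \<oplus>\<^bsub>smash_h d\<^esub> g \<in> JY0"
      using B.a_closed[of f g] JI.a_closed[of f g]
      by (simp add: JY0_def smash_h_simps add_smash lookup_add)
  qed (auto simp: JY0_def)
next
  fix f x assume f: "f \<in> JY0" and x: "x \<in> carrier (smash_h d)"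
  show "x \<otimes>\<^bsub>smash_h d\<^esub> f \<in> JY0"
    using f x B.m_closed[of x f] JI.I_l_closed[of f x]
    by (simp add: JY0_def smash_h_simps carrier_smash_h)
      (simp add: mult_smash lookup_sum lookup_mult_0 lookup_act_tens_0)
  show "f \<otimes>\<^bsub>smash_h d\<^esub> x \<in> JY0"
    using f x B.m_closed[of f x] JI.I_r_closed[of f x]
    by (simp add: JY0_def smash_h_simps carrier_smash_h)
      (simp add: mult_smash lookup_sum lookup_mult_0 lookup_act_tens_0)
qed

lemma JY_subset: "JY \<subseteq> JY0"
  unfolding JY_def
proof (rule B.genideal_minimal[OF ideal_JY0], clarify)
  fix y y'
  let ?f = "of_Y y \<otimes>\<^bsub>smash_h d\<^esub> of_Y y' \<ominus>\<^bsub>smash_h d\<^esub> of_Y y' \<otimes>\<^bsub>smash_h d\<^esub> of_Y y"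
  have h: "?f \<in> carrier (smash_h d)" using comm_closed by blast
  have eq: "?f = comm_yy y y'"
    by (subst a_minus_smash_h) (auto simp: a_minus_smash smash_h_simps(1)[symmetric] simp del: smash_h_simps
        intro: B.m_closed, simp add: smash_h_simps a_minus_smash)
  have "comm_yy y y' \<in> J"
    unfolding J_def by (rule subsetD[OF A.genideal_self[OF relations_closed]]) (auto simp: cherednik_relations_eq)
  moreover have "lookup (comm_yy y y' w) 0 = 0" for w
    by (simp add: a_minus_smash) (simp add: of_Y_def of_tens_mult_of_tens, simp add: of_tens_def lookup_minus lookup_mult_0)
  ultimately show "?f \<in> JY0" using h unfolding JY0_def eq by blast
qed

definition const_act :: "(real^2^2 \<Rightarrow> tens) \<Rightarrow> complex^'n \<Rightarrow> complex^'n" where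
  "const_act f v = (\<Sum>w\<in>G. lookup (f w) 0 *s (\<rho> w *v v))"

lemma smash_sym_eq: "smash_sym d = smash_h d Quot JY"
  by (simp add: smash_sym_def JY_def)

lemma carrier_smash_sym: "carrier (smash_sym d) = {JY +>\<^bsub>smash_h d\<^esub> f | f. f \<in> carrier (smash_h d)}"
  unfolding smash_sym_eq by (auto simp: FactRing_def A_RCOSETS_def')

text \<open>Independence of the representative for both coset constructions: the union in
  \<open>smash_sym_hom\<close> and the choice in \<open>rep_module\<close>.\<close>

lemma smash_sym_coset:
  assumes "f \<in> carrier (smash_h d)" "g \<in> JY +>\<^bsub>smash_h d\<^esub> f"
  shows "cls g = cls f" "const_act g v = const_act f v"
proof -
  obtain j where j: "j \<in> JY0" "g = j \<boxplus> f"
    using assms(2) JY_subset by (auto simp: a_r_coset_def' smash_h_simps)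
  have f: "f \<in> carrier (smash d)"
    using assms(1) by (simp add: carrier_smash_h)
  have "g \<in> cls f" using j by (auto simp: cls_eq a_r_coset_def' JY0_def)
  then show "cls g = cls f" using in_clsD f by blast
  show "const_act g v = const_act f v"
    using j by (simp add: const_act_def add_smash JY0_def lookup_add)
qed

lemma smash_sym_action:
  assumes "f \<in> carrier (smash_h d)"
  defines "F \<equiv> JY +>\<^bsub>smash_h d\<^esub> f"
  shows "smash_sym_hom d c F = cls f" "F \<odot>\<^bsub>rep_module d \<rho>\<^esub> v = const_act f v"
proof -
  have self: "f \<in> F" unfolding F_def by (rule JYI.a_rcos_self[OF assms(1)])
  then show "smash_sym_hom d c F = cls f"
    unfolding smash_sym_hom_def using smash_sym_coset(1)[OF assms(1)] unfolding F_def by blast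
  have "(SOME g. g \<in> F) \<in> F" by (rule someI[of "\<lambda>g. g \<in> F", OF self])
  then show "F \<odot>\<^bsub>rep_module d \<rho>\<^esub> v = const_act f v"
    using smash_sym_coset(2)[OF assms(1), of "SOME g. g \<in> F" v, folded F_def]
    by (simp add: rep_module_def Let_def const_act_def)
qed

text \<open>Vectors of h act by Dunkl operators, which kill constants, so only constant terms
  survive. Degree zero is thus \<tau> as a module over the subalgebra, as the third kind of tensor
  relation demands of \<open>ev\<close>.\<close>

lemma smash_op_lw:
  assumes "f \<in> carrier (smash_h d)"
  shows "smash_op f (lw v) = lw (const_act f v)"
proof -
  have word: "word_op (Free_Mon l) (lw v) = (if l = [] then lw v else 0)" if "set l \<subseteq> range LY" for l v
    using that
  proof (induction l)
    case (Cons a l)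
    then show ?case by (auto simp: word_op_Cons dunkl_lw lin_0[OF lin_dunkl])
  qed (simp add: word_op_Nil)
  have lw_sum: "lw (sum h A) = (\<Sum>a\<in>A. lw (h a))" for h :: "real^2^2 \<Rightarrow> complex^'n" and A
    by (induction A rule: infinite_finite_induct) (simp_all add: lw_add, simp_all add: lw_def)
  have "tens_op p (lw v) = lw (lookup p 0 *s v)" if p: "p \<in> Y_tens" for p v
  proof -
    have "tens_op p (lw v) = (\<Sum>m\<in>keys p.
        scal (lookup p m) (if m = 0 then lw v else 0))"
      unfolding tens_op_def linext_def
    proof (rule sum.cong[OF refl])
      fix m assume "m \<in> keys p"
      then have "set (letters m) \<subseteq> range LY" using p by (auto simp: Y_tens_def)
      then have "word_op m (lw v) = (if m = 0 then lw v else 0)"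
        using word[of "letters m" v] by (cases m) (auto simp: zero_free_mon_def)
      then show "scal (lookup p m) (word_op m (lw v)) =
          scal (lookup p m) (if m = 0 then lw v else 0)" by simp
    qed
    also have "\<dots> = (\<Sum>m\<in>keys p. if m = 0 then scal (lookup p 0) (lw v) else 0)"
      by (intro sum.cong) auto
    also have "\<dots> = scal (lookup p 0) (lw v)"
      by (auto simp: sum.delta in_keys_iff)
    finally show ?thesis by (simp add: lw_scale)
  qed
  then show ?thesis
    using assms by (simp add: smash_op_def const_act_def lw_sum grp_lw carrier_smash_h)
qed

end

section \<open>Normal forms in the standard module\<close>

context dunkl_setup
begin

abbreviation HH where "HH \<equiv> cherednik d c"

section \<open>The tensor relations and congruence modulo them\<close>

definition FA :: "((real^2^2 \<Rightarrow> tens) set \<times> (complex^'n) \<Rightarrow>\<^sub>0 int) monoid" where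
  "FA = free_Abelian_group (carrier HH \<times> UNIV)"

definition TR :: "((real^2^2 \<Rightarrow> tens) set \<times> (complex^'n) \<Rightarrow>\<^sub>0 int) set" where
  "TR = tensor_relations HH (smash_sym d) (smash_sym_hom d c) (rep_module d \<rho>)"

text \<open>Classes of \<open>smash_sym\<close> are replaced by representatives in
  \<open>smash_h\<close>, so that cosets of \<open>JY\<close> disappear from the
  calculations.\<close>

definition tensor_gens :: "((real^2^2 \<Rightarrow> tens) set \<times> (complex^'n) \<Rightarrow>\<^sub>0 int) set" where
  "tensor_gens =
      {frag_of (a \<oplus>\<^bsub>HH\<^esub> a', v) - frag_of (a, v) - frag_of (a', v) | a a' v.
          a \<in> carrier HH \<and> a' \<in> carrier HH} \<union>
       {frag_of (a, v + v') - frag_of (a, v) - frag_of (a, v') | a v v'. a \<in> carrier HH} \<union>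
       {frag_of (a \<otimes>\<^bsub>HH\<^esub> cls f, v) - frag_of (a, const_act f v) | a f v.
          a \<in> carrier HH \<and> f \<in> carrier (smash_h d)}"

lemma rep_module_simps: "carrier (rep_module d \<rho>) = UNIV" "v \<oplus>\<^bsub>rep_module d \<rho>\<^esub> v' = v + v'"
  by (simp_all add: rep_module_def)

lemma TR_eq: "TR = generate FA tensor_gens"
proof -
  have "{frag_of (a \<otimes>\<^bsub>HH\<^esub> smash_sym_hom d c b, v) - frag_of (a, b \<odot>\<^bsub>rep_module d \<rho>\<^esub> v) | a b v.
          a \<in> carrier HH \<and> b \<in> carrier (smash_sym d) \<and> v \<in> carrier (rep_module d \<rho>)} =
       {frag_of (a \<otimes>\<^bsub>HH\<^esub> cls f, v) - frag_of (a, const_act f v) | a f v.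
          a \<in> carrier HH \<and> f \<in> carrier (smash_h d)}" (is "?A = ?B")
  proof
    show "?A \<subseteq> ?B"
      unfolding carrier_smash_sym by clarsimp (metis smash_sym_action)
    show "?B \<subseteq> ?A"
    proof
      fix z assume "z \<in> ?B"
      then obtain a f v where z: "z = frag_of (a \<otimes>\<^bsub>HH\<^esub> cls f, v) - frag_of (a, const_act f v)"
        "a \<in> carrier HH" "f \<in> carrier (smash_h d)" by blast
      show "z \<in> ?A" unfolding carrier_smash_sym rep_module_simps
        using z(2,3) by (intro CollectI exI[of _ a] exI[of _ "JY +>\<^bsub>smash_h d\<^esub> f"] exI[of _ v])
          (auto simp: z(1) smash_sym_action)
    qed
  qed
  then show ?thesis
    unfolding TR_def tensor_relations_def tensor_gens_def FA_def rep_module_simps by simp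
qed

lemma carrier_FA: "z \<in> carrier FA \<longleftrightarrow> keys z \<subseteq> carrier HH \<times> UNIV"
  and mult_FA: "z \<otimes>\<^bsub>FA\<^esub> z' = z + z'" and one_FA: "\<one>\<^bsub>FA\<^esub> = 0"
  by (simp_all add: FA_def)

lemma comm_group_FA: "comm_group FA"
  unfolding FA_def by (rule abelian_free_Abelian_group)

sublocale FAG: comm_group FA by (rule comm_group_FA)

lemma inv_FA: "z \<in> carrier FA \<Longrightarrow> inv\<^bsub>FA\<^esub> z = - z"
  by (simp add: FA_def)

lemma FA_0: "0 \<in> carrier FA"
  by (simp add: FA_def)

lemma FA_frag: "a \<in> carrier HH \<Longrightarrow> frag_of (a, v) \<in> carrier FA"
  by (simp add: FA_def)

lemma FA_add: "z \<in> carrier FA \<Longrightarrow> z' \<in> carrier FA \<Longrightarrow> z + z' \<in> carrier FA"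
  using FAG.m_closed by (simp add: mult_FA)

lemma FA_minus: "z \<in> carrier FA \<Longrightarrow> - z \<in> carrier FA"
  using FAG.inv_closed by (simp add: inv_FA)

lemma FA_diff: "z \<in> carrier FA \<Longrightarrow> z' \<in> carrier FA \<Longrightarrow> z - z' \<in> carrier FA"
  using FA_add[of z "- z'"] FA_minus by simp

lemma FA_sum: "(\<And>a. a \<in> A \<Longrightarrow> f a \<in> carrier FA) \<Longrightarrow> sum f A \<in> carrier FA"
  unfolding FA_def by (rule sum_closed_free_Abelian_group)

lemma FA_induct [consumes 1, case_names zero diff frag]:
  assumes "z \<in> carrier FA" "P 0"
    "\<And>x y. x \<in> carrier FA \<Longrightarrow> y \<in> carrier FA \<Longrightarrow> P x \<Longrightarrow> P y \<Longrightarrow> P (x - y)"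
    "\<And>a v. a \<in> carrier HH \<Longrightarrow> P (frag_of (a, v))"
  shows "P z"
  using assms(1)[unfolded carrier_FA]
  by (rule free_Abelian_group_induct) (use assms(2-) in \<open>auto simp: carrier_FA\<close>)

lemma tensor_gens_closed: "tensor_gens \<subseteq> carrier FA"
  unfolding tensor_gens_def
  by (auto intro!: FA_diff FA_frag simp: carrier_smash_h)

lemma TR_subgroup: "subgroup TR FA"
  unfolding TR_eq by (rule FAG.generate_is_subgroup[OF tensor_gens_closed])

lemma TR_closed: "z \<in> TR \<Longrightarrow> z \<in> carrier FA"
  using subgroup.subset[OF TR_subgroup] by blast

lemma TR_0: "0 \<in> TR"
  using subgroup.one_closed[OF TR_subgroup] by (simp add: one_FA)

lemma TR_add: "z \<in> TR \<Longrightarrow> z' \<in> TR \<Longrightarrow> z + z' \<in> TR"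
  using subgroup.m_closed[OF TR_subgroup] by (simp add: mult_FA)

lemma TR_minus: "z \<in> TR \<Longrightarrow> - z \<in> TR"
  using subgroup.m_inv_closed[OF TR_subgroup] TR_closed by (metis inv_FA)

lemma TR_diff: "z \<in> TR \<Longrightarrow> z' \<in> TR \<Longrightarrow> z - z' \<in> TR"
  using TR_add[of z "- z'"] TR_minus by simp

lemma TR_sum: "(\<And>a. a \<in> A \<Longrightarrow> f a \<in> TR) \<Longrightarrow> sum f A \<in> TR"
  by (induction A rule: infinite_finite_induct) (auto intro: TR_0 TR_add)

lemma TR_gens: "z \<in> tensor_gens \<Longrightarrow> z \<in> TR"
  unfolding TR_eq by (rule generate.incl)

lemma TR_induct [consumes 1, case_names zero gens add minus]:
  assumes "z \<in> TR" "P 0" "\<And>g. g \<in> tensor_gens \<Longrightarrow> P g"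
    "\<And>x y. x \<in> TR \<Longrightarrow> y \<in> TR \<Longrightarrow> P x \<Longrightarrow> P y \<Longrightarrow> P (x + y)" "\<And>x. P x \<Longrightarrow> P (- x)"
  shows "P z"
  using assms(1)[unfolded TR_eq]
proof (induction rule: generate.induct)
  case (inv h)
  then show ?case using tensor_gens_closed assms(3,5) by (auto simp: inv_FA)
qed (use assms(2-) in \<open>auto simp: one_FA mult_FA TR_eq[symmetric]\<close>)

definition eqv :: "((real^2^2 \<Rightarrow> tens) set \<times> (complex^'n) \<Rightarrow>\<^sub>0 int) \<Rightarrow> _ \<Rightarrow> bool" (infix "\<doteq>" 50) where
  "z \<doteq> z' \<longleftrightarrow> z - z' \<in> TR"

lemma eqv_refl: "z \<doteq> z"
  by (simp add: eqv_def TR_0)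

lemma eqv_sym: "z \<doteq> z' \<Longrightarrow> z' \<doteq> z"
  using TR_minus[of "z - z'"] by (simp add: eqv_def)

lemma eqv_trans [trans]: "z \<doteq> z' \<Longrightarrow> z' \<doteq> z'' \<Longrightarrow> z \<doteq> z''"
  using TR_add[of "z - z'" "z' - z''"] by (simp add: eqv_def)

lemma eqv_add: "z \<doteq> z' \<Longrightarrow> y \<doteq> y' \<Longrightarrow> z + y \<doteq> z' + y'"
  using TR_add[of "z - z'" "y - y'"] by (simp add: eqv_def algebra_simps)

lemma eqv_diff: "z \<doteq> z' \<Longrightarrow> y \<doteq> y' \<Longrightarrow> z - y \<doteq> z' - y'"
  using TR_diff[of "z - z'" "y - y'"] by (simp add: eqv_def algebra_simps)

lemma eqv_frag_add_left: "a \<in> carrier HH \<Longrightarrow> a' \<in> carrier HH \<Longrightarrow>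
    frag_of (a \<oplus>\<^bsub>HH\<^esub> a', v) \<doteq> frag_of (a, v) + frag_of (a', v)"
  unfolding eqv_def diff_diff_eq[symmetric] by (rule TR_gens) (auto simp: tensor_gens_def)

lemma eqv_frag_add_right: "a \<in> carrier HH \<Longrightarrow> frag_of (a, v + v') \<doteq> frag_of (a, v) + frag_of (a, v')"
  unfolding eqv_def diff_diff_eq[symmetric] by (rule TR_gens) (auto simp: tensor_gens_def)

lemma eqv_frag_act: "a \<in> carrier HH \<Longrightarrow> f \<in> carrier (smash_h d) \<Longrightarrow>
    frag_of (a \<otimes>\<^bsub>HH\<^esub> cls f, v) \<doteq> frag_of (a, const_act f v)"
  unfolding eqv_def by (rule TR_gens) (auto simp: tensor_gens_def)

lemma eqv_frag_0: "a \<in> carrier HH \<Longrightarrow> frag_of (a, 0) \<doteq> 0"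
  using eqv_frag_add_right[of a 0 0] by (simp add: eqv_def)
    (metis TR_minus minus_minus)

section \<open>Left multiplication, evaluation and monomial representatives\<close>

definition lmul :: "(real^2^2 \<Rightarrow> tens) set \<Rightarrow> ((real^2^2 \<Rightarrow> tens) set \<times> (complex^'n) \<Rightarrow>\<^sub>0 int) \<Rightarrow> _" where
  "lmul a = frag_extend (\<lambda>(b, v). frag_of (a \<otimes>\<^bsub>HH\<^esub> b, v))"

lemma lmul_frag: "lmul a (frag_of (b, v)) = frag_of (a \<otimes>\<^bsub>HH\<^esub> b, v)"
  and lmul_add: "lmul a (z + z') = lmul a z + lmul a z'"
  and lmul_diff: "lmul a (z - z') = lmul a z - lmul a z'"
  and lmul_minus: "lmul a (- z) = - lmul a z"
  and lmul_0: "lmul a 0 = 0"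
  by (simp_all add: lmul_def frag_extend_add frag_extend_diff frag_extend_minus)

lemma lmul_closed: "a \<in> carrier HH \<Longrightarrow> z \<in> carrier FA \<Longrightarrow> lmul a z \<in> carrier FA"
  by (rotate_tac, induction rule: FA_induct)
    (auto simp: lmul_0 lmul_diff lmul_frag FA_0 intro: FA_diff FA_frag)

lemma lmul_TR:
  assumes a: "a \<in> carrier HH" and "z \<in> TR"
  shows "lmul a z \<in> TR"
  using assms(2)
proof (induction rule: TR_induct)
  case (gens g)
  then consider (1) b b' v where "g = frag_of (b \<oplus>\<^bsub>HH\<^esub> b', v) - frag_of (b, v) - frag_of (b', v)"
      "b \<in> carrier HH" "b' \<in> carrier HH"
    | (2) b v v' where "g = frag_of (b, v + v') - frag_of (b, v) - frag_of (b, v')" "b \<in> carrier HH"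
    | (3) b f v where "g = frag_of (b \<otimes>\<^bsub>HH\<^esub> cls f, v) - frag_of (b, const_act f v)"
      "b \<in> carrier HH" "f \<in> carrier (smash_h d)"
    unfolding tensor_gens_def by blast
  then show ?case
  proof cases
    case 1
    then show ?thesis using a eqv_frag_add_left[of "a \<otimes>\<^bsub>HH\<^esub> b" "a \<otimes>\<^bsub>HH\<^esub> b'" v]
      by (simp add: lmul_diff lmul_add lmul_frag H.r_distr eqv_def diff_diff_eq)
  next
    case 2
    then show ?thesis using a eqv_frag_add_right[of "a \<otimes>\<^bsub>HH\<^esub> b" v v']
      by (simp add: lmul_diff lmul_add lmul_frag eqv_def diff_diff_eq)
  next
    case 3
    then show ?thesis using a eqv_frag_act[of "a \<otimes>\<^bsub>HH\<^esub> b" f v]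
      by (simp add: lmul_diff lmul_frag eqv_def H.m_assoc carrier_smash_h)
  qed
qed (simp_all add: lmul_0 lmul_add lmul_minus TR_0 TR_add TR_minus)

lemma lmul_eqv: "a \<in> carrier HH \<Longrightarrow> z \<doteq> z' \<Longrightarrow> lmul a z \<doteq> lmul a z'"
  using lmul_TR[of a "z - z'"] by (simp add: eqv_def lmul_diff)

lemma lmul_mult:
  assumes "a \<in> carrier HH" "b \<in> carrier HH" "z \<in> carrier FA"
  shows "lmul (a \<otimes>\<^bsub>HH\<^esub> b) z = lmul a (lmul b z)"
  using assms(3) by (induction rule: FA_induct)
    (simp_all add: lmul_0 lmul_diff lmul_frag H.m_assoc assms)

lemma lmul_add_left:
  assumes "a \<in> carrier HH" "b \<in> carrier HH" "z \<in> carrier FA"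
  shows "lmul (a \<oplus>\<^bsub>HH\<^esub> b) z \<doteq> lmul a z + lmul b z"
  using assms(3)
proof (induction rule: FA_induct)
  case (diff x y)
  then show ?case using eqv_diff[OF diff(3,4)] by (simp add: lmul_diff algebra_simps)
next
  case (frag e v)
  then show ?case using assms by (simp add: lmul_frag H.l_distr eqv_frag_add_left)
qed (simp add: lmul_0 eqv_refl)

text \<open>The candidate isomorphism from a tensor v to a applied to v. Its coefficients are
  integers because the tensor product is built on a free abelian group; complex scalars act through
  the algebra.\<close>

definition ev :: "((real^2^2 \<Rightarrow> tens) set \<times> (complex^'n) \<Rightarrow>\<^sub>0 int) \<Rightarrow> 'n vpoly" where
  "ev z = linext (\<lambda>(a, v) n. scal (of_int n) (Hop a (lw v))) z"

lemma ev_add: "ev (z + z') = ev z + ev z'"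
  unfolding ev_def by (rule linext_add) (auto simp: V.scale_left_distrib)

lemma ev_frag: "ev (frag_of (a, v)) = Hop a (lw v)"
  unfolding ev_def by (subst linext_single) auto

lemma ev_0: "ev 0 = 0"
  by (simp add: ev_def)

lemma ev_minus: "ev (- z) = - ev z"
  using ev_add[of z "- z"] by (simp add: ev_0 add_eq_0_iff)

lemma ev_diff: "ev (z - z') = ev z - ev z'"
  using ev_add[of z "- z'"] by (simp add: ev_minus)

lemma cls_closed: "f \<in> carrier (smash d) \<Longrightarrow> cls f \<in> carrier HH"
  by simp

lemma ev_TR: "z \<in> TR \<Longrightarrow> ev z = 0"
proof (induction rule: TR_induct)
  case (gens g)
  then show ?case
    unfolding tensor_gens_def
    by (auto simp: ev_diff ev_frag Hop_add lw_add lin_simps[OF lin_Hop] Hop_mult Hop_cls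
        carrier_smash_h smash_op_lw)
qed (simp_all add: ev_0 ev_add ev_minus)

lemma ev_eqv: "z \<doteq> z' \<Longrightarrow> ev z = ev z'"
  using ev_TR[of "z - z'"] by (simp add: eqv_def ev_diff)

lemma ev_lmul:
  assumes "a \<in> carrier HH" "z \<in> carrier FA"
  shows "ev (lmul a z) = Hop a (ev z)"
  using assms(2) by (induction rule: FA_induct)
    (simp_all add: lmul_0 lmul_diff lmul_frag ev_0 ev_diff ev_frag lin_simps[OF lin_Hop] Hop_mult assms)

primrec zpow :: "nat \<Rightarrow> (real^2^2 \<Rightarrow> tens) set" where
  "zpow 0 = \<one>\<^bsub>HH\<^esub>" | "zpow (Suc j) = cls (of_X zbv) \<otimes>\<^bsub>HH\<^esub> zpow j"

primrec zmono :: "nat \<Rightarrow> nat \<Rightarrow> (real^2^2 \<Rightarrow> tens) set" where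
  "zmono 0 j = zpow j" | "zmono (Suc i) j = cls (of_X zv) \<otimes>\<^bsub>HH\<^esub> zmono i j"

lemma zpow_closed: "zpow j \<in> carrier HH"
  by (induction j) auto

lemma zmono_closed: "zmono i j \<in> carrier HH"
  by (induction i) (auto simp: zpow_closed)

lemma zmono_Suc_right: "zmono i (Suc j) = cls (of_X zbv) \<otimes>\<^bsub>HH\<^esub> zmono i j"
proof (induction i)
  case (Suc i)
  then show ?case
    using cls_commute_X[of zbv zv] zmono_closed[of i j] by (simp add: H.m_assoc[symmetric])
qed simp

lemma Hop_zmono: "Hop (zmono i j) (lw v) = single (i, j) v"
proof (induction i)
  case 0
  show ?case
    by (induction j) (auto simp: Hop_one lw_def Hop_mult zpow_closed Hop_cls smash_op_X mulx_zbv mulzb_single)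
qed (auto simp: Hop_mult zmono_closed Hop_cls smash_op_X mulx_zv mulz_single)

text \<open>The candidate inverse of \<open>ev\<close>, by ordered products of z and w. It is
  additive only modulo the relations, since the symbol \<open>frag_of (a, v)\<close> is not additive
  in \<open>v\<close>.\<close>

definition sect :: "'n vpoly \<Rightarrow> ((real^2^2 \<Rightarrow> tens) set \<times> (complex^'n) \<Rightarrow>\<^sub>0 int)" where
  "sect u = (\<Sum>m\<in>keys u. frag_of (zmono (fst m) (snd m), lookup u m))"

lemma sect_closed: "sect u \<in> carrier FA"
  unfolding sect_def by (intro FA_sum FA_frag zmono_closed)

lemma sect_superset:
  assumes "finite T" "keys u \<subseteq> T"
  shows "sect u \<doteq> (\<Sum>m\<in>T. frag_of (zmono (fst m) (snd m), lookup u m))"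
proof -
  have "(\<Sum>m\<in>T. frag_of (zmono (fst m) (snd m), lookup u m)) - sect u =
      (\<Sum>m\<in>T - keys u. frag_of (zmono (fst m) (snd m), lookup u m))"
    unfolding sect_def using assms by (simp add: sum_diff)
  also have "\<dots> \<in> TR"
  proof (rule TR_sum)
    fix m assume "m \<in> T - keys u"
    then have "lookup u m = 0" by (simp add: in_keys_iff)
    then show "frag_of (zmono (fst m) (snd m), lookup u m) \<in> TR"
      using eqv_frag_0[OF zmono_closed, of "fst m" "snd m"] by (simp add: eqv_def)
  qed
  finally show ?thesis unfolding eqv_def[symmetric] by (rule eqv_sym)
qed

lemma sect_add: "sect (u + v) \<doteq> sect u + sect v"
proof -
  let ?T = "keys u \<union> keys v"
  let ?f = "\<lambda>u m. frag_of (zmono (fst m) (snd m), lookup u m)"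
  have "sect (u + v) \<doteq> (\<Sum>m\<in>?T. ?f (u + v) m)"
    using Poly_Mapping.keys_add[of u v] by (intro sect_superset) auto
  also have "(\<Sum>m\<in>?T. ?f (u + v) m) \<doteq> (\<Sum>m\<in>?T. ?f u m) + (\<Sum>m\<in>?T. ?f v m)"
    unfolding eqv_def sum.distrib[symmetric] sum_subtractf[symmetric]
    using eqv_frag_add_right[OF zmono_closed, unfolded eqv_def] by (intro TR_sum) (simp add: lookup_add)
  also have "\<dots> \<doteq> sect u + sect v"
    by (intro eqv_add eqv_sym[OF sect_superset]) auto
  finally show ?thesis .
qed

lemma sect_single: "sect (single (i, j) v) \<doteq> frag_of (zmono i j, v)"
proof (cases "v = 0")
  case True
  then show ?thesis using eqv_sym[OF eqv_frag_0[OF zmono_closed]] by (simp add: sect_def)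
qed (simp add: sect_def eqv_refl)

lemma sect_diff: "sect (u - v) \<doteq> sect u - sect v"
  using eqv_diff[OF eqv_sym[OF sect_add[of "u - v" v]] eqv_refl[of "sect v"]]
  by (simp add: eqv_sym)

text \<open>The section intertwines left multiplication with the action by Dunkl operators up to the
  tensor relations; this is how every element of the standard module is brought to normal form.\<close>

definition good :: "(real^2^2 \<Rightarrow> tens) \<Rightarrow> bool" where
  "good f \<longleftrightarrow> f \<in> carrier (smash d) \<and> (\<forall>u. lmul (cls f) (sect u) \<doteq> sect (smash_op f u))"

lemma goodI_single:
  assumes f: "f \<in> carrier (smash d)"
    and "\<And>i j v. lmul (cls f) (frag_of (zmono i j, v)) \<doteq> sect (smash_op f (single (i, j) v))"
  shows "good f"
  unfolding good_def
proof (intro conjI allI f)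
  fix u
  show "lmul (cls f) (sect u) \<doteq> sect (smash_op f u)"
  proof (induction u rule: poly_mapping_add_induct)
    case (single m v)
    show ?case
      using eqv_trans[OF lmul_eqv[OF cls_closed[OF f] sect_single[of "fst m" "snd m" v]] assms(2)]
      by simp
  next
    case (add u v)
    have "lmul (cls f) (sect (u + v)) \<doteq> lmul (cls f) (sect u) + lmul (cls f) (sect v)"
      using lmul_eqv[OF cls_closed[OF f] sect_add] by (simp add: lmul_add)
    also have "\<dots> \<doteq> sect (smash_op f u) + sect (smash_op f v)" by (rule eqv_add[OF add])
    also have "\<dots> \<doteq> sect (smash_op f (u + v))"
      by (simp add: lin_add[OF lin_smash_op] eqv_sym[OF sect_add])
    finally show ?case .
  qed
qed

text \<open>Scalars are central, so \<open>k\<close> moves to the right of the monomial, where a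
  tensor relation absorbs it into the vector.\<close>

lemma good_const: "good (of_const k)"
proof (rule goodI_single)
  fix i j v
  have comm: "of_const k \<cdot> f = f \<cdot> of_const k" if "f \<in> carrier (smash d)" for f
  proof (rule HOL.ext)
    fix w
    have "(f \<cdot> of_const k) w = (\<Sum>u\<in>G. if u = w then f u * tens_const k else 0)"
      unfolding mult_smash of_const_def of_tens_def
      by (intro sum.cong refl) (auto simp: G_inv_mult_eq_iff)
    then show "(of_const k \<cdot> f) w = (f \<cdot> of_const k) w"
      using that by (auto simp: of_const_def of_tens_mult tens_const_commute carrier_smash)
  qed
  have "cls (of_const k) \<otimes>\<^bsub>HH\<^esub> a = a \<otimes>\<^bsub>HH\<^esub> cls (of_const k)" if "a \<in> carrier HH" for a
    using that comm by (auto simp: carrier_cherednik cl.hom_mult[symmetric] simp del: cl.hom_mult)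
  then have "lmul (cls (of_const k)) (frag_of (zmono i j, v)) = frag_of (zmono i j \<otimes>\<^bsub>HH\<^esub> cls (of_const k), v)"
    by (simp add: lmul_frag zmono_closed)
  also have "\<dots> \<doteq> frag_of (zmono i j, const_act (of_const k) v)"
    by (rule eqv_frag_act) (simp_all add: zmono_closed)
  also have "const_act (of_const k) v = k *s v"
    by (simp add: const_act_def of_const_def of_tens_def if_distrib[of "\<lambda>p. lookup p _"]
        if_distrib[of "\<lambda>k. k *s _"] sum.delta rep_1 cong: if_cong)
  also have "frag_of (zmono i j, k *s v) \<doteq> sect (single (i, j) (k *s v))"
    by (rule eqv_sym[OF sect_single])
  finally show "lmul (cls (of_const k)) (frag_of (zmono i j, v)) \<doteq>
      sect (smash_op (of_const k) (single (i, j) v))"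
    by (simp add: smash_op_const scal_single)
qed simp

lemma good_add:
  assumes "good f" "good g"
  shows "good (f \<boxplus> g)"
  unfolding good_def
proof (intro conjI allI)
  have fg: "f \<in> carrier (smash d)" "g \<in> carrier (smash d)" using assms by (auto simp: good_def)
  then show "f \<boxplus> g \<in> carrier (smash d)" by simp
  fix u
  have "lmul (cls (f \<boxplus> g)) (sect u) \<doteq> lmul (cls f) (sect u) + lmul (cls g) (sect u)"
    using fg by (simp add: lmul_add_left sect_closed)
  also have "\<dots> \<doteq> sect (smash_op f u) + sect (smash_op g u)"
    using assms by (intro eqv_add) (auto simp: good_def)
  also have "\<dots> \<doteq> sect (smash_op (f \<boxplus> g) u)"
    by (simp add: smash_op_add eqv_sym[OF sect_add])
  finally show "lmul (cls (f \<boxplus> g)) (sect u) \<doteq> sect (smash_op (f \<boxplus> g) u)" .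
qed

lemma good_mult:
  assumes "good f" "good g"
  shows "good (f \<cdot> g)"
  unfolding good_def
proof (intro conjI allI)
  have fg: "f \<in> carrier (smash d)" "g \<in> carrier (smash d)" using assms by (auto simp: good_def)
  then show "f \<cdot> g \<in> carrier (smash d)" by simp
  fix u
  have "lmul (cls (f \<cdot> g)) (sect u) = lmul (cls f) (lmul (cls g) (sect u))"
    using fg by (simp add: lmul_mult sect_closed)
  also have "\<dots> \<doteq> lmul (cls f) (sect (smash_op g u))"
    using assms fg by (intro lmul_eqv) (auto simp: good_def)
  also have "\<dots> \<doteq> sect (smash_op f (smash_op g u))" using assms by (auto simp: good_def)
  finally show "lmul (cls (f \<cdot> g)) (sect u) \<doteq> sect (smash_op (f \<cdot> g) u)"
    by (simp add: smash_op_mult)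
qed

lemma of_X_expansion: "of_X x = of_const ((x $ 1 - \<i> * x $ 2) / 2) \<cdot> of_X zv \<boxplus>
    of_const ((x $ 1 + \<i> * x $ 2) / 2) \<cdot> of_X zbv"
  unfolding of_X_def of_const_def of_tens_mult_of_tens of_tens_add tens_X_scale[symmetric] tens_X_add[symmetric]
  using zv_expansion[of x] by simp

lemma good_X: "good (of_X x)"
proof -
  have "good (of_X zv)"
  proof (rule goodI_single)
    fix i j v
    show "lmul (cls (of_X zv)) (frag_of (zmono i j, v)) \<doteq> sect (smash_op (of_X zv) (single (i, j) v))"
      using eqv_sym[OF sect_single[of "Suc i" j v]] by (simp add: lmul_frag smash_op_X mulx_zv mulz_single)
  qed simp
  moreover have "good (of_X zbv)"
  proof (rule goodI_single)
    fix i j v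
    show "lmul (cls (of_X zbv)) (frag_of (zmono i j, v)) \<doteq> sect (smash_op (of_X zbv) (single (i, j) v))"
      using eqv_sym[OF sect_single[of i "Suc j" v]]
      by (simp add: lmul_frag smash_op_X mulx_zbv mulzb_single zmono_Suc_right)
  qed simp
  ultimately show ?thesis
    by (subst of_X_expansion) (intro good_add good_mult good_const)
qed

lemma lmul_lw:
  assumes f: "f \<in> carrier (smash_h d)"
  shows "lmul (cls f) (sect (lw v)) \<doteq> sect (smash_op f (lw v))"
proof -
  have fc: "f \<in> carrier (smash d)" using f by (simp add: carrier_smash_h)
  have "lmul (cls f) (sect (lw v)) \<doteq> frag_of (cls f, v)"
    using lmul_eqv[OF cls_closed[OF fc] sect_single[of 0 0 v]] fc by (simp add: lw_def lmul_frag)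
  also have "frag_of (cls f, v) \<doteq> frag_of (\<one>\<^bsub>HH\<^esub>, const_act f v)"
    using eqv_frag_act[of "\<one>\<^bsub>HH\<^esub>" f v] f fc by simp
  also have "\<dots> \<doteq> sect (lw (const_act f v))"
    using eqv_sym[OF sect_single[of 0 0 "const_act f v"]] by (simp add: lw_def)
  finally show ?thesis by (simp add: smash_op_lw[OF f])
qed

text \<open>Induction on the polynomial: \<open>step\<close> pushes \<open>f\<close> past a linear
  form at the cost of good elements, and on constants \<open>f\<close> is absorbed into \<tau>. For
  a group element the extra term \<open>h\<close> is zero; for a vector of h it is
  \<open>rel_rhs\<close>, so group elements have to be good first.\<close>

lemma good_extend:
  assumes f: "f \<in> carrier (smash_h d)"
    and step: "\<And>x. \<exists>g h. good g \<and> good h \<and> cls f \<otimes>\<^bsub>HH\<^esub> cls (of_X x) = cls g \<otimes>\<^bsub>HH\<^esub> cls f \<oplus>\<^bsub>HH\<^esub> cls h"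
  shows "good f"
proof -
  have fc: "f \<in> carrier (smash d)" using f by (simp add: carrier_smash_h)
  have "lmul (cls f) (sect u) \<doteq> sect (smash_op f u)" for u
  proof (induction u rule: vpoly_induct_x)
    case (x x u)
    obtain g h where g: "good g" and h: "good h"
      and eq: "cls f \<otimes>\<^bsub>HH\<^esub> cls (of_X x) = cls g \<otimes>\<^bsub>HH\<^esub> cls f \<oplus>\<^bsub>HH\<^esub> cls h"
      using step by blast
    have gc: "g \<in> carrier (smash d)" "h \<in> carrier (smash d)" using g h by (auto simp: good_def)
    have "lmul (cls (of_X x)) (sect u) \<doteq> sect (mulx x u)"
      using good_X[of x] by (auto simp: good_def smash_op_X)
    then have "lmul (cls f) (sect (mulx x u)) \<doteq> lmul (cls f) (lmul (cls (of_X x)) (sect u))"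
      by (intro lmul_eqv[OF cls_closed[OF fc] eqv_sym])
    also have "\<dots> = lmul (cls g \<otimes>\<^bsub>HH\<^esub> cls f \<oplus>\<^bsub>HH\<^esub> cls h) (sect u)"
      using fc by (simp add: lmul_mult[symmetric] sect_closed eq)
    also have "\<dots> \<doteq> lmul (cls g \<otimes>\<^bsub>HH\<^esub> cls f) (sect u) + lmul (cls h) (sect u)"
      using fc gc by (intro lmul_add_left) (auto simp: sect_closed)
    also have "lmul (cls g \<otimes>\<^bsub>HH\<^esub> cls f) (sect u) + lmul (cls h) (sect u) \<doteq>
        lmul (cls g) (sect (smash_op f u)) + sect (smash_op h u)"
      using fc gc x h by (intro eqv_add) (auto simp: lmul_mult sect_closed good_def intro: lmul_eqv)
    also have "\<dots> \<doteq> sect (smash_op g (smash_op f u)) + sect (smash_op h u)"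
      using g by (intro eqv_add eqv_refl) (auto simp: good_def)
    also have "\<dots> \<doteq> sect (smash_op g (smash_op f u) + smash_op h u)" by (rule eqv_sym[OF sect_add])
    also have "smash_op g (smash_op f u) + smash_op h u = Hop (cls g \<otimes>\<^bsub>HH\<^esub> cls f \<oplus>\<^bsub>HH\<^esub> cls h) u"
      using fc gc by (simp add: Hop_add Hop_mult Hop_cls)
    also have "\<dots> = smash_op f (mulx x u)"
      using fc by (simp add: eq[symmetric] Hop_mult Hop_cls smash_op_X)
    finally show ?case .
  next
    case (add u v)
    have "lmul (cls f) (sect (u + v)) \<doteq> lmul (cls f) (sect u) + lmul (cls f) (sect v)"
      using lmul_eqv[OF cls_closed[OF fc] sect_add] by (simp add: lmul_add)
    also have "\<dots> \<doteq> sect (smash_op f u) + sect (smash_op f v)" by (rule eqv_add[OF add])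
    also have "\<dots> \<doteq> sect (smash_op f (u + v))"
      by (simp add: lin_add[OF lin_smash_op] eqv_sym[OF sect_add])
    finally show ?case .
  qed (rule lmul_lw[OF f])
  then show ?thesis using fc by (simp add: good_def)
qed

lemma good_grp:
  assumes w: "w \<in> G"
  shows "good (of_grp w)"
proof (rule good_extend)
  fix x
  have "cls (of_grp w) \<otimes>\<^bsub>HH\<^esub> cls (of_X x) = cls (of_grp w \<cdot> of_X x)"
    using w by simp
  also have "\<dots> = cls (of_X (act_dual w x) \<cdot> of_grp w)"
    using w by (simp only: of_X_def of_grp_mult_of_tens act_tens_X)
  finally have "cls (of_grp w) \<otimes>\<^bsub>HH\<^esub> cls (of_X x) =
      cls (of_X (act_dual w x)) \<otimes>\<^bsub>HH\<^esub> cls (of_grp w) \<oplus>\<^bsub>HH\<^esub> cls (of_const 0)"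
    using w cl.hom_zero by (simp add: of_const_def tens_const_0 of_tens_def zero_smash)
  then show "\<exists>g h. good g \<and> good h \<and>
      cls (of_grp w) \<otimes>\<^bsub>HH\<^esub> cls (of_X x) = cls g \<otimes>\<^bsub>HH\<^esub> cls (of_grp w) \<oplus>\<^bsub>HH\<^esub> cls h"
    using good_X good_const by blast
qed (use w in simp)

lemma good_rel_rhs: "good (rel_rhs y x)"
proof -
  have sum: "good (finsum (smash d) (\<lambda>s. of_const (rel_coeff y x s) \<cdot> of_grp s) T)" if "T \<subseteq> S" for T
    using finite_subset[OF that S_finite] that
  proof induction
    case empty
    have "\<zero>\<^bsub>smash d\<^esub> = of_const 0"
      by (simp add: of_const_def tens_const_0 of_tens_def zero_smash)
    then show ?case using good_const[of 0] by simp
  next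
    case (insert s T)
    then have "finsum (smash d) (\<lambda>s. of_const (rel_coeff y x s) \<cdot> of_grp s) (insert s T) =
      of_const (rel_coeff y x s) \<cdot> of_grp s \<boxplus>
      finsum (smash d) (\<lambda>s. of_const (rel_coeff y x s) \<cdot> of_grp s) T"
      by (intro A.finsum_insert) auto
    then show ?case using insert by (auto intro!: good_add good_mult good_const good_grp)
  qed
  have "\<ominus>\<^bsub>smash d\<^esub> f = of_const (- 1) \<cdot> f" if "f \<in> carrier (smash d)" for f
  proof -
    have "tens_const (- 1) = - 1"
      using tens_const_add[of "- 1" 1] by (simp add: tens_const_0 tens_const_1 eq_neg_iff_add_eq_0)
    then show ?thesis using that by (simp add: a_inv_smash of_const_def of_tens_mult)
  qed
  moreover have "finsum (smash d) (\<lambda>s. of_const (rel_coeff y x s) \<cdot> of_grp s) S \<in> carrier (smash d)"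
    using rel_rhs_fun by (rule A.finsum_closed)
  ultimately have "rel_rhs y x = of_const (pairing y x) \<boxplus> of_const (- 1) \<cdot>
     finsum (smash d) (\<lambda>s. of_const (rel_coeff y x s) \<cdot> of_grp s) S"
    unfolding rel_rhs_def a_minus_def by simp
  then show ?thesis using sum[OF order_refl] by (auto intro!: good_add good_mult good_const)
qed

lemma good_Y: "good (of_Y y)"
proof (rule good_extend)
  fix x
  show "\<exists>g h. good g \<and> good h \<and>
      cls (of_Y y) \<otimes>\<^bsub>HH\<^esub> cls (of_X x) = cls g \<otimes>\<^bsub>HH\<^esub> cls (of_Y y) \<oplus>\<^bsub>HH\<^esub> cls h"
    using cls_YX[of y x] good_X[of x] good_rel_rhs[of y x] by blast
qed simp

lemma good_all: "f \<in> carrier (smash d) \<Longrightarrow> good f"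
  by (induction rule: smash_induct) (auto intro: good_const good_X good_Y good_grp good_add good_mult)

text \<open>A symbol a tensor v is a left multiple of 1 tensor v, which is the normal form of a
  constant, and by \<open>good_all\<close> left multiplication preserves normal forms.\<close>

lemma sect_ev: "z \<in> carrier FA \<Longrightarrow> z \<doteq> sect (ev z)"
proof (induction rule: FA_induct)
  case zero
  show ?case by (simp add: ev_0 sect_def eqv_refl)
next
  case (diff x y)
  have "x - y \<doteq> sect (ev x) - sect (ev y)" by (rule eqv_diff[OF diff(3,4)])
  also have "\<dots> \<doteq> sect (ev (x - y))" unfolding ev_diff by (rule eqv_sym[OF sect_diff])
  finally show ?case .
next
  case (frag a v)
  then obtain f where f: "f \<in> carrier (smash d)" "a = cls f" by (auto simp: carrier_cherednik)
  have "frag_of (a, v) = lmul a (frag_of (\<one>\<^bsub>HH\<^esub>, v))"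
    using frag by (simp add: lmul_frag)
  also have "\<dots> \<doteq> lmul a (sect (lw v))"
    using eqv_sym[OF sect_single[of 0 0 v]] by (intro lmul_eqv[OF frag]) (simp add: lw_def)
  also have "\<dots> \<doteq> sect (smash_op f (lw v))"
    using good_all[OF f(1)] f(2) by (simp add: good_def)
  finally show ?case using f by (simp add: ev_frag Hop_cls)
qed

lemma ev_sect: "ev (sect u) = u"
proof (induction u rule: poly_mapping_add_induct)
  case (single m v)
  show ?case using ev_eqv[OF sect_single[of "fst m" "snd m" v]] by (simp add: ev_frag Hop_zmono)
next
  case (add u v)
  then show ?case using ev_eqv[OF sect_add[of u v]] by (simp add: ev_add)
qed

text \<open>Normal forms make evaluation faithful; with \<open>ev_sect\<close>, which gives
  surjectivity, it identifies the standard module with the polynomials.\<close>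

lemma eqv_iff_ev: "z \<in> carrier FA \<Longrightarrow> z' \<in> carrier FA \<Longrightarrow> z \<doteq> z' \<longleftrightarrow> ev z = ev z'"
  using sect_ev eqv_sym eqv_trans ev_eqv by metis

end

section \<open>Maximal submodules and contravariant forms\<close>

text \<open>The map \<open>T_map\<close> in coordinates; see \<open>T_map_vcnj\<close>.\<close>

definition vcnj :: "complex^2 \<Rightarrow> complex^2" where
  "vcnj y = (\<chi> i. cnj (y $ i))"

lemma vcnj_vcnj [simp]: "vcnj (vcnj y) = y"
  by (simp add: vcnj_def vec_eq_iff)

context dunkl_setup
begin

section \<open>The standard module identified with polynomials\<close>

abbreviation M where "M \<equiv> standard_module d c \<rho>"

definition co :: "((real^2^2 \<Rightarrow> tens) set \<times> (complex^'n) \<Rightarrow>\<^sub>0 int) \<Rightarrow> 'n std" where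
  "co z = TR #>\<^bsub>FA\<^esub> z"

lemma M_eq: "M = \<lparr>carrier = carrier (FA Mod TR), mult = undefined, one = undefined,
      ring.zero = \<one>\<^bsub>FA Mod TR\<^esub>, ring.add = mult (FA Mod TR),
      smult = (\<lambda>a t. \<Union>z\<in>t. co (lmul a z))\<rparr>"
  by (simp add: standard_module_def tensor_module_def Let_def TR_def[symmetric] FA_def[symmetric]
      rep_module_simps co_def lmul_def)

lemma carrier_M: "carrier M = co ` carrier FA"
  by (auto simp: M_eq FactGroup_def RCOSETS_def co_def)

lemma TR_normal: "TR \<lhd> FA"
  using TR_subgroup FAG.subgroup_imp_normal by blast

lemma co_add: "z \<in> carrier FA \<Longrightarrow> z' \<in> carrier FA \<Longrightarrow> co z \<oplus>\<^bsub>M\<^esub> co z' = co (z + z')"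
  using normal.rcos_sum[OF TR_normal] by (simp add: M_eq FactGroup_def co_def mult_FA)

lemma in_co: "z' \<in> co z \<longleftrightarrow> z' \<doteq> z"
proof -
  have "z' \<in> co z \<longleftrightarrow> (\<exists>r\<in>TR. z' = r + z)"
    by (auto simp: co_def r_coset_def mult_FA)
  also have "\<dots> \<longleftrightarrow> z' - z \<in> TR" by (metis add_diff_cancel diff_add_cancel)
  finally show ?thesis by (simp add: eqv_def)
qed

lemma co_eq_iff: "co z = co z' \<longleftrightarrow> z \<doteq> z'"
  using in_co eqv_refl eqv_sym eqv_trans by blast

lemma zero_M: "\<zero>\<^bsub>M\<^esub> = co 0"
  by (auto simp: M_eq FactGroup_def in_co eqv_def)

lemma co_smult:
  assumes "a \<in> carrier HH" "z \<in> carrier FA"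
  shows "a \<odot>\<^bsub>M\<^esub> co z = co (lmul a z)"
proof -
  have "co (lmul a z') = co (lmul a z)" if "z' \<in> co z" for z'
    using that assms by (auto simp: in_co co_eq_iff intro: lmul_eqv)
  moreover have "co z \<noteq> {}" using in_co[of z z] eqv_refl by blast
  ultimately have "(\<Union>z'\<in>co z. co (lmul a z')) = co (lmul a z)" by simp
  then show ?thesis by (simp add: M_eq)
qed

lemma lowest_weight_eq: "lowest_weight_vector d c \<rho> v = co (frag_of (\<one>\<^bsub>HH\<^esub>, v))"
  by (simp add: lowest_weight_vector_def pure_tensor_def co_def TR_def FA_def rep_module_simps)

definition mval :: "'n std \<Rightarrow> 'n vpoly" where
  "mval t = ev (SOME z. z \<in> t)"

lemma mval_co: "mval (co z) = ev z"
proof -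
  have "(SOME z'. z' \<in> co z) \<in> co z"
    by (rule someI[of "\<lambda>z'. z' \<in> co z" z]) (simp add: in_co eqv_refl)
  then show ?thesis unfolding mval_def using ev_eqv by (simp add: in_co)
qed

lemma mval_add: "m \<in> carrier M \<Longrightarrow> n \<in> carrier M \<Longrightarrow> mval (m \<oplus>\<^bsub>M\<^esub> n) = mval m + mval n"
  by (auto simp: carrier_M co_add mval_co ev_add)

lemma M_add_closed: "m \<in> carrier M \<Longrightarrow> n \<in> carrier M \<Longrightarrow> m \<oplus>\<^bsub>M\<^esub> n \<in> carrier M"
  by (auto simp: carrier_M co_add FA_add)

lemma mval_zero: "mval \<zero>\<^bsub>M\<^esub> = 0"
  by (simp add: zero_M mval_co ev_0)

lemma M_zero_closed: "\<zero>\<^bsub>M\<^esub> \<in> carrier M"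
  by (auto simp: carrier_M zero_M FA_0)

lemma mval_smult: "a \<in> carrier HH \<Longrightarrow> m \<in> carrier M \<Longrightarrow> mval (a \<odot>\<^bsub>M\<^esub> m) = Hop a (mval m)"
  by (auto simp: carrier_M co_smult mval_co ev_lmul)

lemma M_smult_closed: "a \<in> carrier HH \<Longrightarrow> m \<in> carrier M \<Longrightarrow> a \<odot>\<^bsub>M\<^esub> m \<in> carrier M"
  by (auto simp: carrier_M co_smult lmul_closed)

lemma mval_lowest_weight: "mval (lowest_weight_vector d c \<rho> v) = lw v"
  by (simp add: lowest_weight_eq mval_co ev_frag Hop_one)

lemma lowest_weight_closed: "lowest_weight_vector d c \<rho> v \<in> carrier M"
  by (auto simp: lowest_weight_eq carrier_M FA_frag)

lemma mval_inj: "m \<in> carrier M \<Longrightarrow> n \<in> carrier M \<Longrightarrow> mval m = mval n \<Longrightarrow> m = n"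
  unfolding carrier_M by (elim imageE) (simp add: mval_co co_eq_iff eqv_iff_ev)

definition mvec :: "'n vpoly \<Rightarrow> 'n std" where
  "mvec u = co (sect u)"

lemma mvec_closed [simp]: "mvec u \<in> carrier M"
  by (auto simp: mvec_def carrier_M sect_closed)

lemma mval_mvec [simp]: "mval (mvec u) = u"
  by (simp add: mvec_def mval_co ev_sect)

lemma mvec_mval [simp]: "m \<in> carrier M \<Longrightarrow> mvec (mval m) = m"
  by (rule mval_inj) simp_all

lemma mvec_eqI: "m \<in> carrier M \<Longrightarrow> mval m = u \<Longrightarrow> m = mvec u"
  by auto

lemma abelian_group_M: "abelian_group M"
proof (rule abelian_groupI)
  fix x assume x: "x \<in> carrier M"
  show "\<exists>y\<in>carrier M. y \<oplus>\<^bsub>M\<^esub> x = \<zero>\<^bsub>M\<^esub>"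
    using x by (intro bexI[of _ "mvec (- mval x)"] mval_inj)
      (simp_all add: mval_add M_add_closed mval_zero M_zero_closed)
qed (rule mval_inj M_add_closed M_zero_closed |
    simp add: mval_add M_add_closed mval_zero M_zero_closed add_ac)+

sublocale MG: abelian_group M by (rule abelian_group_M)

lemma mval_a_inv: "m \<in> carrier M \<Longrightarrow> mval (\<ominus>\<^bsub>M\<^esub> m) = - mval m"
  using mval_add[of m "\<ominus>\<^bsub>M\<^esub> m"] by (simp add: MG.r_neg mval_zero minus_unique)

section \<open>Submodules as invariant sets of polynomials\<close>

definition invariant :: "'n vpoly set \<Rightarrow> bool" where
  "invariant K \<longleftrightarrow> 0 \<in> K \<and> (\<forall>u\<in>K. \<forall>v\<in>K. u + v \<in> K) \<and> (\<forall>f\<in>carrier (smash d). \<forall>u\<in>K. smash_op f u \<in> K)"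

lemma invariantD:
  assumes "invariant K"
  shows "0 \<in> K" "u \<in> K \<Longrightarrow> v \<in> K \<Longrightarrow> u + v \<in> K" "u \<in> K \<Longrightarrow> scal k u \<in> K"
    "u \<in> K \<Longrightarrow> mulx x u \<in> K" "u \<in> K \<Longrightarrow> dunkl y u \<in> K" "w \<in> G \<Longrightarrow> u \<in> K \<Longrightarrow> grp w u \<in> K"
  using assms unfolding invariant_def
  by (auto simp flip: smash_op_const smash_op_X smash_op_Y smash_op_grp)

lemma invariant_minus: "invariant K \<Longrightarrow> u \<in> K \<Longrightarrow> - u \<in> K"
  using invariantD(3)[of K u "- 1"] by simp

lemma invariant_diff: "invariant K \<Longrightarrow> u \<in> K \<Longrightarrow> v \<in> K \<Longrightarrow> u - v \<in> K"
  using invariantD(2)[of K u "- v"] invariant_minus by simp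

lemma invariant_sum: "invariant K \<Longrightarrow> (\<And>a. a \<in> A \<Longrightarrow> f a \<in> K) \<Longrightarrow> sum f A \<in> K"
  by (induction A rule: infinite_finite_induct) (auto intro: invariantD)

lemma submodule_invariant:
  assumes "submodule N HH M"
  shows "N = {m \<in> carrier M. mval m \<in> mval ` N}" "invariant (mval ` N)"
proof -
  interpret N: subgroup N "add_monoid M" using assms by (rule submodule.axioms)
  have sub: "N \<subseteq> carrier M" using N.subset by simp
  then show "N = {m \<in> carrier M. mval m \<in> mval ` N}" using mval_inj by blast
  have 0: "\<zero>\<^bsub>M\<^esub> \<in> N" using N.one_closed by simp
  have add: "m \<oplus>\<^bsub>M\<^esub> n \<in> N" if "m \<in> N" "n \<in> N" for m n using N.m_closed[OF that] by simp
  have smult: "a \<odot>\<^bsub>M\<^esub> m \<in> N" if "a \<in> carrier HH" "m \<in> N" for a m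
    using submodule.smult_closed[OF assms that] .
  show "invariant (mval ` N)"
    unfolding invariant_def
  proof (intro conjI ballI)
    show "0 \<in> mval ` N" using 0 mval_zero by (metis imageI)
  next
    fix u v assume "u \<in> mval ` N" "v \<in> mval ` N"
    then show "u + v \<in> mval ` N" using add sub by (auto simp: subset_iff mval_add[symmetric])
  next
    fix f u assume f: "f \<in> carrier (smash d)" and "u \<in> mval ` N"
    then obtain m where m: "m \<in> N" "u = mval m" by blast
    then have "smash_op f u = mval (cls f \<odot>\<^bsub>M\<^esub> m)"
      using sub f by (auto simp: mval_smult Hop_cls)
    then show "smash_op f u \<in> mval ` N" using smult[of "cls f" m] m f by simp
  qed
qed

lemma invariant_submodule:
  assumes K: "invariant K"
  shows "submodule {m \<in> carrier M. mval m \<in> K} HH M"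
proof (intro submodule.intro submodule_axioms.intro)
  show "subgroup {m \<in> carrier M. mval m \<in> K} (add_monoid M)"
  proof (rule MG.add.subgroupI)
    show "{m \<in> carrier M. mval m \<in> K} \<noteq> {}"
      using invariantD(1)[OF K] mvec_closed mval_mvec by (metis (mono_tags, lifting) empty_iff mem_Collect_eq)
  qed (auto simp: mval_a_inv mval_add intro: invariant_minus[OF K] invariantD[OF K])
next
  fix a m assume "a \<in> carrier HH" "m \<in> {m \<in> carrier M. mval m \<in> K}"
  then show "a \<odot>\<^bsub>M\<^esub> m \<in> {m \<in> carrier M. mval m \<in> K}"
    using K by (auto simp: M_smult_closed mval_smult carrier_cherednik Hop_cls invariant_def)
qed

text \<open>A proper invariant set containing all others corresponds to a proper submodule
  containing all others, hence to the only maximal one; this evaluates the \<open>THE\<close> in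
  \<open>max_submodule\<close>.\<close>

lemma max_submodule_eq:
  assumes K: "invariant K" "K \<noteq> UNIV" and largest: "\<And>L. invariant L \<Longrightarrow> L \<noteq> UNIV \<Longrightarrow> L \<subseteq> K"
  shows "max_submodule d c \<rho> = {m \<in> carrier M. mval m \<in> K}" (is "_ = ?N")
proof -
  have sub: "L \<subseteq> ?N" if "submodule L HH M" "L \<noteq> carrier M" for L
  proof -
    have "mval ` L \<noteq> UNIV"
      using submodule_invariant(1)[OF that(1)] that(2) by auto
    then show ?thesis
      using largest[OF submodule_invariant(2)[OF that(1)]] submodule_invariant(1)[OF that(1)] by blast
  qed
  obtain u where u: "u \<notin> K" using K(2) by blast
  then have "mvec u \<in> carrier M" "mvec u \<notin> ?N" by simp_all
  then have "?N \<noteq> carrier M" by metis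
  then have "maximal_proper_submodule HH M ?N"
    unfolding maximal_proper_submodule_def using invariant_submodule[OF K(1)] sub by blast
  moreover have "L = ?N" if L: "maximal_proper_submodule HH M L" for L
  proof -
    have "L \<subseteq> ?N" using L sub unfolding maximal_proper_submodule_def by blast
    then show ?thesis
      using L invariant_submodule[OF K(1)] \<open>?N \<noteq> carrier M\<close> unfolding maximal_proper_submodule_def by blast
  qed
  ultimately show ?thesis unfolding max_submodule_def by (rule the_equality)
qed

section \<open>Contravariant forms and the Euler element on polynomials\<close>

definition contravariant :: "(complex^'n \<Rightarrow> complex^'n \<Rightarrow> complex) \<Rightarrow> ('n vpoly \<Rightarrow> 'n vpoly \<Rightarrow> complex) \<Rightarrow> bool" where
  "contravariant h b \<longleftrightarrow>
     (\<forall>u v w. b (u + v) w = b u w + b v w) \<and>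
     (\<forall>k u v. b (scal k u) v = k * b u v) \<and>
     (\<forall>u v. b v u = cnj (b u v)) \<and>
     (\<forall>w\<in>G. \<forall>u v. b (grp w u) (grp w v) = b u v) \<and>
     (\<forall>y u v. b (dunkl y u) v = b u (mulx (vcnj y) v)) \<and>
     (\<forall>u v. b (lw u) (lw v) = h u v)"

lemma T_map_vcnj: "T_map y = vcnj y"
  by (simp add: T_map_eq vcnj_def)

lemma mval_cls_smult: "f \<in> carrier (smash d) \<Longrightarrow> m \<in> carrier M \<Longrightarrow> mval (cls f \<odot>\<^bsub>M\<^esub> m) = smash_op f (mval m)"
  by (simp add: mval_smult Hop_cls)

lemma M_cls_smult_closed: "f \<in> carrier (smash d) \<Longrightarrow> m \<in> carrier M \<Longrightarrow> cls f \<odot>\<^bsub>M\<^esub> m \<in> carrier M"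
  by (simp add: M_smult_closed)

lemma contravariant_pullback:
  assumes "contravariant h b"
  shows "is_contravariant_form d c \<rho> h (\<lambda>m n. b (mval m) (mval n))"
proof -
  have b: "b (u + v) w = b u w + b v w" "b (scal k u) v = k * b u v"
    "g \<in> G \<Longrightarrow> b (grp g u) (grp g v) = b u v" "b (dunkl y u) v = b u (mulx (vcnj y) v)"
    "b (lw p) (lw q) = h p q" for u v w k g y p q
    using assms unfolding contravariant_def by blast+
  have sym: "b v u = cnj (b u v)" for u v
    using assms unfolding contravariant_def by blast
  show ?thesis
    unfolding is_contravariant_form_def Let_def
    by (intro conjI ballI allI)
      (simp_all add: mval_add mval_cls_smult smash_op_const smash_op_grp smash_op_X smash_op_Y
        mval_lowest_weight T_map_vcnj b, rule sym)
qed

lemma mvec_add: "mvec (u + v) = mvec u \<oplus>\<^bsub>M\<^esub> mvec v"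
  by (rule mvec_eqI[symmetric]) (simp_all add: mval_add M_add_closed)

lemma mvec_smash_op: "f \<in> carrier (smash d) \<Longrightarrow> mvec (smash_op f u) = cls f \<odot>\<^bsub>M\<^esub> mvec u"
  by (rule mvec_eqI[symmetric]) (simp_all add: mval_cls_smult M_cls_smult_closed)

lemma mvec_lw: "mvec (lw v) = lowest_weight_vector d c \<rho> v"
  by (rule mvec_eqI[symmetric]) (simp_all add: lowest_weight_closed mval_lowest_weight)

lemma contravariant_pushforward:
  assumes "is_contravariant_form d c \<rho> h \<beta>"
  shows "contravariant h (\<lambda>u v. \<beta> (mvec u) (mvec v))"
proof -
  have op: "mvec (scal k u) = cls (of_const k) \<odot>\<^bsub>M\<^esub> mvec u" "mvec (mulx x u) = cls (of_X x) \<odot>\<^bsub>M\<^esub> mvec u"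
    "mvec (dunkl x u) = cls (of_Y x) \<odot>\<^bsub>M\<^esub> mvec u" for k x u
    using mvec_smash_op[of "of_const k" u] mvec_smash_op[of "of_X x" u] mvec_smash_op[of "of_Y x" u]
    by (simp_all only: smash_op_const smash_op_X smash_op_Y of_const_closed of_X_closed of_Y_closed)
  have grp: "mvec (grp g u) = cls (of_grp g) \<odot>\<^bsub>M\<^esub> mvec u" if "g \<in> G" for g u
    using mvec_smash_op[OF of_grp_closed[OF that], of u] by (simp only: smash_op_grp[OF that])
  note \<beta> = assms[unfolded is_contravariant_form_def Let_def]
  show ?thesis
    unfolding contravariant_def op mvec_add mvec_lw T_map_vcnj[symmetric]
  proof (intro conjI allI ballI)
    fix g u v assume g: "g \<in> G"
    show "\<beta> (mvec (grp g u)) (mvec (grp g v)) = \<beta> (mvec u) (mvec v)"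
      unfolding grp[OF g] using \<beta> g mvec_closed by blast
  qed (use \<beta> mvec_closed in blast)+
qed

definition csum :: "'n vpoly \<Rightarrow> 'n vpoly" where
  "csum u = (\<Sum>s\<in>S. scal (of_real (c s)) (grp s u))"

text \<open>The sum of x_i y_i alone; the reflection terms that turn it into a degree operator are
  kept apart in \<open>csum\<close>.\<close>

definition euler :: "'n vpoly \<Rightarrow> 'n vpoly" where
  "euler u = mulx (axis 1 1) (dunkl (axis 1 1) u) + mulx (axis 2 1) (dunkl (axis 2 1) u)"

lemma lin_csum: "lin csum"
  unfolding csum_def[abs_def] by (intro lin_sum_fun lin_scale lin_grp)

lemma lin_euler: "lin euler"
  unfolding euler_def[abs_def] by (intro lin_plus lin_compose[OF lin_mulx lin_dunkl])

lemma csum_mulx: "csum (mulx x u) = mulx x (csum u) -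
    (\<Sum>s\<in>S. scal (of_real (c s) * pairing (coroot_of s) x) (mulx (root_of s) (grp s u)))"
  unfolding csum_def lin_simps[OF lin_mulx] sum_subtractf[symmetric]
  by (intro sum.cong refl)
    (simp add: grp_mulx act_S_dual mulx_diff mulx_scale V.scale_right_diff_distrib)

lemma mulx_axis_sum: "scal (x $ 1) (mulx (axis 1 1) u) + scal (x $ 2) (mulx (axis 2 1) u) = mulx x u"
  by (simp only: mulx_scale[symmetric] mulx_add[symmetric] vec2_expansion[symmetric])

text \<open>Summing x_i [y_i, x] over the basis gives x minus a sum over reflections, which by
  \<open>csum_mulx\<close> is x C - C x. Hence \<open>euler\<close> minus \<open>csum\<close> has
  commutator x with x and grows by one with each linear factor.\<close>

lemma euler_mulx: "euler (mulx x u) = mulx x (euler u) + mulx x u - mulx x (csum u) + csum (mulx x u)"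
proof -
  have p: "pairing (axis 1 1) x = x $ 1" "pairing (axis 2 1) x = x $ 2" for x
    by (simp_all add: pairing_eq axis_def)
  have "mulx (axis 1 1) (cm (axis 1 1) x u) + mulx (axis 2 1) (cm (axis 2 1) x u) = mulx x u -
    (\<Sum>s\<in>S. scal (of_real (c s) * pairing (coroot_of s) x) (mulx (root_of s) (grp s u)))"
  proof -
    have "(\<Sum>s\<in>S. scal (of_real (c s) * pairing (coroot_of s) x) (mulx (root_of s) (grp s u))) =
      (\<Sum>s\<in>S. scal (of_real (c s) * root_of s $ 1 * pairing (coroot_of s) x) (mulx (axis 1 1) (grp s u))) +
      (\<Sum>s\<in>S. scal (of_real (c s) * root_of s $ 2 * pairing (coroot_of s) x) (mulx (axis 2 1) (grp s u)))"
      unfolding sum.distrib[symmetric]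
      by (intro sum.cong refl, subst mulx_axis_sum[symmetric]) (simp add: V.scale_right_distrib mult_ac)
    then show ?thesis
      by (subst (3) mulx_axis_sum[symmetric])
        (simp add: cm_def p lin_simps[OF lin_mulx])
  qed
  then show ?thesis
    unfolding euler_def csum_mulx
    by (simp add: dunkl_mulx lin_simps[OF lin_mulx] mulx_commute[of x] algebra_simps)
qed

end

section \<open>Grading by the Euler element and constant terms of invariant sets\<close>

lemma lookup_mulz_0: "lookup (mulz u) (0, 0) = 0"
  and lookup_mulzb_0: "lookup (mulzb u) (0, 0) = 0"
proof -
  show "lookup (mulz u) (0, 0) = 0"
  proof (induction u rule: poly_mapping_add_induct)
    case (single m v)
    show ?case by (cases m) (simp add: mulz_single lookup_single)
  qed (simp add: lin_simps[OF lin_mulz] lookup_add)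
  show "lookup (mulzb u) (0, 0) = 0"
  proof (induction u rule: poly_mapping_add_induct)
    case (single m v)
    show ?case by (cases m) (simp add: mulzb_single lookup_single)
  qed (simp add: lin_simps[OF lin_mulzb] lookup_add)
qed

lemma lookup_mulx_0: "lookup (mulx x u) (0, 0) = 0"
  by (simp add: mulx_def lookup_add lookup_scal lookup_mulz_0 lookup_mulzb_0)

locale irreducible_setup = dunkl_setup d c \<rho>
  for d :: nat and c and \<rho> :: "real^2^2 \<Rightarrow> complex^'n^'n::finite" +
  fixes \<kappa> :: real
  assumes irred: "is_irreducible d \<rho>"
    and kappa: "csum (lw v) = scal (of_real \<kappa>) (lw v)"
begin

lemma euler_degree:
  "euler (single (i, j) v) - csum (single (i, j) v) + scal (of_real \<kappa>) (single (i, j) v)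
   = scal (of_nat (i + j)) (single (i, j) v)"
proof -
  let ?E = "\<lambda>u. euler u - csum u + scal (of_real \<kappa>) u"
  have step: "?E (mulx x u) = scal (of_nat (Suc n)) (mulx x u)" if "?E u = scal (of_nat n) u" for x u n
  proof -
    have "?E (mulx x u) = mulx x (?E u) + mulx x u"
      by (simp add: euler_mulx lin_simps[OF lin_mulx])
    then show ?thesis
      unfolding that by (simp add: lin_simps[OF lin_mulx] V.scale_left_distrib add.commute)
  qed
  have 0: "?E (lw v) = scal (of_nat 0) (lw v)"
    by (simp add: euler_def dunkl_lw lin_simps[OF lin_mulx] kappa)
  have 1: "?E ((mulzb ^^ j) (lw v)) = scal (of_nat j) ((mulzb ^^ j) (lw v))" for j
    by (induction j) (simp_all only: funpow.simps comp_def id_apply 0 mulx_zbv[symmetric] step)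
  have "?E ((mulz ^^ i) ((mulzb ^^ j) (lw v))) = scal (of_nat (i + j)) ((mulz ^^ i) ((mulzb ^^ j) (lw v)))"
    by (induction i) (simp_all only: funpow.simps comp_def id_apply 1 mulx_zv[symmetric] step add_0 add_Suc)
  then show ?thesis by (simp only: single_eq_funpow)
qed

lemma lookup_euler:
  "lookup (euler u - csum u + scal (of_real \<kappa>) u) m =
    of_nat (fst m + snd m) *s lookup u m"
proof (induction u rule: poly_mapping_add_induct)
  case (single k v)
  have "euler (single k v) - csum (single k v) + scal (of_real \<kappa>) (single k v)
    = scal (of_nat (fst k + snd k)) (single k v)"
    using euler_degree[of "fst k" "snd k" v] by simp
  then show ?case by (auto simp: lookup_scal lookup_single when_def simp del: of_nat_add)
next
  case (add u v)
  have "euler (u + v) - csum (u + v) + scal (of_real \<kappa>) (u + v) =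
    (euler u - csum u + scal (of_real \<kappa>) u) + (euler v - csum v + scal (of_real \<kappa>) v)"
    by (simp add: lin_add[OF lin_euler] lin_add[OF lin_csum] V.scale_right_distrib)
  then have "lookup (euler (u + v) - csum (u + v) + scal (of_real \<kappa>) (u + v)) m =
    lookup (euler u - csum u + scal (of_real \<kappa>) u) m +
    lookup (euler v - csum v + scal (of_real \<kappa>) v) m"
    by (metis lookup_add)
  then show ?case unfolding add by (simp only: lookup_add vec.scale_right_distrib)
qed

text \<open>The degree operator preserves \<open>K\<close>, so it can remove one degree after
  another from \<open>u\<close> while keeping the constant term; the induction runs on the number of
  monomials.\<close>

lemma invariant_lowest_component:
  assumes K: "invariant K" and "u \<in> K"
  shows "lw (lookup u (0, 0)) \<in> K"
  using assms(2)
proof (induction "card (keys u)" arbitrary: u rule: less_induct)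
  case less
  show ?case
  proof (cases "\<exists>m\<in>keys u. m \<noteq> (0, 0)")
    case False
    then have "lookup u k = 0" if "k \<noteq> (0, 0)" for k
      using that by (meson in_keys_iff)
    then have "lw (lookup u (0, 0)) = u"
      by (intro poly_mapping_eqI) (simp add: lw_def lookup_single when_def)
    then show ?thesis using less by simp
  next
    case True
    then obtain m where m: "m \<in> keys u" "m \<noteq> (0, 0)" by blast
    define n where "n = fst m + snd m"
    have n: "n \<noteq> 0" using m(2) by (cases m) (auto simp: n_def)
    \<comment> \<open>The coefficient in degree k gets the factor 1 - k/n: 0 in the degree n of
      \<open>m\<close>, and 1 in degree 0.\<close>
    define u' where "u' = u - scal (1 / of_nat n) (euler u - csum u + scal (of_real \<kappa>) u)"
    have "u' \<in> K" unfolding u'_def euler_def csum_def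
      using less.prems by (intro invariant_diff[OF K] invariantD[OF K] invariant_sum[OF K] S_in_G) auto
    have l: "lookup u' k = (1 - of_nat (fst k + snd k) / of_nat n) *s lookup u k" for k
      unfolding u'_def lookup_minus lookup_scal lookup_euler
      by (simp add: vec_eq_iff algebra_simps add_divide_distrib)
    have "keys u' \<subseteq> keys u" by (auto simp: in_keys_iff l)
    moreover have "m \<notin> keys u'" using n by (simp add: in_keys_iff l n_def[symmetric])
    ultimately have "keys u' \<subset> keys u" using m(1) by blast
    then have "card (keys u') < card (keys u)" by (intro psubset_card_mono) simp_all
    from less.hyps[OF this \<open>u' \<in> K\<close>] show ?thesis by (simp add: l)
  qed
qed

text \<open>The constants in \<open>K\<close> form a subrepresentation \<open>T\<close> of \<tau>.
  If some element has a nonzero constant term, irreducibility puts all constants into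
  \<open>K\<close>, and multiplication by linear forms then gives all polynomials.\<close>

lemma invariant_proper:
  assumes K: "invariant K" "K \<noteq> UNIV" and u: "u \<in> K"
  shows "lookup u (0, 0) = 0"
proof (rule ccontr)
  assume ne: "lookup u (0, 0) \<noteq> 0"
  define T where "T = {v. lw v \<in> K}"
  have "lw 0 = (0 :: 'n vpoly)" by (simp add: lw_def)
  then have "vec.subspace T"
    using invariantD[OF K(1)] by (auto simp: T_def vec.subspace_def lw_add lw_scale)
  moreover have "\<forall>w\<in>dihedral d. (*v) (\<rho> w) ` T \<subseteq> T"
    using invariantD(6)[OF K(1)] by (auto simp: T_def grp_lw[symmetric])
  moreover have "lookup u (0, 0) \<in> T"
    using invariant_lowest_component[OF K(1) u] by (simp add: T_def)
  ultimately have T: "T = UNIV" using irred ne unfolding is_irreducible_def by blast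
  have "v \<in> K" for v
    by (induction v rule: vpoly_induct_x) (use T invariantD[OF K(1)] in \<open>auto simp: T_def\<close>)
  then show False using K(2) by blast
qed

end

section \<open>The radical of a contravariant form and unitarity of the quotient\<close>

locale form_setup = irreducible_setup d c \<rho> \<kappa>
  for d :: nat and c and \<rho> :: "real^2^2 \<Rightarrow> complex^'n^'n::finite" and \<kappa> +
  fixes h :: "complex^'n \<Rightarrow> complex^'n \<Rightarrow> complex" and b :: "'n vpoly \<Rightarrow> 'n vpoly \<Rightarrow> complex"
  assumes ip: "is_invariant_inner_product d \<rho> h" and contra: "contravariant h b"
begin

lemma b_add_left: "b (u + v) w = b u w + b v w"
  and b_scal_left: "b (scal k u) v = k * b u v"
  and b_sym: "b v u = cnj (b u v)"
  and b_grp: "g \<in> G \<Longrightarrow> b (grp g u) (grp g v) = b u v"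
  and b_dunkl: "b (dunkl y u) v = b u (mulx (vcnj y) v)"
  and b_lw: "b (lw u0) (lw v0) = h u0 v0"
  using contra unfolding contravariant_def by blast+

lemma b_add_right: "b w (u + v) = b w u + b w v"
  by (metis b_add_left b_sym complex_cnj_add complex_cnj_cnj)

lemma b_scal_right: "b v (scal k u) = cnj k * b v u"
  by (metis b_scal_left b_sym complex_cnj_mult complex_cnj_cnj)

lemma b_0_left [simp]: "b 0 u = 0" and b_0_right [simp]: "b u 0 = 0"
  using b_add_left[of 0 0 u] b_add_right[of u 0 0] by simp_all

lemma b_minus_left: "b (- u) v = - b u v" and b_minus_right: "b u (- v) = - b u v"
  using b_scal_left[of "- 1" u v] b_scal_right[of u "- 1" v] by simp_all

lemma b_diff_left: "b (u - v) w = b u w - b v w" and b_diff_right: "b w (u - v) = b w u - b w v"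
  using b_add_left[of u "- v" w] b_add_right[of w u "- v"] by (simp_all add: b_minus_left b_minus_right)

lemma b_sum_left: "b (sum f A) w = (\<Sum>a\<in>A. b (f a) w)"
  by (induction A rule: infinite_finite_induct) (simp_all add: b_add_left)

lemma b_sum_right: "b w (sum f A) = (\<Sum>a\<in>A. b w (f a))"
  by (induction A rule: infinite_finite_induct) (simp_all add: b_add_right)

lemma b_mulx_left: "b (mulx x u) v = b u (dunkl (vcnj x) v)"
  using b_dunkl[of "vcnj x" v u] by (metis b_sym vcnj_vcnj)

lemma b_mulx_right: "b u (mulx x v) = b (dunkl (vcnj x) u) v"
  by (simp add: b_dunkl)

text \<open>Linear factors on the left become Dunkl operators on the right, where they kill the
  constant.\<close>

lemma b_lw_right: "b u (lw v) = h (lookup u (0, 0)) v"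
proof (induction u rule: vpoly_induct_x)
  case (x x u)
  have "h 0 v = 0" using ip unfolding is_invariant_inner_product_def by (metis add_cancel_right_right)
  then show ?case by (simp add: b_mulx_left dunkl_lw lookup_mulx_0)
next
  case (add u v')
  moreover have "h (p + q) v = h p v + h q v" for p q
    using ip unfolding is_invariant_inner_product_def by blast
  ultimately show ?case by (simp add: b_add_left lookup_add)
qed (simp add: b_lw, simp add: lw_def)

definition rad :: "'n vpoly set" where
  "rad = {u. \<forall>v. b u v = 0}"

lemma b_grp_left: "w \<in> G \<Longrightarrow> b (grp w u) v = b u (grp (matrix_inv w) v)"
  using b_grp[of w u "grp (matrix_inv w) v"] by (simp add: grp_mult grp_1)

lemma invariant_rad: "invariant rad"
proof -
  have "smash_op f u \<in> rad" if "f \<in> carrier (smash d)" "u \<in> rad" for f u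
    using that
  proof (induction f arbitrary: u rule: smash_induct)
    case (add f g)
    then show ?case by (simp add: rad_def smash_op_add b_add_left)
  next
    case (mult f g)
    then show ?case by (simp add: smash_op_mult)
  qed (auto simp: rad_def smash_op_const b_scal_left smash_op_X b_mulx_left smash_op_Y b_dunkl
      smash_op_grp b_grp_left)
  then show ?thesis unfolding invariant_def by (auto simp: rad_def b_add_left)
qed

lemma rad_proper: "rad \<noteq> UNIV"
proof -
  have "axis undefined 1 \<noteq> (0 :: complex^'n)" by (simp add: axis_eq_0_iff)
  then have "0 < Re (h (axis undefined 1) (axis undefined 1))"
    using ip unfolding is_invariant_inner_product_def by blast
  then have "b (lw (axis undefined 1)) (lw (axis undefined 1)) \<noteq> 0" unfolding b_lw by auto
  then have "lw (axis undefined 1) \<notin> rad" unfolding rad_def by blast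
  then show ?thesis by blast
qed

text \<open>A proper \<open>K\<close> has no constant terms, so it is orthogonal to constants; a
  linear factor on the other side becomes a Dunkl operator, under which \<open>K\<close> is
  stable.\<close>

lemma rad_largest:
  assumes K: "invariant K" "K \<noteq> UNIV"
  shows "K \<subseteq> rad"
proof -
  have h0: "h 0 v = 0" for v
    using ip unfolding is_invariant_inner_product_def by (metis add_cancel_right_right)
  have "\<forall>u\<in>K. b u v = 0" for v
  proof (induction v rule: vpoly_induct_x)
    case (lw v)
    then show ?case using invariant_proper[OF K] h0 by (simp add: b_lw_right)
  next
    case (x x u)
    then show ?case using invariantD(5)[OF K(1)] by (simp add: b_mulx_right)
  qed (simp add: b_add_right)
  then show ?thesis by (auto simp: rad_def)
qed

lemma max_submodule_rad: "max_submodule d c \<rho> = {m \<in> carrier M. mval m \<in> rad}"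
  by (rule max_submodule_eq[OF invariant_rad rad_proper rad_largest])

text \<open>The Cauchy-Schwarz argument for null vectors. Nonnegativity is asked only on the line
  through \<open>w\<close> in direction \<open>u\<close>, so that it can be applied inside one
  degree before the whole form is known to be semidefinite.\<close>

lemma b_null:
  assumes psd: "\<And>k. 0 \<le> Re (b (scal k u + w) (scal k u + w))" and null: "Re (b u u) = 0"
  shows "b u w = 0"
proof (rule ccontr)
  assume ne: "b u w \<noteq> 0"
  have buu: "b u u = 0" using null b_sym[of u u] by (simp add: complex_eq_iff)
  \<comment> \<open>This size makes the value of the form at \<open>scal k u + w\<close> equal to
    -1.\<close>
  define K where "K = (Re (b w w) + 1) / (2 * (cmod (b u w))\<^sup>2)"
  define k where "k = - of_real K * cnj (b u w)"
  have "b (scal k u + w) (scal k u + w) = k * b u w + cnj (k * b u w) + b w w"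
    using b_sym[of w u] by (simp add: b_add_left b_add_right b_scal_left b_scal_right buu)
  then have "Re (b (scal k u + w) (scal k u + w)) = 2 * Re (k * b u w) + Re (b w w)"
    by (simp only: plus_complex.sel cnj.sel)
  moreover have "k * b u w = - of_real (K * (cmod (b u w))\<^sup>2)"
    unfolding k_def of_real_mult complex_norm_square by (simp add: mult_ac)
  moreover have "K * (cmod (b u w))\<^sup>2 = (Re (b w w) + 1) / 2"
    using ne by (simp add: K_def)
  ultimately have "Re (b (scal k u + w) (scal k u + w)) = 2 * - ((Re (b w w) + 1) / 2) + Re (b w w)"
    by (simp only: uminus_complex.sel Re_complex_of_real)
  then have "Re (b (scal k u + w) (scal k u + w)) = -1" by (simp add: field_simps)
  then show False using psd[of k] by simp
qed

lemma b_null_rad: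
  assumes "\<And>u. 0 \<le> Re (b u u)" and "Re (b u u) = 0"
  shows "u \<in> rad"
  unfolding rad_def using b_null[OF assms] by blast

lemma simple_module_simps:
  defines "Jm \<equiv> max_submodule d c \<rho>"
  shows "carrier (simple_module d c \<rho>) = {Jm +>\<^bsub>M\<^esub> m | m. m \<in> carrier M}"
    "\<zero>\<^bsub>simple_module d c \<rho>\<^esub> = Jm"
  by (auto simp: simple_module_def quotient_module_def A_RCOSETS_def' Jm_def)

lemma max_submodule_coset:
  assumes "m \<in> carrier M" "m' \<in> max_submodule d c \<rho> +>\<^bsub>M\<^esub> m"
  shows "m' \<in> carrier M" "\<exists>j\<in>rad. mval m' = j + mval m"
  using assms unfolding a_r_coset_def' max_submodule_rad by (auto simp: mval_add)

lemma coset_self: "m \<in> carrier M \<Longrightarrow> m \<in> max_submodule d c \<rho> +>\<^bsub>M\<^esub> m"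
  unfolding a_r_coset_def' max_submodule_rad
  using invariantD(1)[OF invariant_rad] by (auto intro!: bexI[of _ "\<zero>\<^bsub>M\<^esub>"] simp: mval_zero)

text \<open>The maximal submodule is the radical, so the form descends to cosets through any
  representatives. A nonzero coset is represented outside the radical, and by
  \<open>b_null_rad\<close> its norm cannot vanish.\<close>

lemma is_unitaryI:
  assumes psd: "\<And>u. 0 \<le> Re (b u u)"
  shows "is_unitary d c \<rho> h"
proof -
  define \<beta> where "\<beta> = (\<lambda>m n. b (mval m) (mval n))"
  define \<gamma> where "\<gamma> = (\<lambda>U W. \<beta> (SOME m. m \<in> U) (SOME n. n \<in> W))"
  let ?J = "max_submodule d c \<rho>"
  have \<gamma>: "\<gamma> (?J +>\<^bsub>M\<^esub> m) (?J +>\<^bsub>M\<^esub> n) = \<beta> m n" if mn: "m \<in> carrier M" "n \<in> carrier M" for m n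
  proof -
    have *: "\<exists>j\<in>rad. mval (SOME m'. m' \<in> ?J +>\<^bsub>M\<^esub> m) = j + mval m" if "m \<in> carrier M" for m
      by (rule max_submodule_coset(2)[OF that someI[of "\<lambda>m'. m' \<in> ?J +>\<^bsub>M\<^esub> m", OF coset_self[OF that]]])
    obtain j where j: "j \<in> rad" "mval (SOME m'. m' \<in> ?J +>\<^bsub>M\<^esub> m) = j + mval m" using *[OF mn(1)] by blast
    obtain i where i: "i \<in> rad" "mval (SOME m'. m' \<in> ?J +>\<^bsub>M\<^esub> n) = i + mval n" using *[OF mn(2)] by blast
    have r: "b v i = 0" for v using i(1) b_sym[of v i] by (simp add: rad_def)
    show ?thesis using j(1) r by (simp add: \<gamma>_def \<beta>_def j(2) i(2) b_add_left b_add_right) (simp add: rad_def)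
  qed
  have "is_contravariant_form d c \<rho> h \<beta>"
    unfolding \<beta>_def by (rule contravariant_pullback[OF contra])
  moreover have "is_induced_form d c \<rho> \<beta> \<gamma>" unfolding is_induced_form_def Let_def using \<gamma> by blast
  moreover have "0 < Re (\<gamma> v v)"
    if "v \<in> carrier (simple_module d c \<rho>)" "v \<noteq> \<zero>\<^bsub>simple_module d c \<rho>\<^esub>" for v
  proof -
    from that(1) have "\<exists>m. v = ?J +>\<^bsub>M\<^esub> m \<and> m \<in> carrier M"
      unfolding simple_module_simps(1) mem_Collect_eq .
    then obtain m where m: "m \<in> carrier M" "v = ?J +>\<^bsub>M\<^esub> m" by (elim exE conjE)
    have "m \<notin> ?J"
    proof
      assume "m \<in> ?J"
      have sub: "submodule ?J HH M" unfolding max_submodule_rad by (rule invariant_submodule[OF invariant_rad])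
      have "?J +>\<^bsub>M\<^esub> m = ?J"
        by (rule MG.a_coset_join2[OF m(1) submodule.axioms(1)[OF sub] \<open>m \<in> ?J\<close>])
      then show False using that(2) unfolding m(2) simple_module_simps(2) by contradiction
    qed
    then have "mval m \<notin> rad" using m(1) by (simp add: max_submodule_rad)
    then have "Re (b (mval m) (mval m)) \<noteq> 0" using b_null_rad[OF psd] by blast
    then show ?thesis using psd[of "mval m"] \<gamma>[OF m(1) m(1)] by (simp add: m(2) \<beta>_def)
  qed
  ultimately show ?thesis unfolding is_unitary_def by blast
qed

end

context irreducible_setup
begin

text \<open>The form is zero on the radical, and elsewhere its value is that of the induced form on
  a nonzero coset, so positivity on the quotient becomes semidefiniteness on polynomials. The form
  stays quantified: necessary conditions are drawn from the given one, and sufficiency supplies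
  \<open>form\<close>.\<close>

lemma is_unitary_iff:
  assumes ip: "is_invariant_inner_product d \<rho> h"
  shows "is_unitary d c \<rho> h \<longleftrightarrow> (\<exists>b. contravariant h b \<and> (\<forall>u. 0 \<le> Re (b u u)))"
proof
  assume "\<exists>b. contravariant h b \<and> (\<forall>u. 0 \<le> Re (b u u))"
  then obtain b where b: "contravariant h b" "\<And>u. 0 \<le> Re (b u u)" by blast
  interpret form_setup d c \<rho> \<kappa> h b by unfold_locales (rule ip, rule b(1))
  show "is_unitary d c \<rho> h" by (rule is_unitaryI[OF b(2)])
next
  assume "is_unitary d c \<rho> h"
  then obtain \<beta> \<gamma> where \<beta>: "is_contravariant_form d c \<rho> h \<beta>" and \<gamma>: "is_induced_form d c \<rho> \<beta> \<gamma>"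
    and pos: "\<And>v. v \<in> carrier (simple_module d c \<rho>) \<Longrightarrow> v \<noteq> \<zero>\<^bsub>simple_module d c \<rho>\<^esub> \<Longrightarrow> 0 < Re (\<gamma> v v)"
    unfolding is_unitary_def by blast
  define b where "b = (\<lambda>u v. \<beta> (mvec u) (mvec v))"
  have b: "contravariant h b" unfolding b_def by (rule contravariant_pushforward[OF \<beta>])
  interpret form_setup d c \<rho> \<kappa> h b by unfold_locales (rule ip, rule b)
  have "0 \<le> Re (b u u)" for u
  proof (cases "u \<in> rad")
    case False
    let ?J = "max_submodule d c \<rho>"
    have "mvec u \<notin> ?J" using False by (simp add: max_submodule_rad)
    then have "?J +>\<^bsub>M\<^esub> mvec u \<noteq> ?J" using coset_self[OF mvec_closed] by blast
    then have "0 < Re (\<gamma> (?J +>\<^bsub>M\<^esub> mvec u) (?J +>\<^bsub>M\<^esub> mvec u))"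
      by (intro pos) (unfold simple_module_simps, use mvec_closed in blast, assumption)
    moreover have "\<gamma> (?J +>\<^bsub>M\<^esub> mvec u) (?J +>\<^bsub>M\<^esub> mvec u) = b u u"
      using \<gamma> mvec_closed[of u] unfolding is_induced_form_def Let_def b_def by blast
    ultimately show ?thesis by simp
  qed (simp add: rad_def)
  then show "\<exists>b. contravariant h b \<and> (\<forall>u. 0 \<le> Re (b u u))" using b by blast
qed

end

section \<open>Existence of the contravariant form and the Euler identity\<close>

locale inner_setup = dunkl_setup d c \<rho>
  for d :: nat and c and \<rho> :: "real^2^2 \<Rightarrow> complex^'n^'n::finite" +
  fixes h :: "complex^'n \<Rightarrow> complex^'n \<Rightarrow> complex"
  assumes ip: "is_invariant_inner_product d \<rho> h"
begin

lemma h_add_left: "h (u + u') v = h u v + h u' v"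
  and h_scale_left: "h (k *s u) v = k * h u v"
  and h_sym: "h v u = cnj (h u v)"
  and h_pos: "v \<noteq> 0 \<Longrightarrow> 0 < Re (h v v)"
  and h_rho: "g \<in> G \<Longrightarrow> h (\<rho> g *v u) (\<rho> g *v v) = h u v"
  using ip unfolding is_invariant_inner_product_def by blast+

lemma h_add_right: "h w (u + v) = h w u + h w v"
  by (metis h_add_left h_sym complex_cnj_add)

lemma h_scale_right: "h v (k *s u) = cnj k * h v u"
  by (metis h_scale_left h_sym complex_cnj_mult)

lemma h_0_left [simp]: "h 0 v = 0" and h_0_right [simp]: "h v 0 = 0"
  using h_add_left[of 0 0 v] h_add_right[of v 0 0] by simp_all

text \<open>The value is forced: each linear factor moves across as the Dunkl operator of its
  conjugate, and against the remaining constant only a constant term counts. The adjoint rule for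
  multiplication is thus built in, while the rule for Dunkl operators and the symmetry have to be
  proved.\<close>

definition form :: "'n vpoly \<Rightarrow> 'n vpoly \<Rightarrow> complex" where
  "form u y = linext (\<lambda>(i, j) v. h v (lookup
     ((dunkl (vcnj zbv) ^^ j) ((dunkl (vcnj zv) ^^ i) y)) (0, 0))) u"

lemma form_single: "form (single (i, j) v) y = h v (lookup
     ((dunkl (vcnj zbv) ^^ j) ((dunkl (vcnj zv) ^^ i) y)) (0, 0))"
  unfolding form_def by (subst linext_single) auto

lemma form_add_left: "form (u + v) y = form u y + form v y"
  unfolding form_def by (rule linext_add) (auto simp: h_add_left)

lemma form_0_left [simp]: "form 0 y = 0"
  by (simp add: form_def)

lemma form_scal_left: "form (scal k u) y = k * form u y"
proof (induction u rule: poly_mapping_add_induct)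
  case (single m v)
  show ?case by (cases m) (simp add: scal_single form_single h_scale_left)
qed (simp add: V.scale_right_distrib form_add_left distrib_left)

lemma form_minus_left: "form (- u) y = - form u y"
  using form_scal_left[of "- 1" u y] by simp

lemma form_diff_left: "form (u - v) y = form u y - form v y"
  using form_add_left[of u "- v" y] by (simp add: form_minus_left)

lemma form_sum_left: "form (sum f A) y = (\<Sum>a\<in>A. form (f a) y)"
  by (induction A rule: infinite_finite_induct) (simp_all add: form_add_left)

lemma form_add_right: "form u (x + y) = form u x + form u y"
proof (induction u rule: poly_mapping_add_induct)
  case (single m v)
  show ?case
    by (cases m) (simp add: form_single lin_simps[OF lin_funpow[OF lin_dunkl]] lookup_add h_add_right)
qed (simp add: form_add_left)

lemma form_scal_right: "form u (scal k y) = cnj k * form u y"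
proof (induction u rule: poly_mapping_add_induct)
  case (single m v)
  show ?case
    by (cases m) (simp add: form_single lin_simps[OF lin_funpow[OF lin_dunkl]] lookup_scal h_scale_right)
qed (simp add: form_add_left distrib_left)

lemma form_minus_right: "form u (- y) = - form u y"
  using form_scal_right[of u "- 1" y] by simp

lemma form_diff_right: "form u (x - y) = form u x - form u y"
  using form_add_right[of u x "- y"] by (simp add: form_minus_right)

lemma form_sum_right: "form u (sum f A) = (\<Sum>a\<in>A. form u (f a))"
proof (induction A rule: infinite_finite_induct)
  case empty
  show ?case using form_scal_right[of u 0 0] by simp
qed (simp_all add: form_add_right, use form_scal_right[of u 0 0] in simp)

lemma form_lw: "form (lw v) y = h v (lookup y (0, 0))"
  by (simp add: lw_def form_single)

lemma dunkl_funpow_commute: "(dunkl x ^^ n) (dunkl y u) = dunkl y ((dunkl x ^^ n) u)"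
  by (induction n) (simp_all add: dunkl_commute[of x y])

lemma form_mulz: "form (mulz u) y = form u (dunkl (vcnj zv) y)"
proof (induction u rule: poly_mapping_add_induct)
  case (single m v)
  show ?case by (cases m) (simp add: mulz_single form_single funpow_swap1)
qed (simp add: form_add_left lin_simps[OF lin_mulz])

lemma form_mulzb: "form (mulzb u) y = form u (dunkl (vcnj zbv) y)"
proof (induction u rule: poly_mapping_add_induct)
  case (single m v)
  show ?case by (cases m) (simp add: mulzb_single form_single dunkl_funpow_commute)
qed (simp add: form_add_left lin_simps[OF lin_mulzb])

lemma form_mulx: "form (mulx x u) y = form u (dunkl (vcnj x) y)"
proof -
  have "vcnj x = cnj ((x $ 1 - \<i> * x $ 2) / 2) *s vcnj zv + cnj ((x $ 1 + \<i> * x $ 2) / 2) *s vcnj zbv"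
    by (simp add: vec2_eq_iff vcnj_def field_simps)
  then have "dunkl (vcnj x) y = scal (cnj ((x $ 1 - \<i> * x $ 2) / 2)) (dunkl (vcnj zv) y) +
      scal (cnj ((x $ 1 + \<i> * x $ 2) / 2)) (dunkl (vcnj zbv) y)"
    by (simp only: dunkl_add_vec dunkl_scale_vec)
  then show ?thesis
    by (simp only: mulx_def form_add_left form_scal_left form_mulz form_mulzb
        form_add_right form_scal_right complex_cnj_cnj)
qed

lemma lookup_grp_0: "lookup (grp g y) (0, 0) = \<rho> g *v lookup y (0, 0)"
proof (induction y rule: vpoly_induct_x)
  case (lw v)
  show ?case unfolding grp_lw by (simp add: lw_def)
next
  case (x x u)
  show ?case by (simp add: grp_mulx lookup_mulx_0)
next
  case (add u v)
  then show ?case by (simp add: lin_simps[OF lin_grp] lookup_add matrix_vector_right_distrib)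
qed

lemma vcnj_act_h: "vcnj (act_h g x) = act_h g (vcnj x)"
  by (simp add: vec2_eq_iff vcnj_def)

lemma form_grp: "g \<in> G \<Longrightarrow> form (grp g u) (grp g y) = form u y"
proof (induction u arbitrary: y rule: vpoly_induct_x)
  case (lw v)
  then show ?case by (simp add: grp_lw form_lw lookup_grp_0 h_rho)
next
  case (x x u)
  then show ?case by (simp add: grp_mulx form_mulx act_dual_G vcnj_act_h grp_dunkl[symmetric])
next
  case (add u v)
  then show ?case by (simp add: lin_simps[OF lin_grp] form_add_left)
qed

lemma S_mult_self: "s \<in> S \<Longrightarrow> s ** s = mat 1"
  using d_pos by (elim reflections_cases[rotated]) (auto simp: plane_mult rotm_0)

lemma form_grp_S: "s \<in> S \<Longrightarrow> form (grp s u) y = form u (grp s y)"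
  using form_grp[of s u "grp s y"] by (simp add: grp_mult S_mult_self grp_1)

lemma pairing_vcnj: "cnj (pairing (vcnj x) (vcnj y)) = pairing x y"
  by (simp add: pairing_eq vcnj_def)

text \<open>Reflections are orthogonal involutions and \<open>c\<close> is real, so a coefficient
  survives exchanging and conjugating its two vectors.\<close>

lemma rel_coeff_vcnj:
  assumes s: "s \<in> S"
  shows "cnj (rel_coeff (vcnj x) (vcnj y) s) = rel_coeff y x s"
proof -
  have k: "rel_coeff y x s = of_real (c s) * pairing (y - act_h s y) x" for x y
    by (simp add: rel_coeff_def mult.assoc pairing_root[OF s])
  have "pairing (act_h s x) y = pairing x (act_h s y)"
    using pairing_act_h[OF G_orth[OF S_in_G[OF s]], of x "act_h s y"]
    by (simp add: act_h_mult[symmetric] S_mult_self[OF s])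
  then have "pairing (x - act_h s x) y = pairing (y - act_h s y) x"
    by (simp add: pairing_diff_left pairing_commute[of x y] pairing_commute[of x "act_h s y"])
  moreover have "vcnj x - act_h s (vcnj x) = vcnj (x - act_h s x)"
    by (simp add: vcnj_act_h[symmetric]) (simp add: vcnj_def vec_eq_iff)
  ultimately show ?thesis unfolding k by (simp add: pairing_vcnj)
qed

lemma form_cm: "form (cm y x u) v = form u (cm (vcnj x) (vcnj y) v)"
proof -
  have e: "cm y x u = scal (pairing y x) u - (\<Sum>s\<in>S. scal (rel_coeff y x s) (grp s u))" for y x u
    by (simp add: cm_def rel_coeff_def)
  show ?thesis
    unfolding e
    by (simp add: form_diff_left form_diff_right form_scal_left form_scal_right form_sum_left
        form_sum_right form_grp_S rel_coeff_vcnj pairing_vcnj pairing_commute[of y x])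
qed

text \<open>At \<open>mulx x u\<close> a commutator appears; by \<open>form_cm\<close> its adjoint
  is exactly the commutator that arises on the other side. The induction starts because constants
  are orthogonal to multiples of linear forms.\<close>

lemma form_dunkl: "form (dunkl y u) v = form u (mulx (vcnj y) v)"
proof (induction u arbitrary: v rule: vpoly_induct_x)
  case (lw p)
  then show ?case by (simp add: dunkl_lw form_lw lookup_mulx_0)
next
  case (x x u)
  then show ?case by (simp add: dunkl_mulx form_add_left form_mulx form_cm form_add_right)
next
  case (add u v')
  then show ?case by (simp add: lin_simps[OF lin_dunkl] form_add_left)
qed

lemma form_sym: "form v u = cnj (form u v)"
proof (induction u arbitrary: v rule: vpoly_induct_x)
  case (lw p)
  show ?case
  proof (induction v rule: vpoly_induct_x)
    case (lw v)
    show ?case unfolding form_lw by (simp add: lw_def h_sym[of p v])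
  next
    case (x x u)
    show ?case by (simp add: form_mulx dunkl_lw form_lw lookup_mulx_0)
        (use form_scal_right[of u 0 0] in simp)
  next
    case (add u v)
    then show ?case by (simp add: form_add_left form_add_right)
  qed
next
  case (x x u)
  have "form v (mulx x u) = form (dunkl (vcnj x) v) u" by (simp add: form_dunkl)
  then show ?case using x by (simp add: form_mulx)
qed (simp add: form_add_left form_add_right)

lemma contravariant_form: "contravariant h form"
  unfolding contravariant_def
proof (intro conjI allI ballI)
  show "form v u = cnj (form u v)" for u v by (rule form_sym)
qed (simp_all add: form_add_left form_scal_left form_grp form_dunkl form_lw, simp add: lw_def)

end

section \<open>Homogeneous polynomials\<close>

definition homog :: "nat \<Rightarrow> ('n::finite) vpoly \<Rightarrow> bool" where
  "homog n u \<longleftrightarrow> (\<forall>m. lookup u m \<noteq> 0 \<longrightarrow> fst m + snd m = n)"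

lemma homog_0 [simp]: "homog n 0"
  and homog_add: "homog n u \<Longrightarrow> homog n v \<Longrightarrow> homog n (u + v)"
  and homog_scal: "homog n u \<Longrightarrow> homog n (scal k u)"
  and homog_single: "i + j = n \<Longrightarrow> homog n (single (i, j) x)"
proof -
  show "homog n u \<Longrightarrow> homog n v \<Longrightarrow> homog n (u + v)"
    unfolding homog_def lookup_add by (metis add_cancel_right_left)
  show "homog n u \<Longrightarrow> homog n (scal k u)"
    unfolding homog_def lookup_scal by auto
qed (auto simp: homog_def lookup_single when_def)

lemma homog_minus: "homog n u \<Longrightarrow> homog n (- u)"
  using homog_scal[of n u "- 1"] by simp

lemma homog_diff: "homog n u \<Longrightarrow> homog n v \<Longrightarrow> homog n (u - v)"
  using homog_add[of n u "- v"] homog_minus[of n v] by simp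

lemma homog_sum: "(\<And>a. a \<in> A \<Longrightarrow> homog n (f a)) \<Longrightarrow> homog n (sum f A)"
  by (induction A rule: infinite_finite_induct) (auto intro: homog_add)

lemma homog_induct [consumes 1, case_names single add]:
  assumes "homog n u"
    and single: "\<And>i j v. i + j = n \<Longrightarrow> P (single (i, j) v)"
    and add: "\<And>u v. homog n u \<Longrightarrow> homog n v \<Longrightarrow> P u \<Longrightarrow> P v \<Longrightarrow> P (u + v)"
  shows "P u"
proof -
  have k: "fst m + snd m = n" if "m \<in> keys u" for m
    using assms(1) that by (simp add: homog_def in_keys_iff)
  have "homog n (\<Sum>m\<in>T. single m (lookup u m)) \<and>
      P (\<Sum>m\<in>T. single m (lookup u m))" if "T \<subseteq> keys u" for T
    using finite_subset[OF that finite_keys] that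
  proof induction
    case empty
    show ?case using single[of 0 n 0] by simp
  next
    case (insert m T)
    have "homog n (single m (lookup u m))"
      "P (single m (lookup u m))"
      using k[of m] insert.prems homog_single[of "fst m" "snd m" n] single[of "fst m" "snd m"] by auto
    then show ?case using insert by (auto intro: homog_add add)
  qed
  from this[OF order_refl] show ?thesis using poly_mapping_sum_single[of u] by simp
qed

lemma homog_mulz: "homog n u \<Longrightarrow> homog (Suc n) (mulz u)"
  by (induction rule: homog_induct) (auto simp: mulz_single lin_simps[OF lin_mulz] intro: homog_add homog_single)

lemma homog_mulzb: "homog n u \<Longrightarrow> homog (Suc n) (mulzb u)"
  by (induction rule: homog_induct) (auto simp: mulzb_single lin_simps[OF lin_mulzb] intro: homog_add homog_single)

lemma homog_mulx: "homog n u \<Longrightarrow> homog (Suc n) (mulx x u)"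
  unfolding mulx_def by (intro homog_add homog_scal homog_mulz homog_mulzb)

lemma homog_mulx_funpow: "homog n u \<Longrightarrow> homog (k + n) ((mulx x ^^ k) u)"
  by (induction k) (auto intro: homog_mulx)

lemma homog_0_eq: "homog 0 u \<Longrightarrow> u = lw (lookup u (0, 0))"
  by (rule poly_mapping_eqI) (auto simp: homog_def lw_def lookup_single when_def)

lemma homog_components:
  obtains N f where "u = (\<Sum>n<N. f n)" "\<And>n. homog n (f n)"
proof -
  have "\<exists>N f. u = (\<Sum>n<N. f n) \<and> (\<forall>n. homog n (f n))"
  proof (induction u rule: poly_mapping_add_induct)
    case (single m v)
    obtain i j where m: "m = (i, j)" by (cases m)
    show ?case
      by (intro exI[of _ "Suc (i + j)"] exI[of _ "\<lambda>n. if n = i + j then single m v else 0"])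
        (auto simp: m homog_single)
  next
    case (add u v)
    then obtain N f N' f' where u: "u = (\<Sum>n<N. f n)" "\<And>n. homog n (f n)" and v: "v = (\<Sum>n<N'. f' n)" "\<And>n. homog n (f' n)"
      by blast
    let ?g = "\<lambda>n. (if n < N then f n else 0) + (if n < N' then f' n else 0)"
    have "(\<Sum>n<max N N'. (if n < N then f n else 0)) = (\<Sum>n<N. f n)"
      by (rule sum.mono_neutral_cong_right) auto
    moreover have "(\<Sum>n<max N N'. (if n < N' then f' n else 0)) = (\<Sum>n<N'. f' n)"
      by (rule sum.mono_neutral_cong_right) auto
    ultimately have "u + v = (\<Sum>n<max N N'. ?g n)"
      by (simp only: u v sum.distrib)
    moreover have "homog n (?g n)" for n using u v by (auto intro: homog_add)
    ultimately show ?case by blast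
  qed
  then show ?thesis using that by blast
qed

context dunkl_setup
begin

lemma homog_grp: "homog n u \<Longrightarrow> homog n (grp g u)"
proof (induction rule: homog_induct)
  case (single i j v)
  have "homog 0 (lw (\<rho> g *v v))" by (simp add: lw_def homog_single)
  from homog_mulx_funpow[OF homog_mulx_funpow[OF this]] show ?case
    using single by (auto simp: grp_single)
qed (auto simp: lin_simps[OF lin_grp] intro: homog_add)

lemma homog_cm: "homog n u \<Longrightarrow> homog n (cm y x u)"
  unfolding cm_def by (intro homog_diff homog_scal homog_sum homog_grp)

lemma homog_dunkl_mono: "i + j = Suc n \<Longrightarrow> homog n (dunkl_mono y i j v)"
proof (induction y i j v arbitrary: n rule: dunkl_mono.induct)
  case (2 y j v)
  have "homog n (mulzb (dunkl_mono y 0 j v))"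
    using 2 by (cases n) (auto simp: lin_0[OF lin_mulzb] intro: homog_mulzb)
  then show ?case using 2(2) by (auto intro!: homog_add homog_cm homog_single)
next
  case (3 y i j v)
  have "homog n (mulz (dunkl_mono y i j v))"
    using 3 by (cases n) (auto simp: lin_0[OF lin_mulz] intro: homog_mulz)
  then show ?case using 3(2) by (auto intro!: homog_add homog_cm homog_single)
qed simp

lemma homog_dunkl: "homog (Suc n) u \<Longrightarrow> homog n (dunkl y u)"
  by (induction rule: homog_induct)
    (auto simp: dunkl_single homog_dunkl_mono lin_simps[OF lin_dunkl] intro: homog_add)

end

context irreducible_setup
begin

lemma euler_hom: "homog n u \<Longrightarrow> euler u = scal (of_nat n) u + csum u - scal (of_real \<kappa>) u"
proof -
  assume "homog n u"
  then have "euler u - csum u + scal (of_real \<kappa>) u = scal (of_nat n) u"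
    by (intro poly_mapping_eqI, unfold lookup_euler lookup_scal) (auto simp: homog_def simp del: of_nat_add)
  then show ?thesis by (simp add: algebra_simps)
qed

end

section \<open>Semidefiniteness degree by degree\<close>

context form_setup
begin

sublocale inner_setup d c \<rho> h by unfold_locales (rule ip)

lemma b_grp_S: "s \<in> S \<Longrightarrow> b (grp s u) v = b u (grp s v)"
  using b_grp[of s u "grp s v"] by (simp add: grp_mult S_mult_self grp_1)

lemma b_csum: "b (csum u) v = b u (csum v)"
  by (simp add: csum_def b_sum_left b_sum_right b_scal_left b_scal_right b_grp_S)

lemma vcnj_axis: "vcnj (axis i 1) = axis i 1"
  by (simp add: vcnj_def axis_def vec_eq_iff)

lemma b_euler: "b (euler u) v = b (dunkl (axis 1 1) u) (dunkl (axis 1 1) v) + b (dunkl (axis 2 1) u) (dunkl (axis 2 1) v)"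
  by (simp add: euler_def b_add_left b_mulx_left vcnj_axis)

lemma b_euler_sym: "b (euler u) v = b u (euler v)"
  by (simp add: euler_def b_add_left b_add_right b_mulx_left b_mulx_right vcnj_axis)

text \<open>\<open>euler\<close> and \<open>csum\<close> are self-adjoint, hence so is the degree
  operator, and its eigenspaces are orthogonal.\<close>

lemma b_hom_orth:
  assumes "homog n u" "homog m v" "n \<noteq> m"
  shows "b u v = 0"
proof -
  have "of_nat n * b u v = of_nat m * b u v"
    using b_euler_sym[of u v]
    by (simp add: euler_hom[OF assms(1)] euler_hom[OF assms(2)] b_add_left b_add_right b_diff_left
        b_diff_right b_scal_left b_scal_right b_csum)
  then show ?thesis using assms(3) by simp
qed

lemma psd_hom_imp_psd:
  assumes "\<And>n u. homog n u \<Longrightarrow> 0 \<le> Re (b u u)"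
  shows "0 \<le> Re (b u u)"
proof -
  obtain N f where f: "u = (\<Sum>n<N. f n)" "\<And>n. homog n (f n)" using homog_components by blast
  have "b u u = (\<Sum>n<N. \<Sum>m<N. b (f n) (f m))"
    unfolding f(1) b_sum_left b_sum_right by (rule sum.swap)
  also have "\<dots> = (\<Sum>n<N. \<Sum>m<N. if m = n then b (f n) (f n) else 0)"
    using b_hom_orth[OF f(2) f(2)] by (intro sum.cong refl) auto
  also have "\<dots> = (\<Sum>n<N. b (f n) (f n))" by simp
  finally show ?thesis using assms[OF f(2)] by (simp add: sum_nonneg)
qed

lemma Re_of_real_mult: "Re (of_real t * z) = t * Re z"
  by simp

text \<open>The Euler identity \<open>(n - \<kappa> + \<mu>) b(u, u) = \<Sum>\<^sub>i b(D\<^sub>i u, D\<^sub>i u)\<close> carries positivity from degree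
  \<open>n - 1\<close> to degree \<open>n\<close>; when the coefficient vanishes, the right-hand side forces \<open>u\<close> to be null.\<close>

lemma psd_eigenvector_step:
  assumes psd: "\<And>v. homog n v \<Longrightarrow> 0 \<le> Re (b v v)"
    and u: "homog (Suc n) u" "csum u = scal (of_real \<mu>) u" and pos: "0 \<le> real (Suc n) - \<kappa> + \<mu>"
  shows "0 \<le> Re (b u u)"
proof -
  let ?D1 = "dunkl (axis 1 1) u" and ?D2 = "dunkl (axis 2 1) u"
  have D: "homog n ?D1" "homog n ?D2" using homog_dunkl[OF u(1)] by auto
  have "euler u = scal (of_real (real (Suc n) - \<kappa> + \<mu>)) u"
    by (simp add: euler_hom[OF u(1)] u(2) V.scale_left_distrib V.scale_left_diff_distrib algebra_simps)
  then have e: "of_real (real (Suc n) - \<kappa> + \<mu>) * b u u = b ?D1 ?D1 + b ?D2 ?D2"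
    using b_euler[of u u] by (simp add: b_scal_left)
  have "(real (Suc n) - \<kappa> + \<mu>) * Re (b u u) = Re (of_real (real (Suc n) - \<kappa> + \<mu>) * b u u)"
    by (rule Re_of_real_mult[symmetric])
  then have e': "(real (Suc n) - \<kappa> + \<mu>) * Re (b u u) = Re (b ?D1 ?D1) + Re (b ?D2 ?D2)"
    unfolding e by simp
  have nonneg: "0 \<le> Re (b ?D1 ?D1)" "0 \<le> Re (b ?D2 ?D2)" using psd D by auto
  show ?thesis
  proof (cases "real (Suc n) - \<kappa> + \<mu> = 0")
    case False
    then show ?thesis using e' nonneg pos by (metis add_nonneg_nonneg less_eq_real_def zero_le_mult_iff not_less)
  next
    case True
    then have "Re (b ?D1 ?D1) = 0" "Re (b ?D2 ?D2) = 0" using e' nonneg by auto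
    then have null: "b ?D1 w = 0" "b ?D2 w = 0" if "homog n w" for w
      using psd D that by (auto intro!: b_null homog_add homog_scal)
    have "b (dunkl y u) w = 0" if "homog n w" for y w
      by (subst vec2_expansion[of y])
        (simp add: dunkl_add_vec dunkl_scale_vec b_add_left b_scal_left null[OF that])
    then have x: "b u (mulx x w) = 0" if "homog n w" for x w using that by (simp add: b_mulx_right)
    \<comment> \<open>Every monomial of degree \<open>Suc n\<close> is z or w times one of degree
      \<open>n\<close>, so orthogonality to all \<open>mulx x w\<close> is enough; it then applies
      to \<open>u\<close> itself.\<close>
    have "b u w = 0" if "homog (Suc n) w" for w
      using that
    proof (induction rule: homog_induct)
      case (single i j v)
      show ?case
      proof (cases i)
        case 0
        then show ?thesis using single x[of "single (0, n) v" zbv]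
          by (simp add: homog_single mulx_zbv mulzb_single)
      next
        case (Suc i')
        then show ?thesis using single x[of "single (i', j) v" zv]
          by (simp add: homog_single mulx_zv mulz_single)
      qed
    qed (simp add: b_add_right)
    then show ?thesis using u(1) by simp
  qed
qed

lemma psd_hom_0: "homog 0 u \<Longrightarrow> 0 \<le> Re (b u u)"
proof -
  assume "homog 0 u"
  then have u: "u = lw (lookup u (0, 0))" by (rule homog_0_eq)
  show ?thesis
  proof (cases "lookup u (0, 0) = 0")
    case True
    then show ?thesis using u by (simp add: lw_def)
  next
    case False
    then show ?thesis by (subst (1 2) u) (simp add: b_lw h_pos less_imp_le)
  qed
qed

end

section \<open>Isotypic decomposition under rotations\<close>

context dunkl_setup
begin

definition rgrp :: "int \<Rightarrow> 'n vpoly \<Rightarrow> 'n vpoly" where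
  "rgrp k = grp (rotm (ang d k))"

definition sgrp :: "'n vpoly \<Rightarrow> 'n vpoly" where
  "sgrp = grp (refm 0)"

lemma refm_0_in_G [simp]: "refm 0 \<in> G"
  using refm_in_dihedral[OF d_pos, of 0] by (simp add: ang_0)

lemma rotm_in_G [simp]: "rotm (ang d k) \<in> G"
  by (rule rotm_in_dihedral[OF d_pos])

lemma rgrp_add: "rgrp j (rgrp k u) = rgrp (j + k) u"
  by (simp add: rgrp_def grp_mult plane_mult ang_add)

lemma rgrp_0: "rgrp 0 u = u"
  by (simp add: rgrp_def ang_0 rotm_0 grp_1)

lemma rgrp_period: "rgrp (int (2 * d)) u = u"
proof -
  have "rotm (ang d (int (2 * d))) = rotm (ang d 0)"
    using rotm_ang_eq_iff[OF d_pos, of "int (2 * d)" 0] by simp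
  then show ?thesis using rgrp_0 by (simp add: rgrp_def)
qed

lemma rgrp_sgrp: "rgrp k (sgrp u) = sgrp (rgrp (- k) u)"
  and sgrp_sgrp: "sgrp (sgrp u) = u"
  by (simp_all add: rgrp_def sgrp_def grp_mult) (simp_all add: plane_mult ang_minus rotm_0 grp_1)

lemma grp_refm: "grp (refm (ang d k)) u = rgrp k (sgrp u)"
  by (simp add: rgrp_def sgrp_def grp_mult plane_mult)

lemma lin_rgrp: "lin (rgrp k)" and lin_sgrp: "lin sgrp"
  by (simp_all add: rgrp_def sgrp_def lin_grp)

definition eig :: "complex \<Rightarrow> 'n vpoly \<Rightarrow> bool" where
  "eig e u \<longleftrightarrow> rgrp 1 u = scal e u"

lemma rgrp_eig: "eig e u \<Longrightarrow> rgrp (int k) u = scal (e ^ k) u"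
proof (induction k)
  case (Suc k)
  have "rgrp (int (Suc k)) u = rgrp 1 (rgrp (int k) u)" by (simp add: rgrp_add)
  then show ?case using Suc by (simp add: lin_simps[OF lin_rgrp] eig_def mult.commute)
qed (simp add: rgrp_0)

lemma rgrp_minus_eig:
  assumes "eig e u" "e \<noteq> 0"
  shows "rgrp (- int k) u = scal (inverse e ^ k) u"
proof -
  have "u = rgrp (- int k) (rgrp (int k) u)" by (simp add: rgrp_add rgrp_0)
  also have "\<dots> = scal (e ^ k) (rgrp (- int k) u)"
    by (simp add: rgrp_eig[OF assms(1)] lin_simps[OF lin_rgrp])
  finally have "scal (inverse e ^ k) u = scal (inverse e ^ k) (scal (e ^ k) (rgrp (- int k) u))" by simp
  then show ?thesis using assms(2) by (simp add: power_mult_distrib[symmetric])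
qed

lemma eig_sgrp: "eig e u \<Longrightarrow> e \<noteq> 0 \<Longrightarrow> eig (inverse e) (sgrp u)"
  using rgrp_minus_eig[of e u 1] by (simp add: eig_def rgrp_sgrp lin_simps[OF lin_sgrp])

text \<open>An average over the rotations. The weight \<open>e ^ k\<close> selects the eigenvalue
  inverse to \<open>e\<close>; the cases of interest are 1 and -1, which are their own
  inverses.\<close>

definition proj :: "complex \<Rightarrow> 'n vpoly \<Rightarrow> 'n vpoly" where
  "proj e u = scal (1 / of_nat (2 * d)) (\<Sum>k<2 * d. scal (e ^ k) (rgrp (int k) u))"

lemma lin_proj: "lin (proj e)"
  unfolding proj_def[abs_def] by (intro lin_scale lin_sum_fun lin_rgrp)

lemma proj_eig:
  assumes u: "eig m u" and "(e * m) ^ (2 * d) = 1"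
  shows "proj e u = (if e * m = 1 then u else 0)"
proof -
  have "proj e u = scal (1 / of_nat (2 * d)) (scal (\<Sum>k<2 * d. (e * m) ^ k) u)"
    by (simp add: proj_def rgrp_eig[OF u] power_mult_distrib V.scale_sum_left)
  moreover have "(\<Sum>k<2 * d. (e * m) ^ k) = (if e * m = 1 then of_nat (2 * d) else 0)"
    using geometric_sum[of "e * m" "2 * d"] assms(2) by auto
  ultimately show ?thesis using d_pos by auto
qed

lemma eig_proj:
  assumes e: "e * e = 1"
  shows "eig e (proj e u)"
proof -
  let ?f = "\<lambda>k. scal (e ^ k) (rgrp (int k) u)"
  have "e ^ (2 * d) = (e * e) ^ d" by (simp add: power_mult power2_eq_square)
  then have e2: "e ^ (2 * d) = 1" using e by simp
  have "e * e ^ Suc k = (e * e) * e ^ k" for k by simp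
  then have e3: "e * e ^ Suc k = e ^ k" for k by (simp only: e mult_1_left)
  have "(\<Sum>k<2 * d. scal (e ^ k) (rgrp 1 (rgrp (int k) u))) = (\<Sum>k<2 * d. scal e (?f (Suc k)))"
    by (intro sum.cong refl) (simp only: rgrp_add V.scale_scale e3 of_nat_Suc add.commute)
  also have "\<dots> = scal e (\<Sum>k<2 * d. ?f (Suc k))" by (simp add: V.scale_sum_right)
  \<comment> \<open>Shifting a sum over a full period: the term at 2d equals the term at 0.\<close>
  also have "(\<Sum>k<2 * d. ?f (Suc k)) = (\<Sum>k<2 * d. ?f k)"
  proof -
    have "?f 0 + (\<Sum>k<2 * d. ?f (Suc k)) = (\<Sum>k<Suc (2 * d). ?f k)"
      by (rule sum.lessThan_Suc_shift[symmetric])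
    also have "\<dots> = (\<Sum>k<2 * d. ?f k) + ?f (2 * d)" by (rule sum.lessThan_Suc)
    also have "?f (2 * d) = ?f 0" using e2 rgrp_period by (simp add: rgrp_0)
    finally show ?thesis by (simp add: add.commute)
  qed
  finally have "(\<Sum>k<2 * d. scal (e ^ k) (rgrp 1 (rgrp (int k) u))) = scal e (\<Sum>k<2 * d. ?f k)" .
  then show ?thesis
    by (simp only: eig_def proj_def lin_simps[OF lin_rgrp] V.scale_left_commute[of e])
qed

lemma rgrp_proj: "proj e (rgrp k u) = rgrp k (proj e u)"
  by (simp add: proj_def lin_simps[OF lin_rgrp] rgrp_add add.commute)

text \<open>\<open>sgrp\<close> inverts rotations and \<open>e\<close> is its own inverse, so
  \<open>?y\<close> is an eigenvector for \<open>e\<close> and is fixed by \<open>proj e\<close>. It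
  is also a combination of rotated copies of \<open>u\<close>, which \<open>proj e\<close>
  kills.\<close>

lemma proj_sgrp_0:
  assumes e: "e * e = 1" and 0: "proj e u = 0"
  shows "proj e (sgrp u) = 0"
proof -
  let ?y = "sgrp (proj e (sgrp u))"
  have e0: "e \<noteq> 0" "inverse e = e" using e by (auto simp: inverse_unique)
  have "e ^ (2 * d) = (e * e) ^ d" by (simp add: power_mult power2_eq_square)
  then have e2: "(e * e) ^ (2 * d) = 1" using e by simp
  have "eig e ?y" using eig_sgrp[OF eig_proj[OF e] e0(1)] e0(2) by simp
  then have 1: "?y = proj e ?y" using proj_eig[of e ?y e] e e2 by simp
  have 2: "?y = scal (1 / of_nat (2 * d)) (\<Sum>k<2 * d. scal (e ^ k) (rgrp (- int k) u))"
    by (simp add: proj_def lin_simps[OF lin_sgrp] rgrp_sgrp sgrp_sgrp)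
  have "proj e ?y = 0"
    unfolding 2 by (simp add: lin_simps[OF lin_proj] rgrp_proj 0 lin_simps[OF lin_rgrp])
  then have "sgrp ?y = 0" using 1 lin_0[OF lin_sgrp] by metis
  then show ?thesis by (simp add: sgrp_sgrp)
qed

lemma homog_proj: "homog n u \<Longrightarrow> homog n (proj e u)"
  unfolding proj_def rgrp_def by (intro homog_scal homog_sum homog_grp)

lemma homog_sgrp: "homog n u \<Longrightarrow> homog n (sgrp u)"
  unfolding sgrp_def by (rule homog_grp)

text \<open>The weight is an integer of which only the class modulo 2d matters, so it can follow
  degrees without reduction.\<close>

definition wt :: "int \<Rightarrow> 'n vpoly \<Rightarrow> bool" where
  "wt m u \<longleftrightarrow> eig (cis (ang d m)) u"

lemma cis_ang_eq_1_iff: "cis (ang d m) = 1 \<longleftrightarrow> int (2 * d) dvd m"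
  using sin_cos_ang_eq_iff[OF d_pos, of m 0] by (auto simp: complex_eq_iff ang_0)

lemma cis_ang_d: "cis (ang d (int d)) = - 1"
  using d_pos by (simp add: ang_def)

lemma cis_ang_eq_minus_1_iff: "cis (ang d m) = - 1 \<longleftrightarrow> int (2 * d) dvd m - int d"
  unfolding cis_ang_d[symmetric]
  using sin_cos_ang_eq_iff[OF d_pos, of m "int d"] by (auto simp: complex_eq_iff)

lemma cis_ang_power: "cis (ang d m) ^ (2 * d) = 1"
proof -
  have "real (2 * d) * ang d m = ang d (m * int (2 * d))"
    using d_pos by (simp add: ang_def field_simps)
  then have "cis (ang d m) ^ (2 * d) = cis (ang d (m * int (2 * d)))"
    by (simp only: Complex.DeMoivre)
  then show ?thesis by (simp add: cis_ang_eq_1_iff)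
qed

text \<open>Linear forms transform contragrediently: rotation by t multiplies z by
  \<open>cis (- t)\<close> and w by \<open>cis t\<close>.\<close>

lemma wt_mulz: "wt m u \<Longrightarrow> wt (m - 1) (mulz u)"
  and wt_mulzb: "wt m u \<Longrightarrow> wt (m + 1) (mulzb u)"
proof -
  have z: "act_h (rotm t) zv = cis (- t) *s zv" "act_h (rotm t) zbv = cis t *s zbv" for t
    by (simp_all add: vec2_eq_iff complex_eq_iff)
  show "wt m u \<Longrightarrow> wt (m - 1) (mulz u)" "wt m u \<Longrightarrow> wt (m + 1) (mulzb u)"
    by (simp_all add: wt_def eig_def rgrp_def mulx_zv[symmetric] mulx_zbv[symmetric] grp_mulx act_dual_G z
        mulx_scale lin_simps[OF lin_mulx] ang_diff ang_add cis_mult add_ac)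
qed

lemma wt_sgrp: "wt m u \<Longrightarrow> wt (- m) (sgrp u)"
  unfolding wt_def using eig_sgrp[of "cis (ang d m)" u] by (simp add: ang_minus)

lemma wt_mulz_funpow: "wt m u \<Longrightarrow> wt (m - int i) ((mulz ^^ i) u)"
proof (induction i)
  case (Suc i)
  then show ?case using wt_mulz[of "m - int i" "(mulz ^^ i) u"] by (simp add: algebra_simps)
qed simp

lemma wt_mulzb_funpow: "wt m u \<Longrightarrow> wt (m + int i) ((mulzb ^^ i) u)"
proof (induction i)
  case (Suc i)
  then show ?case using wt_mulzb[of "m + int i" "(mulzb ^^ i) u"] by (simp add: algebra_simps)
qed simp

lemma wt_single: "wt m (lw v) \<Longrightarrow> wt (m + int j - int i) (single (i, j) v)"
  unfolding single_eq_funpow by (intro wt_mulz_funpow wt_mulzb_funpow)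

lemma proj_1_wt: "wt m u \<Longrightarrow> proj 1 u = (if int (2 * d) dvd m then u else 0)"
  unfolding wt_def using proj_eig[of "cis (ang d m)" u 1] cis_ang_power by (simp add: cis_ang_eq_1_iff)

lemma proj_minus_1_wt: "wt m u \<Longrightarrow> proj (- 1) u = (if int (2 * d) dvd m - int d then u else 0)"
proof -
  assume u: "wt m u"
  have "(- 1 * cis (ang d m)) ^ (2 * d) = 1" using cis_ang_power[of m] by (simp add: power_mult_distrib)
  moreover have "- 1 * cis (ang d m) = 1 \<longleftrightarrow> int (2 * d) dvd m - int d"
    unfolding cis_ang_eq_minus_1_iff[symmetric] by (auto simp: minus_equation_iff[of _ 1])
  ultimately show ?thesis using u proj_eig[of "cis (ang d m)" u "- 1"] unfolding wt_def by simp
qed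

lemma proj_homog_0:
  assumes "\<And>i j v. i + j = n \<Longrightarrow> proj e (single (i, j) v) = 0" "homog n u"
  shows "proj e u = 0"
  using assms(2) by (induction rule: homog_induct) (simp_all add: assms(1) lin_simps[OF lin_proj])

text \<open>The bridge from the eigenvalue condition in \<open>is_tau\<close> to weights of constant
  polynomials.\<close>

lemma lw_wt_iff: "wt m (lw v) \<longleftrightarrow> \<rho> (rotation d) *v v = cis (ang d m) *s v"
proof -
  have "rotation d = rotm (ang d 1)"
    by (simp add: mat2_eq_iff rotation_def ang_def)
  moreover have "lw x = lw y \<longleftrightarrow> x = y" for x y :: "complex^'n"
    by (auto simp: lw_def dest: arg_cong[where f = "\<lambda>u. lookup u (0, 0)"])
  ultimately show ?thesis by (simp add: wt_def eig_def rgrp_def grp_lw lw_scale[symmetric])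
qed

end

text \<open>\<open>p\<close> and \<open>q\<close> belong to even and odd reflections; which of them
  is the parameter of the first generator depends on the index of that generator.\<close>

locale two_params = dunkl_setup d c \<rho>
  for d :: nat and c and \<rho> :: "real^2^2 \<Rightarrow> complex^'n^'n::finite" +
  fixes p q :: real
  assumes c_refm: "c (refm (ang d k)) = (if even k then p else q)"
begin

text \<open>The reflection of index k is the k-th rotation times \<open>sgrp\<close>, and the
  function with values p, q by parity is (p + q)/2 + (-1)^k (p - q)/2. Summing over the 2d rotations
  turns the two parts into projections for the characters 1 and -1.\<close>

lemma csum_eq: "csum u = scal (of_real (real d * (p + q))) (proj 1 (sgrp u)) +
    scal (of_real (real d * (p - q))) (proj (- 1) (sgrp u))"
proof -
  have inj: "inj_on (\<lambda>k. refm (ang d (int k))) {..<2 * d}"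
  proof (rule inj_onI)
    fix j k assume jk: "j \<in> {..<2 * d}" "k \<in> {..<2 * d}" "refm (ang d (int j)) = refm (ang d (int k))"
    then have "int (2 * d) dvd int j - int k" using refm_ang_eq_iff[OF d_pos] by blast
    then have "int j mod int (2 * d) = int k mod int (2 * d)" by (simp add: mod_eq_dvd_iff)
    then show "j = k" using jk(1,2) by simp
  qed
  have "csum u = (\<Sum>k<2 * d. scal (of_real (if even k then p else q)) (rgrp (int k) (sgrp u)))"
    unfolding csum_def reflections_eq_nat[OF d_pos]
    by (subst sum.reindex[OF inj]) (simp add: c_refm grp_refm)
  also have "\<dots> = (\<Sum>k<2 * d. scal (of_real (real d * (p + q)) / of_nat (2 * d)) (rgrp (int k) (sgrp u)) +
      scal (of_real (real d * (p - q)) / of_nat (2 * d) * (- 1) ^ k) (rgrp (int k) (sgrp u)))"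
  proof (rule sum.cong[OF refl])
    fix k
    have "complex_of_real (if even k then p else q) = of_real (real d * (p + q)) / of_nat (2 * d) +
        of_real (real d * (p - q)) / of_nat (2 * d) * (- 1) ^ k"
      using d_pos by (simp add: field_simps)
    then show "scal (of_real (if even k then p else q)) (rgrp (int k) (sgrp u)) =
      scal (of_real (real d * (p + q)) / of_nat (2 * d)) (rgrp (int k) (sgrp u)) +
      scal (of_real (real d * (p - q)) / of_nat (2 * d) * (- 1) ^ k) (rgrp (int k) (sgrp u))"
      by (simp only: V.scale_left_distrib)
  qed
  finally show ?thesis
    by (simp add: proj_def sum.distrib V.scale_sum_right)
qed

text \<open>The factor by which the reflection sum is a multiple of \<open>sgrp\<close> on weight
  \<open>m\<close>. As \<open>sgrp\<close> exchanges weights m and -m, the eigenvalues are plus and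
  minus this number, on u + \<open>sgrp\<close> u and u - \<open>sgrp\<close> u.\<close>

definition sigma :: "int \<Rightarrow> real" where
  "sigma m = (if int (2 * d) dvd m then real d * (p + q)
     else if int (2 * d) dvd m - int d then real d * (p - q) else 0)"

lemma sigma_minus: "sigma (- m) = sigma m"
proof -
  have "int (2 * d) dvd - m - int d \<longleftrightarrow> int (2 * d) dvd m - int d"
  proof -
    have "- m - int d = - (m - int d) - int (2 * d)" by simp
    then show ?thesis by (metis dvd_diff_left_iff dvd_minus_iff dvd_refl)
  qed
  then show ?thesis by (simp add: sigma_def)
qed

lemma csum_wt:
  assumes "wt m u"
  shows "csum u = scal (of_real (sigma m)) (sgrp u)"
proof -
  \<comment> \<open>The two cases of \<open>sigma\<close> exclude each other, because 2d does not
    divide d.\<close>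
  have *: "\<not> (int (2 * d) dvd m \<and> int (2 * d) dvd m - int d)" for m
  proof
    assume a: "int (2 * d) dvd m \<and> int (2 * d) dvd m - int d"
    then have "int (2 * d) dvd m - (m - int d)" using dvd_diff by blast
    then show False using d_pos zdvd_imp_le[of "int (2 * d)" "int d"] by simp
  qed
  have "csum u = scal (of_real (sigma (- m))) (sgrp u)"
    unfolding csum_eq proj_1_wt[OF wt_sgrp[OF assms]] proj_minus_1_wt[OF wt_sgrp[OF assms]] sigma_def
    using *[of "- m"] by auto
  then show ?thesis by (simp add: sigma_minus)
qed

lemma csum_eig_1: "eig 1 u \<Longrightarrow> csum u = scal (of_real (real d * (p + q))) (sgrp u)"
  using csum_wt[of 0 u] by (simp add: wt_def ang_0 sigma_def)

lemma csum_eig_minus_1: "eig (- 1) u \<Longrightarrow> csum u = scal (of_real (real d * (p - q))) (sgrp u)"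
proof -
  assume "eig (- 1) u"
  moreover have "\<not> int (2 * d) dvd int d" using d_pos zdvd_imp_le[of "int (2 * d)" "int d"] by auto
  ultimately show ?thesis using csum_wt[of "int d" u] by (simp add: wt_def cis_ang_d sigma_def)
qed

end

section \<open>Semidefiniteness from the inequalities\<close>

locale two_params_form = two_params d c \<rho> p q + form_setup d c \<rho> \<kappa> h b
  for d :: nat and c and \<rho> :: "real^2^2 \<Rightarrow> complex^'n^'n::finite" and p q \<kappa> h b
begin

lemma b_sgrp: "b (sgrp u) v = b u (sgrp v)"
  using b_grp[OF refm_0_in_G, of u "sgrp v"] by (simp add: sgrp_def[symmetric] sgrp_sgrp)

text \<open>Rotations are unitary, so pairing with an eigenvector sees only the part of
  \<open>v\<close> with the same eigenvalue.\<close>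

lemma b_proj:
  assumes e: "e = 1 \<or> e = - 1" and x: "eig e x"
  shows "b x (proj e v) = b x v"
proof -
  have e0: "e \<noteq> 0" "inverse e = e" "cnj e = e" using e by auto
  have ek: "e ^ k * e ^ k = 1" for k using e by (auto simp: power_mult_distrib[symmetric])
  have "b x (rgrp (int k) v) = e ^ k * b x v" for k
  proof -
    have "b x (rgrp (int k) v) = b (rgrp (int k) (rgrp (- int k) x)) (rgrp (int k) v)"
      by (simp add: rgrp_add rgrp_0)
    also have "\<dots> = b (rgrp (- int k) x) v"
      unfolding rgrp_def[of "int k"] by (rule b_grp) simp
    finally show ?thesis by (simp add: rgrp_minus_eig[OF x e0(1)] e0(2) b_scal_left)
  qed
  then have "b x (proj e v) = 1 / of_nat (2 * d) * (\<Sum>k<2 * d. e ^ k * e ^ k * b x v)"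
    by (simp add: proj_def b_scal_right b_sum_right e0(3) mult.assoc)
  then show ?thesis using d_pos by (simp add: ek)
qed

text \<open>The symmetric and antisymmetric parts of \<open>z\<close> under \<open>sgrp\<close> are
  eigenvectors of \<open>csum\<close> for \<open>t\<close> and \<open>-t\<close>, and they are
  orthogonal; the bound on the absolute value of \<open>t\<close> is what the Euler step needs for
  both. The alternative \<open>z = 0\<close> covers degrees in which the character does not
  occur.\<close>

lemma psd_eig_step:
  assumes psd: "\<And>v. homog n v \<Longrightarrow> 0 \<le> Re (b v v)"
    and z: "homog (Suc n) z" "csum z = scal (of_real t) (sgrp z)" "csum (sgrp z) = scal (of_real t) z"
    and t: "z = 0 \<or> \<bar>t\<bar> \<le> real (Suc n) - \<kappa>"
  shows "0 \<le> Re (b z z)"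
proof (cases "z = 0")
  case False
  then have t: "\<bar>t\<bar> \<le> real (Suc n) - \<kappa>" using t by simp
  define x y where "x = scal (1 / 2) (z + sgrp z)" and "y = scal (1 / 2) (z - sgrp z)"
  have h: "homog (Suc n) x" "homog (Suc n) y"
    unfolding x_def y_def using z(1) by (auto intro: homog_scal homog_add homog_diff homog_sgrp)
  have c: "csum x = scal (of_real t) x" "csum y = scal (of_real (- t)) y"
    by (simp_all add: x_def y_def lin_simps[OF lin_csum] z(2,3) V.scale_right_distrib
        V.scale_right_diff_distrib mult.commute algebra_simps)
  have "0 \<le> Re (b x x)" "0 \<le> Re (b y y)"
    using t by (auto intro!: psd_eigenvector_step[OF psd h(1) c(1)] psd_eigenvector_step[OF psd h(2) c(2)])
  moreover have "z = x + y"
  proof -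
    have "x + y = scal (1 / 2) z + scal (1 / 2) z"
      by (simp add: x_def y_def V.scale_right_distrib V.scale_right_diff_distrib)
    also have "\<dots> = scal (1 / 2 + 1 / 2) z" by (simp only: V.scale_left_distrib)
    finally show ?thesis by simp
  qed
  moreover have "b x y = 0"
  proof -
    have "sgrp x = x" "sgrp y = - y"
      by (simp_all add: x_def y_def lin_simps[OF lin_sgrp] sgrp_sgrp add.commute
          V.scale_right_diff_distrib)
    then have "b x y = - b x y" using b_sgrp[of x y] by (simp add: b_minus_right)
    then show ?thesis by simp
  qed
  moreover have "b y x = 0" using b_sym[of y x] \<open>b x y = 0\<close> by simp
  ultimately show ?thesis by (simp add: b_add_left b_add_right)
qed simp

text \<open>A polynomial splits orthogonally into its parts for the characters 1 and -1 and a rest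
  on which \<open>csum\<close> vanishes. The rest needs only that \<kappa> is at most the
  degree.\<close>

lemma psd_homog:
  assumes cond: "\<And>n. 1 \<le> n \<Longrightarrow> \<kappa> \<le> real n"
    "\<And>n. 1 \<le> n \<Longrightarrow> (\<forall>u. homog n u \<longrightarrow> proj 1 u = 0) \<or> \<bar>real d * (p + q)\<bar> \<le> real n - \<kappa>"
    "\<And>n. 1 \<le> n \<Longrightarrow> (\<forall>u. homog n u \<longrightarrow> proj (- 1) u = 0) \<or> \<bar>real d * (p - q)\<bar> \<le> real n - \<kappa>"
  shows "homog n u \<Longrightarrow> 0 \<le> Re (b u u)"
proof (induction n arbitrary: u)
  case 0
  then show ?case by (rule psd_hom_0)
next
  case (Suc n)
  note psd = Suc.IH
  define x y w where "x = proj 1 u" and "y = proj (- 1) u" and "w = u - x - y"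
  have ex: "eig 1 x" and ey: "eig (- 1) y" unfolding x_def y_def by (auto intro: eig_proj)
  have hx: "homog (Suc n) x" and hy: "homog (Suc n) y"
    unfolding x_def y_def using homog_proj Suc.prems by auto
  then have hw: "homog (Suc n) w" unfolding w_def using Suc.prems by (intro homog_diff)
  have px: "proj 1 x = x" "proj (- 1) x = 0" and py: "proj 1 y = 0" "proj (- 1) y = y"
    using proj_eig[OF ex, of 1] proj_eig[OF ex, of "- 1"] proj_eig[OF ey, of 1] proj_eig[OF ey, of "- 1"]
    by simp_all
  have pw: "proj 1 w = 0" "proj (- 1) w = 0"
    by (simp_all add: w_def lin_simps[OF lin_proj] px py x_def[symmetric] y_def[symmetric])
  have "csum w = scal (of_real 0) w"
    using proj_sgrp_0[OF _ pw(1)] proj_sgrp_0[OF _ pw(2)] by (simp add: csum_eq)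
  then have "0 \<le> Re (b w w)"
    using cond(1)[of "Suc n"] by (intro psd_eigenvector_step[OF psd hw]) auto
  moreover have "0 \<le> Re (b x x)"
  proof (rule psd_eig_step[OF psd hx csum_eig_1[OF ex]])
    show "csum (sgrp x) = scal (of_real (real d * (p + q))) x"
      using csum_eig_1[of "sgrp x"] eig_sgrp[OF ex] by (simp add: sgrp_sgrp)
    show "x = 0 \<or> \<bar>real d * (p + q)\<bar> \<le> real (Suc n) - \<kappa>"
      using cond(2)[of "Suc n"] Suc.prems by (auto simp: x_def)
  qed
  moreover have "0 \<le> Re (b y y)"
  proof (rule psd_eig_step[OF psd hy csum_eig_minus_1[OF ey]])
    show "csum (sgrp y) = scal (of_real (real d * (p - q))) y"
      using csum_eig_minus_1[of "sgrp y"] eig_sgrp[OF ey] by (simp add: sgrp_sgrp)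
    show "y = 0 \<or> \<bar>real d * (p - q)\<bar> \<le> real (Suc n) - \<kappa>"
      using cond(3)[of "Suc n"] Suc.prems by (auto simp: y_def)
  qed
  moreover have "b x w = 0" "b y w = 0" "b x y = 0"
    using b_proj[OF _ ex, of w] b_proj[OF _ ey, of w] b_proj[OF _ ex, of y] by (simp_all add: pw py)
  moreover have "b w x = 0" "b w y = 0" "b y x = 0"
    using calculation(4-6) b_sym[of w x] b_sym[of w y] b_sym[of y x] by simp_all
  moreover have "u = w + x + y" by (simp add: w_def)
  ultimately show ?case by (simp add: b_add_left b_add_right)
qed

text \<open>Each reflection sends \<open>zbv\<close> to a multiple of the isotropic vector
  \<open>zv\<close>, so every reflection contributes the same factor 2, the pairing of
  \<open>zbv\<close> with \<open>zv\<close>, and the commutator becomes 2 - 2C.\<close>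

lemma dunkl_zbv_mulz: "dunkl zbv (mulz u) = mulz (dunkl zbv u) + scal 2 u - scal 2 (csum u)"
proof -
  have "rel_coeff zbv zv s = 2 * of_real (c s)" if sS: "s \<in> S" for s
  proof -
    obtain k where k: "s = refm (ang d k)" by (rule reflections_cases[OF d_pos sS])
    show ?thesis
      unfolding rel_coeff_def mult.assoc pairing_root[OF sS]
      by (simp add: k pairing_eq complex_eq_iff)
  qed
  then have "(\<Sum>s\<in>S. scal (rel_coeff zbv zv s) (grp s u)) = (\<Sum>s\<in>S. scal (2 * of_real (c s)) (grp s u))"
    by (intro sum.cong) simp_all
  moreover have "pairing zbv zv = 2" by (simp add: pairing_eq)
  ultimately have "cm zbv zv u = scal 2 u - (\<Sum>s\<in>S. scal (2 * of_real (c s)) (grp s u))"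
    by (simp only: cm_def rel_coeff_def)
  then show ?thesis by (simp add: dunkl_mulz csum_def V.scale_sum_right)
qed

text \<open>The commutator of the two conjugate directions is a twisted reflection sum, which after
  multiplication by \<open>z\<close> becomes the untwisted one.\<close>

lemma mulz_cm_zbv: "mulz (cm zbv zbv u) = scal 2 (csum (mulzb u))"
proof -
  have "scal (rel_coeff zbv zbv s) (mulz (grp s u)) = - scal (2 * of_real (c s)) (grp s (mulzb u))" if sS: "s \<in> S" for s
  proof -
    obtain k where k: "s = refm (ang d k)" by (rule reflections_cases[OF d_pos sS])
    define t where "t = ang d k"
    have "act_h s zbv = cis (- t) *s zv" by (simp add: k t_def[symmetric] vec2_eq_iff complex_eq_iff)
    then have 1: "grp s (mulzb u) = scal (cis (- t)) (mulz (grp s u))"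
      using sS by (simp add: mulx_zbv[symmetric] mulx_zv[symmetric] grp_mulx act_dual_G mulx_scale)
    have "rel_coeff zbv zbv s = - (2 * of_real (c s) * cis (- t))"
      unfolding rel_coeff_def mult.assoc pairing_root[OF sS]
      by (simp add: k t_def[symmetric] pairing_eq complex_eq_iff)
    then show ?thesis by (simp add: 1)
  qed
  then have "(\<Sum>s\<in>S. scal (rel_coeff zbv zbv s) (mulz (grp s u))) = - (\<Sum>s\<in>S. scal (2 * of_real (c s)) (grp s (mulzb u)))"
    unfolding sum_negf[symmetric] by (intro sum.cong) simp_all
  moreover have "pairing zbv zbv = 0" by (simp add: pairing_eq)
  ultimately have "mulz (cm zbv zbv u) = (\<Sum>s\<in>S. scal (2 * of_real (c s)) (grp s (mulzb u)))"
    by (simp only: cm_def rel_coeff_def lin_simps[OF lin_mulz]) simp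
  then show ?thesis by (simp add: csum_def V.scale_sum_right)
qed

end

lemma mulz_inj:
  fixes u v :: "('n::finite) vpoly"
  shows "mulz u = mulz v \<Longrightarrow> u = v"
proof -
  assume "mulz u = mulz v"
  moreover have "lookup (mulz w) (Suc i, j) = lookup w (i, j)"
    for w :: "'n vpoly" and i j
  proof (induction w rule: poly_mapping_add_induct)
    case (single m x)
    show ?case by (cases m) (simp add: mulz_single lookup_single when_def)
  qed (simp add: lin_simps[OF lin_mulz] lookup_add)
  ultimately show "u = v" by (metis poly_mapping_eqI surj_pair)
qed

context two_params_form
begin

section \<open>Norms along powers of z and the necessary inequalities\<close>

context
  fixes v :: "complex^'n" and k0 :: int
  assumes wt_v: "wt k0 (lw v)"
begin

text \<open>Powers of z pass through the weights one at a time, so the weight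
  \<open>k0 - int n\<close> is met exactly in degree n.\<close>

definition chain :: "nat \<Rightarrow> 'n vpoly" where
  "chain j = (mulz ^^ j) (lw v)"

lemma chain_wt: "wt (k0 - int j) (chain j)"
  unfolding chain_def by (rule wt_mulz_funpow[OF wt_v])

text \<open>Each factor z contributes 2 - 2C. In degree 0 the sum C is \<kappa>, and at the
  intermediate weights it vanishes by assumption, so the contributions add up to 2(j + 1 -
  \<kappa>).\<close>

lemma dunkl_chain:
  assumes "\<And>i. 0 < i \<Longrightarrow> i \<le> j \<Longrightarrow> sigma (k0 - int i) = 0"
  shows "dunkl zbv (chain (Suc j)) = scal (of_real (2 * (real (Suc j) - \<kappa>))) (chain j)"
  using assms
proof (induction j)
  case 0
  show ?case
    by (simp add: chain_def dunkl_zbv_mulz dunkl_lw lin_simps[OF lin_mulz] kappa V.scale_left_diff_distrib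
        right_diff_distrib)
next
  case (Suc j)
  have "csum (chain (Suc j)) = 0"
    using csum_wt[OF chain_wt[of "Suc j"]] Suc.prems[of "Suc j"] by simp
  then have "dunkl zbv (chain (Suc (Suc j))) = mulz (dunkl zbv (chain (Suc j))) + scal 2 (chain (Suc j))"
    by (simp add: chain_def dunkl_zbv_mulz)
  also have "\<dots> = scal (of_real (2 * (real (Suc j) - \<kappa>))) (chain (Suc j)) + scal 2 (chain (Suc j))"
    using Suc by (simp add: lin_simps[OF lin_mulz]) (simp add: chain_def)
  also have "\<dots> = scal (of_real (2 * (real (Suc j) - \<kappa>)) + 2) (chain (Suc j))"
    by (simp only: V.scale_left_distrib)
  also have "of_real (2 * (real (Suc j) - \<kappa>)) + 2 = complex_of_real (2 * (real (Suc (Suc j)) - \<kappa>))"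
    by (simp add: algebra_simps)
  finally show ?case .
qed

lemma sgrp_chain: "sgrp (chain (Suc j)) = mulzb (sgrp (chain j))"
proof -
  have "act_h (refm 0) zv = zbv" by (simp add: vec2_eq_iff)
  then show ?thesis
    by (simp add: chain_def sgrp_def mulx_zv[symmetric] mulx_zbv[symmetric] grp_mulx act_dual_G)
qed

text \<open>Multiplied by z, the twisted sum becomes twice the reflection sum of
  \<open>sgrp (chain (Suc j))\<close>, which is a weight vector; then z is cancelled.\<close>

lemma cm_sgrp_chain: "cm zbv zbv (sgrp (chain j)) = scal (of_real (2 * sigma (k0 - int (Suc j)))) (chain j)"
proof (rule mulz_inj)
  have "wt (- (k0 - int (Suc j))) (sgrp (chain (Suc j)))" by (rule wt_sgrp[OF chain_wt])
  then have "csum (sgrp (chain (Suc j))) = scal (of_real (sigma (k0 - int (Suc j)))) (chain (Suc j))"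
    using csum_wt by (simp only: sigma_minus sgrp_sgrp)
  moreover have "mulz (chain j) = chain (Suc j)" by (simp add: chain_def)
  ultimately show "mulz (cm zbv zbv (sgrp (chain j))) = mulz (scal (of_real (2 * sigma (k0 - int (Suc j)))) (chain j))"
    by (simp only: mulz_cm_zbv sgrp_chain[symmetric] lin_scal[OF lin_mulz] V.scale_scale of_real_mult
        of_real_numeral)
qed

text \<open>The reflected chain consists of powers of w, whose commutator with \<open>zbv\<close>
  has reflection terms only. These vanish before the last step, so the last weight alone
  contributes.\<close>

lemma dunkl_sgrp_chain:
  assumes "\<And>i. 0 < i \<Longrightarrow> i \<le> j \<Longrightarrow> sigma (k0 - int i) = 0"
  shows "dunkl zbv (sgrp (chain (Suc j))) = scal (of_real (2 * sigma (k0 - int (Suc j)))) (chain j)"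
proof -
  have 0: "dunkl zbv (sgrp (chain i)) = 0" if "i \<le> j" for i
    using that
  proof (induction i)
    case 0
    show ?case by (simp add: chain_def sgrp_def grp_lw dunkl_lw)
  next
    case (Suc i)
    then show ?case
      using assms[of "Suc i"] by (simp add: sgrp_chain dunkl_mulzb cm_sgrp_chain lin_simps[OF lin_mulzb])
  qed
  show ?thesis
    by (simp add: sgrp_chain dunkl_mulzb 0 cm_sgrp_chain lin_simps[OF lin_mulzb])
qed

lemma vcnj_zv: "vcnj zv = zbv"
  by (simp add: vec2_eq_iff vcnj_def)

lemma b_chain:
  assumes "\<And>i. 0 < i \<Longrightarrow> i \<le> j \<Longrightarrow> sigma (k0 - int i) = 0"
  shows "b (chain (Suc j)) (chain (Suc j)) = of_real (2 * (real (Suc j) - \<kappa>)) * b (chain j) (chain j)"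
proof -
  have "b (chain (Suc j)) (chain (Suc j)) = b (chain j) (dunkl zbv (chain (Suc j)))"
    by (subst (1) chain_def) (simp add: mulx_zv[symmetric] b_mulx_left vcnj_zv, simp add: chain_def mulx_zv)
  then show ?thesis using dunkl_chain[of j] assms by (simp add: b_scal_right)
qed

lemma b_chain_pos:
  assumes "v \<noteq> 0" "\<kappa> < 1" "\<And>i. 0 < i \<Longrightarrow> i < j \<Longrightarrow> sigma (k0 - int i) = 0"
  shows "0 < Re (b (chain j) (chain j))"
  using assms(3)
proof (induction j)
  case 0
  show ?case using h_pos[OF assms(1)] by (simp add: chain_def b_lw)
next
  case (Suc j)
  then have "0 < Re (b (chain j) (chain j))" by simp
  moreover have "0 < 2 * (real (Suc j) - \<kappa>)" using assms(2) by simp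
  ultimately show ?case using b_chain[of j] Suc.prems
    by (simp only: less_Suc_eq_le Re_of_real_mult) simp
qed

text \<open>Before degree n the reflection sum does not disturb the chain, so its member in degree n
  - 1 has positive norm. The test vector of either sign \<open>e\<close> has this norm times 4(n -
  \<kappa> + e sigma).\<close>

lemma sigma_bound:
  assumes psd: "\<And>u. 0 \<le> Re (b u u)" and "v \<noteq> 0" "\<kappa> < 1" "0 < n"
    and sig: "\<And>i. 0 < i \<Longrightarrow> i < n \<Longrightarrow> sigma (k0 - int i) = 0"
  shows "\<bar>sigma (k0 - int n)\<bar> \<le> real n - \<kappa>"
proof -
  obtain j where n: "n = Suc j" using \<open>0 < n\<close> by (cases n) auto
  let ?t = "real n - \<kappa>" and ?s = "sigma (k0 - int n)"
  have pos: "0 < Re (b (chain j) (chain j))"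
    using assms(2,3) sig n by (intro b_chain_pos) auto
  have sig': "sigma (k0 - int i) = 0" if "0 < i" "i \<le> j" for i using sig that n by simp
  have "0 \<le> ?t + e * ?s" if e: "e = 1 \<or> e = - 1" for e :: real
  proof -
    define y where "y = chain n + scal (of_real e) (sgrp (chain n))"
    have ee: "complex_of_real e * complex_of_real e = 1" using e by auto
    have sy: "sgrp y = scal (of_real e) y"
      by (simp add: y_def lin_simps[OF lin_sgrp] sgrp_sgrp V.scale_right_distrib ee add.commute)
    have D: "dunkl zbv y = scal (of_real (2 * (?t + e * ?s))) (chain j)"
    proof -
      have 1: "dunkl zbv (chain (Suc j)) = scal (of_real (2 * (real (Suc j) - \<kappa>))) (chain j)"
        by (rule dunkl_chain) (rule sig')
      have 2: "dunkl zbv (sgrp (chain (Suc j))) = scal (of_real (2 * sigma (k0 - int (Suc j)))) (chain j)"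
        by (rule dunkl_sgrp_chain) (rule sig')
      have "dunkl zbv y = scal (of_real (2 * ?t) + of_real e * of_real (2 * ?s)) (chain j)"
        unfolding y_def n lin_add[OF lin_dunkl] lin_scal[OF lin_dunkl] 1 2
        by (simp only: V.scale_left_distrib V.scale_scale)
      also have "of_real (2 * ?t) + of_real e * of_real (2 * ?s) = complex_of_real (2 * (?t + e * ?s))"
        by (simp add: algebra_simps)
      finally show ?thesis .
    qed
    have "chain n = mulx zv (chain j)" by (simp add: n chain_def mulx_zv)
    then have 1: "b (chain n) y = of_real (2 * (?t + e * ?s)) * b (chain j) (chain j)"
      by (simp only: b_mulx_left vcnj_zv D b_scal_right complex_cnj_complex_of_real)
    \<comment> \<open>\<open>sgrp\<close> is self-adjoint and \<open>y\<close> is an eigenvector of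
      it for the sign \<open>e\<close>, so both halves of \<open>y\<close> contribute
      equally.\<close>
    have "b (sgrp (chain n)) y = of_real e * b (chain n) y"
      by (simp add: b_sgrp sy b_scal_right)
    then have "b y y = b (chain n) y + of_real e * (of_real e * b (chain n) y)"
      by (subst (1) y_def) (simp add: b_add_left b_scal_left)
    then have "b y y = 2 * b (chain n) y" by (simp add: mult.assoc[symmetric] ee)
    then have "b y y = of_real (4 * (?t + e * ?s)) * b (chain j) (chain j)"
      unfolding 1 by simp
    then have "0 \<le> 4 * (?t + e * ?s) * Re (b (chain j) (chain j))"
      using psd[of y] by (simp only: Re_of_real_mult)
    then show ?thesis using pos by (simp add: zero_le_mult_iff)
  qed
  from this[of 1] this[of "- 1"] show ?thesis by simp
qed

lemma kappa_bound:
  assumes psd: "\<And>u. 0 \<le> Re (b u u)" and "v \<noteq> 0"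
  shows "\<kappa> \<le> 1"
proof -
  have "b (chain 1) (chain 1) = of_real (2 * (1 - \<kappa>)) * h v v"
    using b_chain[of 0] by (simp add: chain_def b_lw)
  then have "0 \<le> 2 * (1 - \<kappa>) * Re (h v v)"
    using psd[of "chain 1"] by (simp only: Re_of_real_mult)
  then show ?thesis using h_pos[OF assms(2)] by (simp add: zero_le_mult_iff)
qed

end

text \<open>For \<open>\<kappa> = 1\<close> the linear polynomials are singular, so the form lives in degree zero only.\<close>

lemma psd_kappa_1:
  assumes "\<kappa> = 1" and p0: "\<And>u. homog 1 u \<Longrightarrow> proj 1 u = 0" "\<And>u. homog 1 u \<Longrightarrow> proj (- 1) u = 0"
  shows "0 \<le> Re (b u u)"
proof -
  have rad1: "u \<in> rad" if u: "homog 1 u" for u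
  proof -
    \<comment> \<open>Neither critical character occurs in degree 1, so there the Euler element acts
      by 1 - \<kappa> = 0.\<close>
    have "csum u = 0" using p0 homog_sgrp[OF u] by (simp add: csum_eq)
    then have "euler u = 0" using euler_hom[OF u] assms(1) by simp
    then have e: "b (dunkl (axis 1 1) u) (dunkl (axis 1 1) u) + b (dunkl (axis 2 1) u) (dunkl (axis 2 1) u) = 0"
      using b_euler[of u u] by simp
    have D: "homog 0 (dunkl y u)" for y using homog_dunkl[of 0 u y] u by simp
    have "dunkl y u = 0" if "Re (b (dunkl y u) (dunkl y u)) = 0" for y
    proof -
      have *: "dunkl y u = lw (lookup (dunkl y u) (0, 0))" by (rule homog_0_eq[OF D])
      then have "Re (h (lookup (dunkl y u) (0, 0)) (lookup (dunkl y u) (0, 0))) = 0"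
        using that b_lw by metis
      then have "lookup (dunkl y u) (0, 0) = 0" using h_pos by (metis less_irrefl)
      then show ?thesis using * by (simp add: lw_def)
    qed
    moreover have "Re (b (dunkl (axis 1 1) u) (dunkl (axis 1 1) u)) = 0"
      "Re (b (dunkl (axis 2 1) u) (dunkl (axis 2 1) u)) = 0"
      using psd_hom_0[OF D[of "axis 1 1"]] psd_hom_0[OF D[of "axis 2 1"]] arg_cong[OF e, of Re] by simp_all
    ultimately have "dunkl (axis 1 1) u = 0" "dunkl (axis 2 1) u = 0" by blast+
    then have D0: "dunkl y u = 0" for y
      by (subst vec2_expansion[of y]) (simp add: dunkl_add_vec dunkl_scale_vec)
    have "lookup u (0, 0) = 0" using u[unfolded homog_def, rule_format, of "(0, 0)"] by auto
    then have "b u v = 0" for v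
      by (induction v rule: vpoly_induct_x) (simp_all add: b_lw_right b_mulx_right D0 b_add_right)
    then show ?thesis by (simp add: rad_def)
  qed
  have "homog n u \<Longrightarrow> 0 < n \<Longrightarrow> u \<in> rad" for n u
  proof (induction rule: homog_induct)
    case (single i j v)
    \<comment> \<open>Every monomial of positive degree is a multiple of a linear one, and the
      radical is stable under multiplication.\<close>
    have "single (i, j) v \<in> rad" if "0 < i + j" for i j
      using that
    proof (induction "i + j" arbitrary: i j)
      case (Suc m)
      show ?case
      proof (cases "m = 0")
        case True
        then show ?thesis using rad1 homog_single[of i j 1 v] Suc.hyps(2) by simp
      next
        case False
        show ?thesis
        proof (cases i)
          case 0
          then have "single (i, j - 1) v \<in> rad" using Suc False by auto
          then show ?thesis using invariantD(4)[OF invariant_rad, of _ zbv] Suc.hyps(2) 0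
            by (force simp: mulx_zbv mulzb_single)
        next
          case (Suc i')
          then have "single (i', j) v \<in> rad" using Suc.hyps False \<open>Suc m = i + j\<close> by auto
          then show ?thesis using invariantD(4)[OF invariant_rad, of _ zv] Suc
            by (force simp: mulx_zv mulz_single)
        qed
      qed
    qed simp
    then show ?case using single by (metis add_gr_0)
  qed (auto intro: invariantD[OF invariant_rad])
  then have "0 \<le> Re (b u u)" if "homog n u" for n u
    using that psd_hom_0[of u] by (cases "n = 0") (auto simp: rad_def)
  then show ?thesis by (rule psd_hom_imp_psd)
qed

end

section \<open>The unitary loci\<close>

lemma not_dvd_small: "m \<noteq> 0 \<Longrightarrow> \<bar>m\<bar> < int n \<Longrightarrow> \<not> int n dvd m"
  using dvd_imp_le_int[of m "int n"] by auto

section \<open>Characters and weights in low degrees\<close>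

context dunkl_setup
begin

lemma proj_1_single:
  assumes "wt m (lw v)" "m + int j - int i \<noteq> 0" "\<bar>m + int j - int i\<bar> < 2 * int d"
  shows "proj 1 (single (i, j) v) = 0"
  using proj_1_wt[OF wt_single[OF assms(1), of j i]] not_dvd_small[OF assms(2), of "2 * d"] assms(3) by simp

lemma proj_minus_1_single:
  assumes "wt m (lw v)" "\<bar>m + int j - int i\<bar> < int d"
  shows "proj (- 1) (single (i, j) v) = 0"
  using proj_minus_1_wt[OF wt_single[OF assms(1), of j i]]
    not_dvd_small[of "m + int j - int i - int d" "2 * d"] assms(2) by simp

lemma wt_rgrp: "wt m u \<Longrightarrow> wt m (rgrp k u)"
proof -
  assume "wt m u"
  then have "rgrp k (rgrp 1 u) = rgrp k (scal (cis (ang d m)) u)" by (simp add: wt_def eig_def)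
  then show ?thesis by (simp add: wt_def eig_def rgrp_add lin_simps[OF lin_rgrp] add.commute)
qed

end

context two_params
begin

lemma sigma_small: "m \<noteq> 0 \<Longrightarrow> \<bar>m\<bar> < int d \<Longrightarrow> sigma m = 0"
  using not_dvd_small[of m "2 * d"] not_dvd_small[of "m - int d" "2 * d"] by (simp add: sigma_def)

lemma sigma_0: "sigma 0 = real d * (p + q)"
  by (simp add: sigma_def)

lemma sigma_minus_d: "sigma (- int d) = real d * (p - q)"
  using not_dvd_small[of "- int d" "2 * d"] d_pos by (simp add: sigma_def)

end

lemma is_representation_trivial: "is_representation d trivial_rep"
  by (simp add: is_representation_def trivial_rep_def)

lemma is_irreducible_trivial: "is_irreducible d trivial_rep"
  unfolding is_irreducible_def
proof (intro conjI allI impI is_representation_trivial)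
  fix V :: "(complex^1) set"
  assume "vec.subspace V \<and> (\<forall>w\<in>dihedral d. (*v) (trivial_rep w) ` V \<subseteq> V)"
  then have V: "vec.subspace V" by blast
  show "V = {0} \<or> V = UNIV"
  proof (cases "V \<subseteq> {0}")
    case True
    then show ?thesis using vec.subspace_0[OF V] by blast
  next
    case False
    then obtain v where v: "v \<in> V" "v \<noteq> 0" by blast
    then have "v $ 1 \<noteq> 0" by (simp add: vec_eq_iff)
    then have "x = (x $ 1 / v $ 1) *s v" for x by (simp add: vec_eq_iff)
    then have "x \<in> V" for x using vec.subspace_scale[OF V v(1)] by metis
    then show ?thesis by blast
  qed
qed

text \<open>The lowest weight is 0; it recurs first in degree 2, and weight d modulo 2d appears
  first in degree d. The first fact makes \<kappa> < 1 suffice for the rotation-invariant part, and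
  the second gives the condition of degree d, which amounts to p and q being at most 1/2.\<close>

lemma unitary_trivial_iff:
  assumes d: "d \<ge> 2" and "two_params d c trivial_rep p q" and ip: "is_invariant_inner_product d trivial_rep h"
  shows "is_unitary d c trivial_rep h \<longleftrightarrow>
    (p + q < 1 / real d \<and> p \<le> 1 / 2 \<and> q \<le> 1 / 2) \<or> p + q = 1 / real d"
proof -
  interpret two_params d c trivial_rep p q by fact
  define \<kappa> where "\<kappa> = real d * (p + q)"
  have wt: "wt 0 (lw v)" for v by (simp add: lw_wt_iff trivial_rep_def ang_0)
  have kap: "csum (lw v) = scal (of_real \<kappa>) (lw v)" for v
    using csum_wt[OF wt[of v]] by (simp add: sigma_0 \<kappa>_def sgrp_def grp_lw trivial_rep_def)
  interpret irreducible_setup d c trivial_rep \<kappa>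
    by unfold_locales (rule is_irreducible_trivial, rule kap)
  interpret inner_setup d c trivial_rep h by unfold_locales (rule ip)
  have kappa_less: "\<kappa> < 1 \<longleftrightarrow> p + q < 1 / real d" and kappa_eq: "\<kappa> = 1 \<longleftrightarrow> p + q = 1 / real d"
    using d_pos by (auto simp: \<kappa>_def field_simps)
  have half: "\<bar>real d * (p - q)\<bar> \<le> real d - \<kappa> \<longleftrightarrow> p \<le> 1 / 2 \<and> q \<le> 1 / 2"
  proof -
    \<comment> \<open>Inserting \<kappa> = d(p + q), the two signs of the absolute value leave 2dp
      \<le> d and 2dq \<le> d.\<close>
    have "\<bar>real d * (p - q)\<bar> \<le> real d - \<kappa> \<longleftrightarrow> real d * p \<le> real d * (1 / 2) \<and> real d * q \<le> real d * (1 / 2)"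
      by (auto simp: \<kappa>_def abs_le_iff algebra_simps)
    then show ?thesis using d_pos by (simp only: mult_le_cancel_left_pos of_nat_0_less_iff)
  qed
  have p1: "proj 1 u = 0" if "homog 1 u" for u
    using d by (intro proj_homog_0[OF _ that] proj_1_single[OF wt]) (auto, presburger)
  have p2: "proj (- 1) u = 0" if "homog n u" "n < d" for n u
    using that(2) by (intro proj_homog_0[OF _ that(1)] proj_minus_1_single[OF wt]) auto
  show ?thesis
  proof
    assume "is_unitary d c trivial_rep h"
    then obtain b where b: "contravariant h b" and psd: "\<And>u. 0 \<le> Re (b u u)"
      using is_unitary_iff[OF ip] by blast
    interpret two_params_form d c trivial_rep p q \<kappa> h b by unfold_locales (rule ip, rule b)
    have ne: "(axis 1 1 :: complex^1) \<noteq> 0" by (simp add: axis_eq_0_iff)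
    have "\<kappa> \<le> 1" by (rule kappa_bound[OF wt psd ne])
    \<comment> \<open>Strictness keeps the norms along the chain positive below degree d; at
      \<kappa> = 1 the chain already has norm 0 in degree 1.\<close>
    moreover have "\<bar>sigma (0 - int d)\<bar> \<le> real d - \<kappa>" if "\<kappa> < 1"
      using d_pos that by (intro sigma_bound[OF wt psd ne]) (auto intro: sigma_small)
    ultimately show "(p + q < 1 / real d \<and> p \<le> 1 / 2 \<and> q \<le> 1 / 2) \<or> p + q = 1 / real d"
      using half by (auto simp: sigma_minus_d kappa_less[symmetric] kappa_eq[symmetric])
  next
    assume pq: "(p + q < 1 / real d \<and> p \<le> 1 / 2 \<and> q \<le> 1 / 2) \<or> p + q = 1 / real d"
    interpret two_params_form d c trivial_rep p q \<kappa> h form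
      by unfold_locales (rule ip, rule contravariant_form)
    have "0 \<le> Re (form u u)" for u
    proof (cases "\<kappa> = 1")
      case True
      then show ?thesis using p1 p2[of 1] d by (intro psd_kappa_1) auto
    next
      case False
      then have k: "\<kappa> < 1" and h2: "\<bar>real d * (p - q)\<bar> \<le> real d - \<kappa>"
        using pq half kappa_less kappa_eq by auto
      show ?thesis
      proof (rule psd_hom_imp_psd, rule psd_homog)
        fix n :: nat assume n: "1 \<le> n"
        show "\<kappa> \<le> real n" using k n by linarith
        show "(\<forall>u. homog n u \<longrightarrow> proj 1 u = 0) \<or> \<bar>real d * (p + q)\<bar> \<le> real n - \<kappa>"
        proof (cases "n = 1")
          case False
          then have "2 \<le> n" using n by simp
          then have "2 \<le> real n" by simp
          \<comment> \<open>For \<kappa> \<ge> 0 this is 2 \<kappa> < 2 \<le> n, and for negative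
            \<kappa> it is 0 \<le> n.\<close>
          then have "\<bar>\<kappa>\<bar> \<le> real n - \<kappa>" using k by linarith
          then show ?thesis by (simp add: \<kappa>_def)
        qed (use p1 in simp)
        show "(\<forall>u. homog n u \<longrightarrow> proj (- 1) u = 0) \<or> \<bar>real d * (p - q)\<bar> \<le> real n - \<kappa>"
          using h2 p2[of n] by (cases "n < d") auto
      qed
    qed
    then show "is_unitary d c trivial_rep h"
      using is_unitary_iff[OF ip] contravariant_form by blast
  qed
qed

text \<open>\<tau> is spanned by vectors of weights l and -l. The chain from weight l meets weight 0
  in degree l, and the chain from weight -l meets weight -d in degree d - l: these give the
  necessary bounds. No smaller degree contains the characters 1 and -1 respectively, which gives
  sufficiency.\<close>

lemma unitary_tau_iff:
  assumes l: "1 \<le> l" "l < d" and "two_params d c \<rho> p q" and tau: "is_tau d l \<rho>"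
    and ip: "is_invariant_inner_product d \<rho> h"
  shows "is_unitary d c \<rho> h \<longleftrightarrow>
    \<bar>p + q\<bar> \<le> real l / real d \<and> \<bar>p - q\<bar> \<le> (real d - real l) / real d"
proof -
  interpret two_params d c \<rho> p q by fact
  have irr: "is_irreducible d \<rho>" using tau by (simp add: is_tau_def)
  have "cis (ang d (int l)) = exp (2 * of_real pi * \<i> / of_nat (2 * d)) ^ l"
    by (simp add: cis_conv_exp ang_def exp_of_nat_mult[symmetric] field_simps)
  then have "cis (ang d (int l)) \<in> {k. \<exists>v. v \<noteq> 0 \<and> \<rho> (rotation d) *v v = k *s v}"
    using tau unfolding is_tau_def Let_def by simp
  then obtain v where v: "v \<noteq> 0" "wt (int l) (lw v)" by (auto simp: lw_wt_iff)
  define v' where "v' = \<rho> (refm 0) *v v"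
  have lw_v': "lw v' = sgrp (lw v)" by (simp add: v'_def sgrp_def grp_lw)
  have v': "v' \<noteq> 0" "wt (- int l) (lw v')"
  proof -
    show "wt (- int l) (lw v')" unfolding lw_v' by (rule wt_sgrp[OF v(2)])
    have "lw v = sgrp (lw v')" by (simp add: lw_v' sgrp_sgrp)
    moreover have "lw v \<noteq> 0" using v(1) by (auto simp: lw_def poly_mapping_eq_iff lookup_single fun_eq_iff when_def)
    ultimately show "v' \<noteq> 0" by (auto simp: lw_def lin_0[OF lin_sgrp])
  qed
  \<comment> \<open>The sum of the two weight spaces is a subrepresentation, since rotations
    preserve each of them and reflections exchange them. It contains \<open>v\<close>, so it is
    everything.\<close>
  define T where "T = {x. \<exists>x1 x2. x = x1 + x2 \<and> wt (int l) (lw x1) \<and> wt (- int l) (lw x2)}"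
  have wt_lin: "wt m (lw (x + y))" "wt m (lw (k *s x))" if "wt m (lw x)" "wt m (lw y)" for m x y k
    using that by (simp_all add: wt_def eig_def lw_add lw_scale lin_simps[OF lin_rgrp] V.scale_right_distrib
        mult.commute)
  have wt_0: "wt m (lw 0)" for m by (simp add: wt_def eig_def lw_def lin_0[OF lin_rgrp])
  have T: "T = UNIV"
  proof -
    have "vec.subspace T"
      unfolding vec.subspace_def
    proof (intro conjI ballI allI)
      show "0 \<in> T" unfolding T_def using wt_0 by (intro CollectI exI[of _ 0]) simp
    next
      fix x y assume "x \<in> T" "y \<in> T"
      then obtain x1 x2 y1 y2 where *: "x = x1 + x2" "y = y1 + y2" "wt (int l) (lw x1)" "wt (- int l) (lw x2)"
        "wt (int l) (lw y1)" "wt (- int l) (lw y2)" unfolding T_def by blast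
      then have "x + y = (x1 + y1) + (x2 + y2)" by simp
      then show "x + y \<in> T" unfolding T_def using *(3-6) wt_lin(1) by blast
    next
      fix k x assume "x \<in> T"
      then obtain x1 x2 where *: "x = x1 + x2" "wt (int l) (lw x1)" "wt (- int l) (lw x2)"
        unfolding T_def by blast
      then have "k *s x = k *s x1 + k *s x2" by (simp add: vec.scale_right_distrib)
      then show "k *s x \<in> T" unfolding T_def using *(2,3) wt_lin(2) by blast
    qed
    moreover have "\<forall>w\<in>dihedral d. (*v) (\<rho> w) ` T \<subseteq> T"
    proof (intro ballI subsetI)
      fix w y assume w: "w \<in> dihedral d" and "y \<in> (*v) (\<rho> w) ` T"
      then obtain x1 x2 where *: "y = \<rho> w *v (x1 + x2)" "wt (int l) (lw x1)" "wt (- int l) (lw x2)"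
        unfolding T_def by blast
      then have y: "y = \<rho> w *v x1 + \<rho> w *v x2" "y = \<rho> w *v x2 + \<rho> w *v x1"
        by (simp_all add: matrix_vector_right_distrib add.commute)
      from d_pos w show "y \<in> T"
      proof (cases rule: dihedral_cases)
        case (1 k)
        have "lw (\<rho> w *v x) = rgrp k (lw x)" for x by (simp add: 1 rgrp_def grp_lw)
        then show ?thesis unfolding T_def using y(1) *(2,3) wt_rgrp
          by (intro CollectI exI[of _ "\<rho> w *v x1"] exI[of _ "\<rho> w *v x2"]) simp
      next
        case (2 k)
        have "lw (\<rho> w *v x) = rgrp k (sgrp (lw x))" for x by (simp add: 2 grp_refm[symmetric] grp_lw)
        then show ?thesis unfolding T_def
          using y(2) wt_rgrp[OF wt_sgrp[OF *(2)]] wt_rgrp[OF wt_sgrp[OF *(3)]]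
          by (intro CollectI exI[of _ "\<rho> w *v x2"] exI[of _ "\<rho> w *v x1"]) simp
      qed
    qed
    moreover have "v \<in> T" unfolding T_def using v(2) wt_0
      by (intro CollectI exI[of _ v] exI[of _ 0]) simp
    ultimately show ?thesis using irr v(1) unfolding is_irreducible_def by blast
  qed
  have split: thesis if "\<And>x1 x2. x = x1 + x2 \<Longrightarrow> wt (int l) (lw x1) \<Longrightarrow> wt (- int l) (lw x2) \<Longrightarrow> thesis" for x thesis
    using T that unfolding T_def by blast
  \<comment> \<open>As 0 < l < d, neither l nor -l is 0 or d modulo 2d, so the reflection sum
    vanishes on \<tau>.\<close>
  have kap: "csum (lw x) = scal (of_real 0) (lw x)" for x
  proof (rule split[of x])
    fix x1 x2 assume *: "x = x1 + x2" "wt (int l) (lw x1)" "wt (- int l) (lw x2)"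
    show ?thesis using l csum_wt[OF *(2)] csum_wt[OF *(3)]
      by (simp add: *(1) lw_add lin_simps[OF lin_csum] sigma_small)
  qed
  interpret irreducible_setup d c \<rho> 0
    by unfold_locales (rule irr, rule kap)
  interpret inner_setup d c \<rho> h by unfold_locales (rule ip)
  have p1: "proj 1 u = 0" if "homog n u" "n < l" for n u
  proof (rule proj_homog_0[OF _ that(1)])
    fix i j x assume n: "i + j = n"
    show "proj 1 (single (i, j) x) = 0"
    proof (rule split[of x])
      fix x1 x2 assume *: "x = x1 + x2" "wt (int l) (lw x1)" "wt (- int l) (lw x2)"
      have "proj 1 (single (i, j) x1) = 0" "proj 1 (single (i, j) x2) = 0"
        using n that(2) l by (auto intro!: proj_1_single[OF *(2)] proj_1_single[OF *(3)])
      then show ?thesis by (simp add: *(1) single_add lin_simps[OF lin_proj])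
    qed
  qed
  have p2: "proj (- 1) u = 0" if "homog n u" "n < d - l" for n u
  proof (rule proj_homog_0[OF _ that(1)])
    fix i j x assume n: "i + j = n"
    show "proj (- 1) (single (i, j) x) = 0"
    proof (rule split[of x])
      fix x1 x2 assume *: "x = x1 + x2" "wt (int l) (lw x1)" "wt (- int l) (lw x2)"
      have "proj (- 1) (single (i, j) x1) = 0" "proj (- 1) (single (i, j) x2) = 0"
        using n that(2) l by (auto intro!: proj_minus_1_single[OF *(2)] proj_minus_1_single[OF *(3)])
      then show ?thesis by (simp add: *(1) single_add lin_simps[OF lin_proj])
    qed
  qed
  have bounds: "\<bar>real d * (p + q)\<bar> \<le> real l \<longleftrightarrow> \<bar>p + q\<bar> \<le> real l / real d"
    "\<bar>real d * (p - q)\<bar> \<le> real (d - l) \<longleftrightarrow> \<bar>p - q\<bar> \<le> (real d - real l) / real d"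
    using d_pos l unfolding abs_mult abs_of_nat
    by (simp_all add: pos_le_divide_eq of_nat_diff mult.commute)
  show ?thesis
    unfolding bounds[symmetric]
  proof
    assume "is_unitary d c \<rho> h"
    then obtain b where b: "contravariant h b" and psd: "\<And>u. 0 \<le> Re (b u u)"
      using is_unitary_iff[OF ip] by blast
    interpret two_params_form d c \<rho> p q 0 h b by unfold_locales (rule ip, rule b)
    have "\<bar>sigma (int l - int l)\<bar> \<le> real l - 0"
      using l by (intro sigma_bound[OF v(2) psd v(1)]) (auto intro!: sigma_small)
    moreover have "\<bar>sigma (- int l - int (d - l))\<bar> \<le> real (d - l) - 0"
      using l by (intro sigma_bound[OF v'(2) psd v'(1)]) (auto intro!: sigma_small)
    moreover have "- int l - int (d - l) = - int d" using l by simp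
    ultimately show "\<bar>real d * (p + q)\<bar> \<le> real l \<and> \<bar>real d * (p - q)\<bar> \<le> real (d - l)"
      by (simp add: sigma_0 sigma_minus_d)
  next
    assume pq: "\<bar>real d * (p + q)\<bar> \<le> real l \<and> \<bar>real d * (p - q)\<bar> \<le> real (d - l)"
    interpret two_params_form d c \<rho> p q 0 h form
      by unfold_locales (rule ip, rule contravariant_form)
    have "0 \<le> Re (form u u)" for u
    proof (rule psd_hom_imp_psd, rule psd_homog)
      fix n :: nat
      show "(0::real) \<le> real n" by simp
      show "(\<forall>u. homog n u \<longrightarrow> proj 1 u = 0) \<or> \<bar>real d * (p + q)\<bar> \<le> real n - 0"
      proof (cases "n < l")
        case False
        then have "real l \<le> real n" by simp
        then show ?thesis using pq by linarith
      qed (use p1 in blast)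
      show "(\<forall>u. homog n u \<longrightarrow> proj (- 1) u = 0) \<or> \<bar>real d * (p - q)\<bar> \<le> real n - 0"
      proof (cases "n < d - l")
        case False
        then have "real (d - l) \<le> real n" by simp
        then show ?thesis using pq by linarith
      qed (use p2 in blast)
    qed
    then show "is_unitary d c \<rho> h"
      using is_unitary_iff[OF ip] contravariant_form by blast
  qed
qed

text \<open>The parity of the index \<open>i\<close> of the first generator decides whether its
  class consists of the even or of the odd reflections.\<close>

lemma two_params_param:
  assumes "d > 0" "is_representation d \<rho>"
  shows "two_params d (param d (refm (ang d i)) c1 c2) \<rho>
    (if even i then c1 else c2) (if even i then c2 else c1)"
proof unfold_locales
  have s: "refm (ang d i) \<in> reflections d" using reflections_eq[OF assms(1)] by blast
  show "0 < d" "is_representation d \<rho>" by fact+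
  show "param d (refm (ang d i)) c1 c2 (w ** s ** matrix_inv w) = param d (refm (ang d i)) c1 c2 s"
    if "w \<in> dihedral d" "s \<in> reflections d" for w s
    by (rule param_conj[OF assms(1) s that])
  show "param d (refm (ang d i)) c1 c2 (refm (ang d k)) =
      (if even k then if even i then c1 else c2 else if even i then c2 else c1)" for k
    by (simp add: param_refm[OF assms(1)])
qed

theorem proposition4p4:
  fixes d :: nat and s1 s2 :: "real^2^2"
  assumes "d \<ge> 2" and "coxeter_generators d s1 s2"
  shows "(\<forall>h. is_invariant_inner_product d trivial_rep h \<longrightarrow>
            unitary_locus d s1 trivial_rep h =
              {(c1, c2). c1 + c2 < 1 / real d \<and> c1 \<le> 1 / 2 \<and> c2 \<le> 1 / 2} \<union>
              {(c1, c2). c1 + c2 = 1 / real d}) \<and>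
         (\<forall>l \<rho> h. 1 \<le> l \<and> l \<le> d - 1 \<and> is_tau d l \<rho> \<and> is_invariant_inner_product d \<rho> h \<longrightarrow>
            unitary_locus d s1 \<rho> h =
              {(c1, c2). \<bar>c1 + c2\<bar> \<le> real l / real d \<and> \<bar>c1 - c2\<bar> \<le> (real d - real l) / real d})"
proof -
  have d: "d > 0" using assms(1) by simp
  have "s1 \<in> reflections d" using assms(2) by (simp add: coxeter_generators_def)
  from reflections_cases[OF d this] obtain i where s1: "s1 = refm (ang d i)" .
  show ?thesis
  proof (intro conjI allI impI)
    fix h assume h: "is_invariant_inner_product d trivial_rep h"
    \<comment> \<open>For odd \<open>i\<close> the parameters enter in exchanged order; the region
      is symmetric in them.\<close>
    have "is_unitary d (param d s1 c1 c2) trivial_rep h \<longleftrightarrow>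
      (c1 + c2 < 1 / real d \<and> c1 \<le> 1 / 2 \<and> c2 \<le> 1 / 2) \<or> c1 + c2 = 1 / real d" for c1 c2
      using unitary_trivial_iff[OF assms(1) two_params_param[OF d is_representation_trivial, of i c1 c2] h]
      unfolding s1 by (auto simp: add.commute split: if_splits)
    then show "unitary_locus d s1 trivial_rep h =
              {(c1, c2). c1 + c2 < 1 / real d \<and> c1 \<le> 1 / 2 \<and> c2 \<le> 1 / 2} \<union>
              {(c1, c2). c1 + c2 = 1 / real d}"
      unfolding unitary_locus_def by auto
  next
    fix l and \<rho> :: "real^2^2 \<Rightarrow> complex^2^2" and h
    assume *: "1 \<le> l \<and> l \<le> d - 1 \<and> is_tau d l \<rho> \<and> is_invariant_inner_product d \<rho> h"
    then have l: "1 \<le> l" "l < d" using d by auto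
    have rep: "is_representation d \<rho>" using * by (simp add: is_tau_def is_irreducible_def)
    \<comment> \<open>The exchange for odd \<open>i\<close> only changes the sign of the difference
      \<open>c1 - c2\<close>.\<close>
    have "is_unitary d (param d s1 c1 c2) \<rho> h \<longleftrightarrow>
      \<bar>c1 + c2\<bar> \<le> real l / real d \<and> \<bar>c1 - c2\<bar> \<le> (real d - real l) / real d" for c1 c2
      using unitary_tau_iff[OF l two_params_param[OF d rep, of i c1 c2], of h] *
      unfolding s1 by (cases "even i") (simp_all add: add.commute[of c2] abs_minus_commute[of c2])
    then show "unitary_locus d s1 \<rho> h =
              {(c1, c2). \<bar>c1 + c2\<bar> \<le> real l / real d \<and> \<bar>c1 - c2\<bar> \<le> (real d - real l) / real d}"
      unfolding unitary_locus_def by auto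
  qed
qed

end
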